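(* Let $X=\mathbb{A}^9_{\mathbb{R}}$ be the affine space of $3\times3$ matrices $C$ over $\mathbb{R}$, and let the real algebraic group $G=\operatorname{SO}_3\times\operatorname{SO}_3$ act on $X$ by $(R_1,R_2)\cdot C=R_1CR_2^{t}$. Let $$X_0=\{C\in X: CC^t\text{ has distinct eigenvalues}\}\subseteq X,$$ and let $\Delta\in\mathbb{R}[X]^G$ be the discriminant of the characteristic polynomial of $CC^t$. Then the algebraic quotient $$X_0/\!/G=\operatorname{Spec}(\mathbb{R}[X_0]^G)=\operatorname{Spec}(\mathbb{R}[X]^G[\Delta^{-1}])$$ is a geometric quotient of $X_0$ by $G$, and therefore a geometric rational quotient for the action of $G$ on $X$.
   Context: The space $X$ is the Bloch matrix model of the variety of locally maximally mixed states of two qubits; $C$ is the matrix of 2-point correlation functions and $G$ acts through local unitary operators. $X_0$ is the open subscheme $\{\Delta\neq 0\}$ of $X$. For an affine variety $X$ over a field $k$ of characteristic zero with an action of a reductive $k$-group $G$, the algebraic quotient $X/\!/G$ is $\operatorname{Spec}(k[X]^G)$. A geometric quotient of $X$ by $G$ is a $k$-variety $Y$ with a $k$-morphism $f:X\to Y$ such that (i) $f$ is open, constant on $G$-orbits, and induces a bijection $X(\bar k)/G(\bar k)\leftrightarrow Y(\bar k)$, where $\bar k$ is an algebraically closed field containing $k$; and (ii) for every open $V\subseteq Y$ the natural morphism $k[V]\to k[f^{-1}(V)]^G$ is an isomorphism. A geometric rational quotient of $X$ by $G$ is a geometric quotient of the form $Y=U/G$ where $U\subseteq X$ is an open dense $G$-invariant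 subset. Here $k=\mathbb{R}$, $\bar k=\mathbb{C}$, and the morphism $X_0\to X_0/\!/G$ is the one induced by $\mathbb{R}[X_0]^G\subseteq\mathbb{R}[X_0]$. *)

theory Defs
  imports
    "Subresultants.Resultant_Prelim"
    "HOL-Algebra.Algebra"
    "HOL-Algebra.Algebraic_Closure_Type"
    "HOL-Analysis.Analysis"
    "HOL-Analysis.Finite_Function_Topology"
begin

section \<open>Integral real affine varieties and their open subschemes\<close>

text \<open>
  All coordinate rings live in a fixed field \<open>'k\<close> containing the reals. An integral affine
  variety is given by its coordinate ring, a finitely generated real subalgebra \<open>A\<close> of \<open>'k\<close>; its
  points are the prime ideals of \<open>A\<close>. An open subscheme is given by the set \<open>U\<close> of its points.
\<close>

text \<open>
  The class of real algebras with unit is not used, since the library's type of fractions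
  cannot be made an instance of it.
\<close>

definition real_const :: "real \<Rightarrow> 'k::{field,real_algebra}" where
  "real_const r = r *\<^sub>R 1"

definition subring_of :: "'k::field set \<Rightarrow> 'k ring" where
  "subring_of A = ring_of_type_algebra\<lparr>carrier := A\<rparr>"

definition affine_variety :: "'k::{field,real_algebra} set \<Rightarrow> bool" where
  "affine_variety A \<longleftrightarrow>
     (\<exists>F. finite F \<and> A = generate_ring ring_of_type_algebra (range real_const \<union> F))"

definition Spec :: "'k::field set \<Rightarrow> 'k set set" where
  "Spec A = {p. primeideal p (subring_of A)}"

definition basic_open :: "'k::field set \<Rightarrow> 'k \<Rightarrow> 'k set set" where
  "basic_open A a = {p \<in> Spec A. a \<notin> p}"

definition zariski :: "'k::field set \<Rightarrow> 'k set topology" where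
  "zariski A = topology_generated_by (basic_open A ` A)"

definition local_ring :: "'k::field set \<Rightarrow> 'k set \<Rightarrow> 'k set" where
  "local_ring A p = {a / s | a s. a \<in> A \<and> s \<in> A - p}"

definition max_ideal :: "'k::field set \<Rightarrow> 'k set \<Rightarrow> 'k set" where
  "max_ideal A p = {a / s | a s. a \<in> p \<and> s \<in> A - p}"

text \<open>
  The ring of sections over \<open>U\<close>: as \<open>Spec A\<close> is integral, a section over a nonempty open set is an
  element of the function field lying in every local ring, and restriction maps are inclusions.
  Over the empty set the ring of sections is the zero ring.
\<close>

definition regular :: "'k::field set \<Rightarrow> 'k set set \<Rightarrow> 'k set" where
  "regular A U = (if U = {} then {0} else (\<Inter>p\<in>U. local_ring A p))"

text \<open>
  Complex points of the open subscheme \<open>U\<close> of \<open>Spec A\<close>: homomorphisms of real algebras from \<open>A\<close> to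
  the complex numbers (undefined outside \<open>A\<close>) whose underlying scheme point, the kernel, is in \<open>U\<close>.
\<close>

definition cpoints :: "'k::{field,real_algebra} set \<Rightarrow> 'k set set \<Rightarrow> ('k \<Rightarrow> complex) set" where
  "cpoints A U = {x \<in> ring_hom (subring_of A) ring_of_type_algebra \<inter> extensional A.
     (\<forall>r. x (real_const r) = of_real r) \<and> {a \<in> A. x a = 0} \<in> U}"

text \<open>The value at a complex point of a rational function that is regular there.\<close>

definition val :: "'k::field set \<Rightarrow> ('k \<Rightarrow> complex) \<Rightarrow> 'k \<Rightarrow> complex" where
  "val A x h = (THE v. \<exists>a\<in>A. \<exists>s\<in>A. x s \<noteq> 0 \<and> h = a / s \<and> v = x a / x s)"

text \<open>
  For a subalgebra \<open>B\<close> of \<open>regular A U\<close>, the inclusion induces a morphism from \<open>U\<close> to \<open>Spec B\<close>. The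
  next two definitions give its effect on scheme points and on complex points. On sections it is
  again an inclusion.
\<close>

definition point_map :: "'k::field set \<Rightarrow> 'k set \<Rightarrow> 'k set \<Rightarrow> 'k set" where
  "point_map A B p = B \<inter> max_ideal A p"

definition cpoint_map :: "'k::field set \<Rightarrow> 'k set \<Rightarrow> ('k \<Rightarrow> complex) \<Rightarrow> ('k \<Rightarrow> complex)" where
  "cpoint_map A B x = restrict (val A x) B"

section \<open>Quotients\<close>

text \<open>
  A real algebraic group enters through its group \<open>G\<close> of complex points and the action \<open>\<phi>\<close> of that
  group on complex points. Since the base field has characteristic zero, group schemes are reduced,
  and equality of regular functions (on \<open>G \<times> U\<close>) can be tested on complex points. The spectrum of
  the ring of invariant functions \<open>inv_regular A U G \<phi>\<close> is the algebraic quotient of an affine \<open>U\<close>.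
\<close>

definition inv_regular ::
  "'k::{field,real_algebra} set \<Rightarrow> 'k set set \<Rightarrow> ('g, 'm) monoid_scheme \<Rightarrow>
     ('g \<Rightarrow> ('k \<Rightarrow> complex) \<Rightarrow> ('k \<Rightarrow> complex)) \<Rightarrow> 'k set" where
  "inv_regular A U G \<phi> =
     {h \<in> regular A U. \<forall>g\<in>carrier G. \<forall>x\<in>cpoints A U. val A (\<phi> g x) h = val A x h}"

text \<open>
  Spectrum of \<open>B\<close> as a geometric quotient of the open subscheme \<open>U\<close> of \<open>Spec A\<close>, with respect to the
  morphism induced by the inclusion of \<open>B\<close> in \<open>regular A U\<close>. The natural map from \<open>regular B V\<close> to the
  invariant sections over the preimage of \<open>V\<close> is the inclusion inside \<open>'k\<close>, so that it is an
  isomorphism if and only if the two sets agree.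
\<close>

definition geometric_quotient ::
  "'k::{field,real_algebra} set \<Rightarrow> 'k set set \<Rightarrow> ('g, 'm) monoid_scheme \<Rightarrow>
     ('g \<Rightarrow> ('k \<Rightarrow> complex) \<Rightarrow> ('k \<Rightarrow> complex)) \<Rightarrow> 'k set \<Rightarrow> bool" where
  "geometric_quotient A U G \<phi> B \<longleftrightarrow>
     affine_variety A \<and> openin (zariski A) U \<and> group_action G (cpoints A U) \<phi> \<and>
     affine_variety B \<and> B \<subseteq> regular A U \<and>
     open_map (subtopology (zariski A) U) (zariski B) (point_map A B) \<and>
     (\<forall>g\<in>carrier G. \<forall>x\<in>cpoints A U. cpoint_map A B (\<phi> g x) = cpoint_map A B x) \<and>
     bij_betw (\<lambda>orb. the_elem (cpoint_map A B ` orb))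
       (orbits G (cpoints A U) \<phi>) (cpoints B (Spec B)) \<and>
     (\<forall>V. openin (zariski B) V \<longrightarrow>
        regular B V = inv_regular A {p \<in> U. point_map A B p \<in> V} G \<phi>)"

definition restrict_action ::
  "'x set \<Rightarrow> ('g \<Rightarrow> 'x \<Rightarrow> 'x) \<Rightarrow> 'g \<Rightarrow> 'x \<Rightarrow> 'x" where
  "restrict_action E \<phi> g = restrict (\<phi> g) E"

definition invariant_open ::
  "'k::{field,real_algebra} set \<Rightarrow> 'k set set \<Rightarrow> ('g, 'm) monoid_scheme \<Rightarrow>
     ('g \<Rightarrow> ('k \<Rightarrow> complex) \<Rightarrow> ('k \<Rightarrow> complex)) \<Rightarrow> bool" where
  "invariant_open A U G \<phi> \<longleftrightarrow>
     openin (zariski A) U \<and> (\<forall>g\<in>carrier G. \<forall>x\<in>cpoints A U. \<phi> g x \<in> cpoints A U)"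

definition geometric_rational_quotient ::
  "'k::{field,real_algebra} set \<Rightarrow> ('g, 'm) monoid_scheme \<Rightarrow>
     ('g \<Rightarrow> ('k \<Rightarrow> complex) \<Rightarrow> ('k \<Rightarrow> complex)) \<Rightarrow> 'k set \<Rightarrow> bool" where
  "geometric_rational_quotient A G \<phi> B \<longleftrightarrow>
     group_action G (cpoints A (Spec A)) \<phi> \<and>
     (\<exists>U. invariant_open A U G \<phi> \<and> zariski A closure_of U = Spec A \<and>
        geometric_quotient A U G (restrict_action (cpoints A U) \<phi>) B)"

definition adjoin_inverse :: "'k::field set \<Rightarrow> 'k \<Rightarrow> 'k set" where
  "adjoin_inverse S d = {a / d ^ n | a n. a \<in> S}"

section \<open>The space of 3 by 3 matrices\<close>

text \<open>
  Polynomials are finitely supported functions from monomials to coefficients. The variables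
  are indexed by the entries of a 3 by 3 matrix; a linear order on them is needed only for the
  library's proof that polynomials form an integral domain.
\<close>

datatype entry = Entry (row: 3) (col: 3)

instantiation entry :: linorder
begin

definition less_eq_entry :: "entry \<Rightarrow> entry \<Rightarrow> bool" where
  "e \<le> e' \<longleftrightarrow> row e < row e' \<or> row e = row e' \<and> col e \<le> col e'"

definition less_entry :: "entry \<Rightarrow> entry \<Rightarrow> bool" where
  "e < e' \<longleftrightarrow> row e < row e' \<or> row e = row e' \<and> col e < col e'"

instance
  by intro_classes (auto simp: less_eq_entry_def less_entry_def entry.expand)

end

type_synonym mpoly9 = "(entry \<Rightarrow>\<^sub>0 nat) \<Rightarrow>\<^sub>0 real"

lemma lookup_scaleR:
  "Poly_Mapping.lookup (r *\<^sub>R p) k = r *\<^sub>R Poly_Mapping.lookup (p :: 'a \<Rightarrow>\<^sub>0 'b::real_vector) k"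
proof -
  have "finite {i. r *\<^sub>R Poly_Mapping.lookup p i \<noteq> 0}"
    by (rule finite_subset[OF _ Poly_Mapping.finite_lookup[of p]]) auto
  then show ?thesis
    by (simp add: scaleR_poly_mapping_def Abs_poly_mapping_inverse)
qed

lemma scaleR_eq_single_times:
  fixes p :: "'a::comm_monoid_add \<Rightarrow>\<^sub>0 'b::{real_algebra_1,comm_ring_1}"
  shows "r *\<^sub>R p = Poly_Mapping.single 0 (of_real r) * p"
  unfolding Poly_Mapping.mult_map_scale_conv_mult[symmetric]
  by (rule poly_mapping_eqI)
     (auto simp: lookup_scaleR Poly_Mapping.map.rep_eq scaleR_conv_of_real when_def)

instance poly_mapping ::
  (comm_monoid_add, "{real_algebra_1,comm_ring_1}") real_algebra_1
  by intro_classes (simp_all add: scaleR_eq_single_times ac_simps)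

instantiation fract :: ("{idom,real_algebra_1}") real_algebra
begin

definition scaleR_fract :: "real \<Rightarrow> 'a fract \<Rightarrow> 'a fract" where
  "scaleR_fract r x = to_fract (of_real r) * x"

instance
proof
  fix r s :: real and x y :: "'a fract"
  show "r *\<^sub>R (x + y) = r *\<^sub>R x + r *\<^sub>R y"
    by (simp only: scaleR_fract_def distrib_left)
  show "(r + s) *\<^sub>R x = r *\<^sub>R x + s *\<^sub>R x"
    by (simp only: scaleR_fract_def of_real_add to_fract_add distrib_right)
  show "r *\<^sub>R s *\<^sub>R x = (r * s) *\<^sub>R x"
    by (simp only: scaleR_fract_def of_real_mult to_fract_mult mult.assoc)
  show "1 *\<^sub>R x = x"
    by (simp only: scaleR_fract_def of_real_1 to_fract_1 mult_1_left)
  show "r *\<^sub>R x * y = r *\<^sub>R (x * y)"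
    by (simp only: scaleR_fract_def mult.assoc)
  show "x * r *\<^sub>R y = r *\<^sub>R (x * y)"
    by (simp only: scaleR_fract_def mult.left_commute)
qed

end

definition generic_matrix :: "mpoly9^3^3" where
  "generic_matrix =
     (\<chi> i j. Poly_Mapping.single (Poly_Mapping.single (Entry i j) 1) 1)"

text \<open>The coordinate ring of affine 9-space, inside the field of rational functions.\<close>

definition coord_ring :: "mpoly9 fract set" where
  "coord_ring = range to_fract"

definition eval_at :: "complex^3^3 \<Rightarrow> mpoly9 \<Rightarrow> complex" where
  "eval_at M P = (\<Sum>m \<in> Poly_Mapping.keys P. of_real (Poly_Mapping.lookup P m) *
     (\<Prod>i\<in>UNIV. \<Prod>j\<in>UNIV. M $ i $ j ^ Poly_Mapping.lookup m (Entry i j)))"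

definition matrix_to_point :: "complex^3^3 \<Rightarrow> (mpoly9 fract \<Rightarrow> complex)" where
  "matrix_to_point M = (\<lambda>h\<in>coord_ring. eval_at M (the_inv to_fract h))"

definition point_to_matrix :: "(mpoly9 fract \<Rightarrow> complex) \<Rightarrow> complex^3^3" where
  "point_to_matrix x = (\<chi> i j. x (to_fract (generic_matrix $ i $ j)))"

definition SO3 :: "(complex^3^3) monoid" where
  "SO3 = \<lparr>carrier = {R. orthogonal_matrix R \<and> Determinants.det R = 1},
          monoid.mult = (**), one = Finite_Cartesian_Product.mat 1\<rparr>"

text \<open>The pair \<open>(R1, R2)\<close> sends the matrix \<open>C\<close> to \<open>R1 C R2\<^sup>t\<close>.\<close>

definition matrix_action ::
  "(complex^3^3) \<times> (complex^3^3) \<Rightarrow> (mpoly9 fract \<Rightarrow> complex) \<Rightarrow> (mpoly9 fract \<Rightarrow> complex)" where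
  "matrix_action = (\<lambda>(R1, R2). \<lambda>x\<in>cpoints coord_ring (Spec coord_ring).
     matrix_to_point (R1 ** point_to_matrix x ** Finite_Cartesian_Product.transpose R2))"

definition matrix_group :: "((complex^3^3) \<times> (complex^3^3)) monoid" where
  "matrix_group = SO3 \<times>\<times> SO3"

definition charpoly :: "'a::comm_ring_1^'n^'n \<Rightarrow> 'a poly" where
  "charpoly M = Determinants.det (\<chi> i j. (if i = j then [:0, 1:] else 0) - [:M $ i $ j:])"

text \<open>Discriminant of a monic polynomial.\<close>

definition monic_discriminant :: "'a::idom poly \<Rightarrow> 'a" where
  "monic_discriminant f = (-1) ^ (Polynomial.degree f * (Polynomial.degree f - 1) div 2) * resultant f (pderiv f)"

definition Delta :: "mpoly9 fract" where
  "Delta = to_fract (monic_discriminant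
     (charpoly (generic_matrix ** Finite_Cartesian_Product.transpose generic_matrix)))"

text \<open>The open subscheme where \<open>Delta\<close> is nonzero.\<close>

definition X0 :: "mpoly9 fract set set" where
  "X0 = basic_open coord_ring Delta"

definition matrix_action_X0 ::
  "(complex^3^3) \<times> (complex^3^3) \<Rightarrow> (mpoly9 fract \<Rightarrow> complex) \<Rightarrow> (mpoly9 fract \<Rightarrow> complex)" where
  "matrix_action_X0 = restrict_action (cpoints coord_ring X0) matrix_action"

text \<open>A 3 by 3 matrix has distinct eigenvalues if and only if it has exactly three of them.\<close>

definition distinct_eigenvalues :: "complex^3^3 \<Rightarrow> bool" where
  "distinct_eigenvalues M \<longleftrightarrow> card {l. \<exists>v. v \<noteq> 0 \<and> M *v v = l *s v} = 3"

end

theory Submission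
  imports Defs
begin

text \<open>
  The quotient map is \<open>f(C) = (p, q, d)\<close> with \<open>d = det C\<close> and \<open>p\<close>, \<open>q\<close> the first two elementary symmetric
  functions of the eigenvalues of \<open>C C\<^sup>t\<close>. Two facts about it suffice. First, \<open>f\<close> separates the complex
  orbits where \<open>\<Delta>\<close> is nonzero: unit eigenvectors of \<open>C C\<^sup>t\<close> for two nonzero eigenvalues bring \<open>C\<close> to a
  diagonal form that depends on \<open>f(C)\<close> only. Secondly, \<open>f\<close> has a polynomial section \<open>\<sigma>\<close> over the complex
  numbers. Restriction along \<open>\<sigma>\<close> therefore expresses every invariant function by \<open>p\<close>, \<open>q\<close>, \<open>d\<close> with complex
  coefficients, and real functions by their real parts; the same computation with denominators gives
  the sections over open subsets of the quotient.

  For openness at the level of primes, pull back a polynomial \<open>a\<close> along \<open>b \<mapsto> g \<cdot> \<sigma>(b)\<close> for all \<open>g\<close> in the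
  group, and let \<open>u\<^sub>g\<close>, \<open>v\<^sub>g\<close> be the real and imaginary part. The image of the locus where \<open>a\<close> is nonzero is
  the union of the loci where some \<open>u\<^sub>g\<close> or \<open>v\<^sub>g\<close> is nonzero: one inclusion lifts a prime along such a
  pullback, the other follows from the Nullstellensatz and the separation of orbits.
\<close>

text \<open>Two gaps shape the proof. The spaces consist of primes of real rings, while orbits and
  eigenvectors live on complex points; and \<sigma> has complex coefficients. As \<open>p\<close>,
  \<open>q\<close>, \<open>d\<close> are real polynomials, a function pulled back along \<sigma> is
  \<open>u + i v\<close> with \<open>u\<close>, \<open>v\<close> real polynomials in them. The price
  is that primes must be lifted through the extension by the imaginary unit. The determinant counts
  as an invariant itself, not only through its square, because it is preserved by
  \<open>SO3\<close>; it fixes the third diagonal entry once two singular values are known. Distinct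
  eigenvalues enter twice: a complex symmetric matrix may have isotropic eigenvectors, which simple
  eigenvalues exclude, and at most one of three distinct eigenvalues vanishes, so two of them can be
  inverted. A single pullback is too coarse for openness, since an open set may miss the image of
  \<sigma>. The translates of this image by the group cover every point where \<Delta> is
  nonzero.\<close>

no_notation vec_index (infixl \<open>$\<close> 100)
no_notation fps_nth (infixl \<open>$\<close> 75)

section \<open>Evaluation of polynomials\<close>

instance entry :: finite
proof
  have "finite (range (\<lambda>(i, j). Entry i j))"
    by simp
  moreover have "range (\<lambda>(i, j). Entry i j) = UNIV"
    by (auto simp: image_iff) (metis entry.exhaust)
  ultimately show "finite (UNIV :: entry set)"
    by simp
qed

definition const_poly :: "'c \<Rightarrow> ('v \<Rightarrow>\<^sub>0 nat) \<Rightarrow>\<^sub>0 'c::zero" where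
  "const_poly c = Poly_Mapping.single 0 c"

definition var_poly :: "'v \<Rightarrow> ('v \<Rightarrow>\<^sub>0 nat) \<Rightarrow>\<^sub>0 'c::zero_neq_one" where
  "var_poly v = Poly_Mapping.single (Poly_Mapping.single v 1) 1"

text \<open>The coefficient map \<open>f\<close> lets one notion serve for real values, for complex
  values of real polynomials and for the base change from real to complex polynomials.\<close>

definition peval ::
  "('c::comm_ring_1 \<Rightarrow> 'd::comm_ring_1) \<Rightarrow> ('v::finite \<Rightarrow> 'd) \<Rightarrow> (('v \<Rightarrow>\<^sub>0 nat) \<Rightarrow>\<^sub>0 'c) \<Rightarrow> 'd"
where
  "peval f \<xi> p = (\<Sum>m\<in>Poly_Mapping.keys p.
     f (Poly_Mapping.lookup p m) * (\<Prod>v\<in>UNIV. \<xi> v ^ Poly_Mapping.lookup m v))"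

lemma poly_mapping_add_induct [case_names zero single add]:
  fixes p :: "'a \<Rightarrow>\<^sub>0 'b::comm_monoid_add"
  assumes "P 0" "\<And>k c. P (Poly_Mapping.single k c)" "\<And>p q. P p \<Longrightarrow> P q \<Longrightarrow> P (p + q)"
  shows "P p"
proof (induction p rule: update_induct)
  case const
  show ?case using assms(1) .
next
  case (update p k c)
  have "Poly_Mapping.update k c p = p + Poly_Mapping.single k c"
    using update.hyps by (intro poly_mapping_eqI)
      (auto simp: lookup_update lookup_add lookup_single when_def in_keys_iff)
  then show ?case
    using assms(2,3) update.IH by simp
qed

lemma single_eq_const_times_vars:
  "Poly_Mapping.single m (c::'c::comm_ring_1) =
     const_poly c * (\<Prod>v\<in>(UNIV::'v::finite set). var_poly v ^ Poly_Mapping.lookup m v)"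
proof -
  have pow: "var_poly v ^ n = Poly_Mapping.single (Poly_Mapping.single v n) (1::'c)" for v :: 'v and n
    by (induction n) (simp_all add: var_poly_def mult_single single_add[symmetric])
  have prod: "(\<Prod>v\<in>A. Poly_Mapping.single (Poly_Mapping.single v (Poly_Mapping.lookup m v)) (1::'c)) =
      Poly_Mapping.single (\<Sum>v\<in>A. Poly_Mapping.single v (Poly_Mapping.lookup m v)) 1"
    if "finite A" for A :: "'v set"
    using that by (induction A) (simp_all add: mult_single)
  have "(\<Sum>v\<in>UNIV. Poly_Mapping.single v (Poly_Mapping.lookup m v)) = m"
    by (rule poly_mapping_eqI) (simp add: lookup_sum lookup_single when_def)
  then show ?thesis
    by (simp add: pow prod const_poly_def mult_single)
qed

lemma const_poly_0 [simp]: "const_poly 0 = 0"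
  and const_poly_1: "const_poly 1 = 1"
  by (simp_all add: const_poly_def)

lemma mpoly_induct [case_names const var add mult]:
  fixes p :: "('v::finite \<Rightarrow>\<^sub>0 nat) \<Rightarrow>\<^sub>0 'c::comm_ring_1"
  assumes const: "\<And>c. P (const_poly c)" and var: "\<And>v. P (var_poly v)"
    and add: "\<And>p q. P p \<Longrightarrow> P q \<Longrightarrow> P (p + q)" and mult: "\<And>p q. P p \<Longrightarrow> P q \<Longrightarrow> P (p * q)"
  shows "P p"
proof (induction p rule: poly_mapping_add_induct)
  case zero
  show ?case using const[of 0] by simp
next
  case (single m c)
  have one: "P 1"
    using const[of 1] by (simp add: const_poly_1)
  have pow: "P (var_poly v ^ n)" for v n
    by (induction n) (use one var mult in auto)
  have "P (\<Prod>v\<in>A. var_poly v ^ Poly_Mapping.lookup m v)" if "finite A" for A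
    using that by (induction A) (use one pow mult in auto)
  then show ?case
    unfolding single_eq_const_times_vars by (intro mult const) simp
qed (rule add)

context
  fixes f :: "'c::comm_ring_1 \<Rightarrow> 'd::comm_ring_1"
  assumes hom: "comm_ring_hom f"
begin

interpretation comm_ring_hom f by (rule hom)

lemma peval_superset:
  assumes "finite S" "Poly_Mapping.keys p \<subseteq> S"
  shows "peval f \<xi> p = (\<Sum>m\<in>S. f (Poly_Mapping.lookup p m) * (\<Prod>v\<in>UNIV. \<xi> v ^ Poly_Mapping.lookup m v))"
  unfolding peval_def using assms by (intro sum.mono_neutral_left) (auto simp: in_keys_iff)

lemma peval_add: "peval f \<xi> (p + q) = peval f \<xi> p + peval f \<xi> q"
proof -
  let ?S = "Poly_Mapping.keys p \<union> Poly_Mapping.keys q"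
  have "peval f \<xi> (p + q) = (\<Sum>m\<in>?S. f (Poly_Mapping.lookup (p + q) m) * (\<Prod>v\<in>UNIV. \<xi> v ^ Poly_Mapping.lookup m v))"
    using keys_add[of p q] by (intro peval_superset) auto
  moreover have "peval f \<xi> p = (\<Sum>m\<in>?S. f (Poly_Mapping.lookup p m) * (\<Prod>v\<in>UNIV. \<xi> v ^ Poly_Mapping.lookup m v))"
    by (intro peval_superset) auto
  moreover have "peval f \<xi> q = (\<Sum>m\<in>?S. f (Poly_Mapping.lookup q m) * (\<Prod>v\<in>UNIV. \<xi> v ^ Poly_Mapping.lookup m v))"
    by (intro peval_superset) auto
  ultimately show ?thesis
    by (simp add: lookup_add hom_add distrib_right sum.distrib)
qed

lemma peval_0: "peval f \<xi> 0 = 0"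
  by (simp add: peval_def)

lemma peval_single:
  "peval f \<xi> (Poly_Mapping.single m c) = f c * (\<Prod>v\<in>UNIV. \<xi> v ^ Poly_Mapping.lookup m v)"
  by (simp add: peval_def)

lemma peval_const: "peval f \<xi> (const_poly c) = f c"
  by (simp add: const_poly_def peval_single)

lemma peval_var: "peval f \<xi> (var_poly v) = \<xi> v"
proof -
  have "\<xi> w ^ Poly_Mapping.lookup (Poly_Mapping.single v 1) w = (if w = v then \<xi> v else 1)" for w
    by (simp add: lookup_single when_def)
  then show ?thesis
    by (simp only: var_poly_def peval_single) simp
qed

lemma peval_mult: "peval f \<xi> (p * q) = peval f \<xi> p * peval f \<xi> q"
proof (induction p rule: poly_mapping_add_induct)
  case (single m c)
  show ?case
  proof (induction q rule: poly_mapping_add_induct)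
    case (single n d)
    show ?case
      by (simp add: mult_single peval_single hom_mult lookup_add power_add prod.distrib mult_ac)
  qed (simp_all add: peval_0 peval_add distrib_left)
qed (simp_all add: peval_0 peval_add distrib_right)

lemma peval_hom: "comm_ring_hom (peval f \<xi>)"
proof
  show "peval f \<xi> 1 = 1"
    using peval_const[of \<xi> 1] by (simp add: const_poly_1)
qed (simp_all add: peval_0 peval_add peval_mult)

end

lemma comp_peval:
  assumes "comm_ring_hom f" "comm_ring_hom g"
  shows "g (peval f \<xi> p) = peval (g \<circ> f) (g \<circ> \<xi>) p"
proof -
  interpret f: comm_ring_hom f by fact
  interpret g: comm_ring_hom g by fact
  show ?thesis
    by (simp add: peval_def g.hom_sum g.hom_mult g.hom_prod g.hom_power)
qed

lemma comm_ring_hom_of_real: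
  "comm_ring_hom (of_real :: real \<Rightarrow> 'a::{real_algebra_1,comm_ring_1})"
  by unfold_locales simp_all

lemma comm_ring_hom_id: "comm_ring_hom (\<lambda>x::'a::comm_ring_1. x)"
  by unfold_locales simp_all

section \<open>Nonzero real polynomials and real points\<close>

lemma digit_sum_inject:
  fixes f g :: "nat \<Rightarrow> nat"
  assumes "\<And>i. i < n \<Longrightarrow> f i < N" "\<And>i. i < n \<Longrightarrow> g i < N"
    and "(\<Sum>i<n. f i * N ^ i) = (\<Sum>i<n. g i * N ^ i)" and "j < n"
  shows "f j = g j"
  using assms
proof (induction n arbitrary: f g j)
  case (Suc n)
  have split: "(\<Sum>i<Suc n. h i * N ^ i) = h 0 + N * (\<Sum>i<n. h (Suc i) * N ^ i)" for h :: "nat \<Rightarrow> nat"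
    by (simp only: sum.lessThan_Suc_shift sum_distrib_left) (simp add: ac_simps)
  have lt: "f 0 < N" "g 0 < N"
    using Suc.prems by auto
  have eq: "f 0 + N * (\<Sum>i<n. f (Suc i) * N ^ i) = g 0 + N * (\<Sum>i<n. g (Suc i) * N ^ i)"
    using Suc.prems(3) by (simp only: split)
  have "(f 0 + N * (\<Sum>i<n. f (Suc i) * N ^ i)) mod N = f 0"
    "(g 0 + N * (\<Sum>i<n. g (Suc i) * N ^ i)) mod N = g 0"
    using lt by simp_all
  then have 0: "f 0 = g 0"
    using eq by simp
  then have "(\<Sum>i<n. f (Suc i) * N ^ i) = (\<Sum>i<n. g (Suc i) * N ^ i)"
    using eq lt by simp
  then have "f (Suc i) = g (Suc i)" if "i < n" for i
    using Suc.IH[of "\<lambda>i. f (Suc i)" "\<lambda>i. g (Suc i)" i] Suc.prems(1,2) that by auto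
  then show ?case
    using 0 Suc.prems(4) by (cases j) auto
qed simp

lemma keys_bounded:
  "\<exists>D. \<forall>m\<in>Poly_Mapping.keys (p :: ('v::finite \<Rightarrow>\<^sub>0 nat) \<Rightarrow>\<^sub>0 'c::zero). \<forall>v. Poly_Mapping.lookup m v \<le> D"
proof -
  have "finite (\<Union>m\<in>Poly_Mapping.keys p. range (Poly_Mapping.lookup m))"
    by simp
  then obtain D where D: "\<forall>k\<in>(\<Union>m\<in>Poly_Mapping.keys p. range (Poly_Mapping.lookup m)). k \<le> D"
    unfolding finite_nat_set_iff_bounded_le by auto
  show ?thesis
    by (rule exI[of _ D]) (use D in auto)
qed

text \<open>
  Kronecker substitution: the powers \<open>t ^ (N ^ i)\<close> for the variables turn distinct monomials into
  distinct powers of \<open>t\<close>.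
\<close>

lemma peval_nonzero:
  fixes p :: "('v::finite \<Rightarrow>\<^sub>0 nat) \<Rightarrow>\<^sub>0 real"
  assumes "p \<noteq> 0"
  shows "\<exists>\<xi>. peval (\<lambda>c. c) \<xi> p \<noteq> 0"
proof -
  obtain idx :: "'v \<Rightarrow> nat" and n where idx: "bij_betw idx UNIV {..<n}"
    using ex_bij_betw_finite_nat[of "UNIV :: 'v set"] by (auto simp: atLeast0LessThan)
  obtain D where "\<forall>m\<in>Poly_Mapping.keys p. \<forall>v. Poly_Mapping.lookup m v \<le> D"
    using keys_bounded[of p] by blast
  then have N: "Poly_Mapping.lookup m v < Suc D" if "m \<in> Poly_Mapping.keys p" for m v
    using that by (simp add: less_Suc_eq_le)
  \<comment> \<open>\<open>N\<close> exceeds every exponent that occurs, so the exponents of a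
    monomial are the base \<open>N\<close> digits of \<open>k m\<close>.\<close>
  define N where "N = Suc D"
  note N = N[folded N_def]
  define k where "k m = (\<Sum>v\<in>UNIV. Poly_Mapping.lookup m v * N ^ idx v)" for m :: "'v \<Rightarrow>\<^sub>0 nat"
  have inj: "m = m'" if m: "m \<in> Poly_Mapping.keys p" "m' \<in> Poly_Mapping.keys p" and eq: "k m = k m'" for m m'
  proof (rule poly_mapping_eqI)
    fix v
    let ?i = "inv_into UNIV idx"
    have k: "k m = (\<Sum>i<n. Poly_Mapping.lookup m (?i i) * N ^ i)" for m
    proof -
      have "k m = (\<Sum>v\<in>UNIV. Poly_Mapping.lookup m (?i (idx v)) * N ^ idx v)"
        using idx by (simp add: k_def bij_betw_def)
      also have "\<dots> = (\<Sum>i<n. Poly_Mapping.lookup m (?i i) * N ^ i)"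
        using sum.reindex_bij_betw[OF idx, of "\<lambda>i. Poly_Mapping.lookup m (?i i) * N ^ i"] .
      finally show ?thesis .
    qed
    have "Poly_Mapping.lookup m (?i (idx v)) = Poly_Mapping.lookup m' (?i (idx v))"
    proof (rule digit_sum_inject[of n "\<lambda>i. Poly_Mapping.lookup m (?i i)" N "\<lambda>i. Poly_Mapping.lookup m' (?i i)"])
      show "(\<Sum>i<n. Poly_Mapping.lookup m (?i i) * N ^ i) = (\<Sum>i<n. Poly_Mapping.lookup m' (?i i) * N ^ i)"
        using eq by (simp add: k)
      show "idx v < n"
        using idx by (auto simp: bij_betw_def)
    qed (use N m in auto)
    then show "Poly_Mapping.lookup m v = Poly_Mapping.lookup m' v"
      using idx by (simp add: bij_betw_def)
  qed
  \<comment> \<open>The univariate polynomial after substitution. As \<open>k\<close> is injective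
    on the monomials of \<open>p\<close>, no coefficients are merged.\<close>
  define Q where "Q = (\<Sum>m\<in>Poly_Mapping.keys p. Polynomial.monom (Poly_Mapping.lookup p m) (k m))"
  have "Poly_Mapping.keys p \<noteq> {}"
  proof
    assume "Poly_Mapping.keys p = {}"
    then have "p = 0"
      by (intro poly_mapping_eqI) (metis empty_iff in_keys_iff lookup_zero)
    then show False using assms by simp
  qed
  then obtain m where m: "m \<in> Poly_Mapping.keys p"
    by blast
  have "Polynomial.coeff Q (k m) = (\<Sum>m'\<in>Poly_Mapping.keys p. if m' = m then Poly_Mapping.lookup p m else 0)"
    unfolding Q_def coeff_sum using inj m by (intro sum.cong) auto
  then have "Q \<noteq> 0"
    using m by (auto simp: in_keys_iff)
  then obtain t where t: "poly Q t \<noteq> 0"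
    using poly_all_0_iff_0 by blast
  have "poly Q t = peval (\<lambda>c. c) (\<lambda>v. t ^ (N ^ idx v)) p"
    by (simp add: Q_def peval_def poly_sum poly_monom k_def power_sum power_mult[symmetric] mult.commute)
  then show ?thesis
    using t by metis
qed

section \<open>Spectra of subrings of a field\<close>

text \<open>Predicates on plain sets apply alike to subrings of the function field, to a subring of
  the polynomial ring and to the whole polynomial ring.\<close>

definition subring_set :: "'r::comm_ring_1 set \<Rightarrow> bool" where
  "subring_set A \<longleftrightarrow> 1 \<in> A \<and> (\<forall>a\<in>A. \<forall>b\<in>A. a - b \<in> A \<and> a * b \<in> A)"

definition ideal_in :: "'r::comm_ring_1 set \<Rightarrow> 'r set \<Rightarrow> bool" where
  "ideal_in A p \<longleftrightarrow> p \<subseteq> A \<and> 0 \<in> p \<and> (\<forall>a\<in>p. \<forall>b\<in>p. a + b \<in> p) \<and> (\<forall>a\<in>A. \<forall>b\<in>p. a * b \<in> p)"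

definition prime_in :: "'r::comm_ring_1 set \<Rightarrow> 'r set \<Rightarrow> bool" where
  "prime_in A p \<longleftrightarrow> ideal_in A p \<and> 1 \<notin> p \<and> (\<forall>a\<in>A. \<forall>b\<in>A. a * b \<in> p \<longrightarrow> a \<in> p \<or> b \<in> p)"

lemma subring_set_1: "subring_set A \<Longrightarrow> 1 \<in> A"
  and subring_set_diff: "subring_set A \<Longrightarrow> a \<in> A \<Longrightarrow> b \<in> A \<Longrightarrow> a - b \<in> A"
  and subring_set_mult: "subring_set A \<Longrightarrow> a \<in> A \<Longrightarrow> b \<in> A \<Longrightarrow> a * b \<in> A"
  by (auto simp: subring_set_def)

lemma subring_set_0: "subring_set A \<Longrightarrow> 0 \<in> A"
  using subring_set_diff[of A 1 1] subring_set_1[of A] by simp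

lemma subring_set_uminus: "subring_set A \<Longrightarrow> a \<in> A \<Longrightarrow> - a \<in> A"
  using subring_set_diff[of A 0 a] subring_set_0[of A] by simp

lemma subring_set_add: "subring_set A \<Longrightarrow> a \<in> A \<Longrightarrow> b \<in> A \<Longrightarrow> a + b \<in> A"
  using subring_set_diff[of A a "- b"] subring_set_uminus[of A b] by simp

lemma subring_set_power: "subring_set A \<Longrightarrow> a \<in> A \<Longrightarrow> a ^ n \<in> A"
  by (induction n) (auto intro: subring_set_1 subring_set_mult)

lemmas subring_set_intros = subring_set_0 subring_set_1 subring_set_diff subring_set_uminus
  subring_set_add subring_set_mult subring_set_power

lemma subring_set_UNIV: "subring_set UNIV"
  by (simp add: subring_set_def)

lemma ideal_in_subset: "ideal_in A p \<Longrightarrow> a \<in> p \<Longrightarrow> a \<in> A"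
  and ideal_in_0: "ideal_in A p \<Longrightarrow> 0 \<in> p"
  and ideal_in_add: "ideal_in A p \<Longrightarrow> a \<in> p \<Longrightarrow> b \<in> p \<Longrightarrow> a + b \<in> p"
  and ideal_in_lmult: "ideal_in A p \<Longrightarrow> a \<in> A \<Longrightarrow> b \<in> p \<Longrightarrow> a * b \<in> p"
  by (auto simp: ideal_in_def)

lemma ideal_in_rmult: "ideal_in A p \<Longrightarrow> b \<in> p \<Longrightarrow> a \<in> A \<Longrightarrow> b * a \<in> p"
  using ideal_in_lmult[of A p a b] by (simp add: mult.commute)

lemma ideal_in_uminus: "subring_set A \<Longrightarrow> ideal_in A p \<Longrightarrow> b \<in> p \<Longrightarrow> - b \<in> p"
  using ideal_in_lmult[of A p "- 1" b] by (simp add: subring_set_intros)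

lemma ideal_in_diff: "subring_set A \<Longrightarrow> ideal_in A p \<Longrightarrow> a \<in> p \<Longrightarrow> b \<in> p \<Longrightarrow> a - b \<in> p"
  using ideal_in_add[of A p a "- b"] ideal_in_uminus[of A p b] by simp

lemma prime_in_ideal: "prime_in A p \<Longrightarrow> ideal_in A p"
  and prime_in_1: "prime_in A p \<Longrightarrow> 1 \<notin> p"
  and prime_in_mult: "prime_in A p \<Longrightarrow> a \<in> A \<Longrightarrow> b \<in> A \<Longrightarrow> a * b \<in> p \<Longrightarrow> a \<in> p \<or> b \<in> p"
  by (auto simp: prime_in_def)

lemma prime_in_power:
  assumes "subring_set A" "prime_in A p" "a \<in> A" "a ^ n \<in> p"
  shows "a \<in> p"
  using assms(4)
proof (induction n)
  case 0
  then show ?case using prime_in_1[OF assms(2)] by simp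
next
  case (Suc n)
  then show ?case
    using prime_in_mult[OF assms(2,3), of "a ^ n"] assms(1,3) by (auto intro: subring_set_power)
qed

text \<open>An ideal maximal among those that contain \<open>J\<close> and no power of
  \<open>d\<close> is prime. Maximality gives the last clause: modulo \<open>p\<close> and with
  \<open>d\<close> inverted, every nonzero element is a unit. The Nullstellensatz below rests on
  this clause.\<close>

lemma ex_prime_avoiding:
  assumes A: "subring_set A" and J: "ideal_in A J" and d: "d \<in> A" and avoid: "\<And>n::nat. d ^ n \<notin> J"
  shows "\<exists>p. prime_in A p \<and> J \<subseteq> p \<and> d \<notin> p \<and>
    (\<forall>a\<in>A. a \<notin> p \<longrightarrow> (\<exists>n::nat. \<exists>b\<in>A. d ^ n - a * b \<in> p))"
proof -
  define F where "F = {p. ideal_in A p \<and> J \<subseteq> p \<and> (\<forall>n. d ^ n \<notin> p)}"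
  have "\<exists>M\<in>F. \<forall>q\<in>F. M \<subseteq> q \<longrightarrow> q = M"
  proof (rule subset_Zorn_nonempty)
    show "F \<noteq> {}"
      using J avoid by (auto simp: F_def)
  next
    fix C assume C: "C \<noteq> {}" "subset.chain F C"
    then have CF: "q \<in> F" if "q \<in> C" for q
      using that by (auto simp: subset.chain_def)
    have "a + b \<in> \<Union> C" if ab: "a \<in> \<Union> C" "b \<in> \<Union> C" for a b
    proof -
      obtain q q' where q: "q \<in> C" "q' \<in> C" "a \<in> q" "b \<in> q'"
        using ab by blast
      then have "q \<subseteq> q' \<or> q' \<subseteq> q"
        using C(2) by (auto simp: subset.chain_def)
      then consider "a \<in> q'" | "b \<in> q"
        using q by blast
      then show ?thesis
        using q CF[OF q(1)] CF[OF q(2)] ideal_in_add[of A q a b] ideal_in_add[of A q' a b]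
        by cases (auto simp: F_def)
    qed
    moreover have "\<Union> C \<subseteq> A"
      using CF by (force simp: F_def ideal_in_def)
    moreover have "0 \<in> \<Union> C"
      using CF C(1) by (auto simp: F_def ideal_in_def)
    moreover have "a * b \<in> \<Union> C" if ab: "a \<in> A" "b \<in> \<Union> C" for a b
    proof -
      obtain q where q: "q \<in> C" "b \<in> q"
        using ab by blast
      then have "a * b \<in> q"
        using CF[of q] ideal_in_lmult[of A q a b] ab by (simp add: F_def)
      then show ?thesis
        using q by blast
    qed
    ultimately have "ideal_in A (\<Union> C)"
      by (simp add: ideal_in_def)
    then show "\<Union> C \<in> F"
      using C(1) CF by (auto simp: F_def)
  qed
  then obtain M where M: "M \<in> F" and max: "\<And>q. q \<in> F \<Longrightarrow> M \<subseteq> q \<Longrightarrow> q = M"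
    by blast
  have id: "ideal_in A M" and JM: "J \<subseteq> M" and dM: "\<And>n. d ^ n \<notin> M"
    using M by (auto simp: F_def)
  have ex: "\<exists>n::nat. \<exists>b\<in>A. d ^ n - a * b \<in> M" if a: "a \<in> A" "a \<notin> M" for a
  proof (rule ccontr)
    assume contra: "\<not> ?thesis"
    \<comment> \<open>The ideal generated by \<open>M\<close> and \<open>a\<close>. If it contained
      no power of \<open>d\<close>, it would contradict maximality of \<open>M\<close>.\<close>
    define q where "q = {m + a * b | m b. m \<in> M \<and> b \<in> A}"
    have Mq: "M \<subseteq> q"
      using A by (force simp: q_def intro: subring_set_0)
    have "a \<in> q"
      using ideal_in_0[OF id] subring_set_1[OF A] by (force simp: q_def)
    have "ideal_in A q"
      unfolding ideal_in_def
    proof (intro conjI ballI)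
      show "q \<subseteq> A"
        using a ideal_in_subset[OF id] subring_set_add[OF A] subring_set_mult[OF A] by (auto simp: q_def)
      show "0 \<in> q"
        using Mq ideal_in_0[OF id] by blast
    next
      fix x y assume "x \<in> q" "y \<in> q"
      then obtain m b m' b' where *: "m \<in> M" "b \<in> A" "m' \<in> M" "b' \<in> A"
        "x = m + a * b" "y = m' + a * b'"
        by (auto simp: q_def)
      then have "x + y = (m + m') + a * (b + b')"
        by (simp add: algebra_simps)
      moreover have "m + m' \<in> M" "b + b' \<in> A"
        using * ideal_in_add[OF id] subring_set_add[OF A] by auto
      ultimately show "x + y \<in> q"
        unfolding q_def by blast
    next
      fix x y assume "x \<in> A" "y \<in> q"
      then obtain m b where *: "m \<in> M" "b \<in> A" "y = m + a * b"
        by (auto simp: q_def)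
      then have "x * y = x * m + a * (x * b)"
        by (simp add: algebra_simps)
      moreover have "x * m \<in> M" "x * b \<in> A"
        using * ideal_in_lmult[OF id \<open>x \<in> A\<close>] subring_set_mult[OF A \<open>x \<in> A\<close>] by auto
      ultimately show "x * y \<in> q"
        unfolding q_def by blast
    qed
    moreover have "d ^ n \<notin> q" for n
    proof
      assume "d ^ n \<in> q"
      then obtain m b where "m \<in> M" "b \<in> A" "d ^ n = m + a * b"
        by (auto simp: q_def)
      then have "d ^ n - a * b \<in> M" "b \<in> A"
        by simp_all
      then show False
        using contra by blast
    qed
    ultimately have "q \<in> F"
      using JM Mq by (auto simp: F_def)
    then show False
      using max[of q] Mq \<open>a \<in> q\<close> a by auto
  qed
  have "prime_in A M"
    unfolding prime_in_def
  proof (intro conjI ballI impI id)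
    show "1 \<notin> M"
      using dM[of 0] by simp
  next
    fix a b assume ab: "a \<in> A" "b \<in> A" "a * b \<in> M"
    show "a \<in> M \<or> b \<in> M"
    proof (rule ccontr)
      assume "\<not> ?thesis"
      then obtain n k x y where *: "x \<in> A" "d ^ n - a * x \<in> M" "y \<in> A" "d ^ k - b * y \<in> M"
        using ex[of a] ex[of b] ab by blast
      \<comment> \<open>Modulo \<open>M\<close>, \<open>d ^ n\<close> is \<open>a * x\<close> and
        \<open>d ^ k\<close> is \<open>b * y\<close>; their product is a multiple of
        \<open>a * b\<close>.\<close>
      have "d ^ (n + k) = (d ^ n - a * x) * d ^ k + (a * x) * (d ^ k - b * y) + (a * b) * (x * y)"
        by (simp add: algebra_simps power_add)
      also have "\<dots> \<in> M"
        using ideal_in_rmult[OF id *(2) subring_set_power[OF A d]]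
          ideal_in_lmult[OF id subring_set_mult[OF A ab(1) *(1)] *(4)]
          ideal_in_rmult[OF id ab(3) subring_set_mult[OF A *(1,3)]]
        by (intro ideal_in_add[OF id])
      finally show False
        using dM by blast
    qed
  qed
  moreover have "d \<notin> M"
    using dM[of 1] by simp
  ultimately show ?thesis
    using JM ex by blast
qed

section \<open>Prime spectra and the Zariski topology\<close>

lemma cring_subring_of:
  fixes A :: "'k::field set"
  assumes A: "subring_set A"
  shows "cring (subring_of A)"
proof -
  have "\<exists>y\<in>A. x + y = 0" if "x \<in> A" for x
    using that A by (intro bexI[of _ "- x"]) (auto intro: subring_set_intros)
  then show ?thesis
    using A unfolding subring_of_def ring_of_type_algebra_def
    by unfold_locales (auto simp: algebra_simps Units_def intro: subring_set_intros)
qed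

lemma Spec_iff:
  fixes A :: "'k::field set"
  assumes A: "subring_set A"
  shows "p \<in> Spec A \<longleftrightarrow> prime_in A p"
proof
  assume "p \<in> Spec A"
  then interpret primeideal p "subring_of A"
    by (simp add: Spec_def)
  have 1: "1 \<notin> p"
  proof
    assume "1 \<in> p"
    then have "p = carrier (subring_of A)"
      by (intro one_imp_carrier) (simp add: subring_of_def ring_of_type_algebra_def)
    then show False
      using I_notcarr by simp
  qed
  have "0 \<in> p"
    using additive_subgroup.zero_closed[OF is_additive_subgroup]
    by (simp add: subring_of_def ring_of_type_algebra_def)
  moreover have "a + b \<in> p" if "a \<in> p" "b \<in> p" for a b
    using additive_subgroup.a_closed[OF is_additive_subgroup that] by (simp add: subring_of_def ring_of_type_algebra_def)
  moreover have "a * b \<in> p" if "a \<in> A" "b \<in> p" for a b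
    using I_l_closed[of b a] that by (simp add: subring_of_def ring_of_type_algebra_def)
  moreover have "a \<in> p \<or> b \<in> p" if "a \<in> A" "b \<in> A" "a * b \<in> p" for a b
    using I_prime[of a b] that by (simp add: subring_of_def ring_of_type_algebra_def)
  moreover have "p \<subseteq> A"
    using a_subset by (simp add: subring_of_def ring_of_type_algebra_def)
  ultimately show "prime_in A p"
    using 1 by (auto simp: prime_in_def ideal_in_def)
next
  assume p: "prime_in A p"
  note id = prime_in_ideal[OF p]
  interpret R: cring "subring_of A"
    by (rule cring_subring_of[OF A])
  have "additive_subgroup p (subring_of A)"
  proof (rule additive_subgroup.intro, rule R.add.subgroupI)
    fix a assume a: "a \<in> p"
    have "\<ominus>\<^bsub>subring_of A\<^esub> a = - a"
      using a ideal_in_subset[OF id a] A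
      by (intro R.minus_equality)
        (auto simp: subring_of_def ring_of_type_algebra_def intro: subring_set_intros)
    then show "\<ominus>\<^bsub>subring_of A\<^esub> a \<in> p"
      using ideal_in_uminus[OF A id a] by simp
  qed (use id in \<open>auto simp: subring_of_def ring_of_type_algebra_def ideal_in_def\<close>)
  then have "ideal p (subring_of A)"
    using id by (intro ideal.intro R.ring_axioms ideal_axioms.intro)
      (auto simp: subring_of_def ring_of_type_algebra_def ideal_in_def intro: ideal_in_rmult[OF id])
  moreover have "carrier (subring_of A) \<noteq> p"
    using prime_in_1[OF p] subring_set_1[OF A] by (auto simp: subring_of_def)
  ultimately have "primeideal p (subring_of A)"
    using p by (intro primeidealI R.cring_axioms)
      (auto simp: subring_of_def ring_of_type_algebra_def prime_in_def)
  then show "p \<in> Spec A"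
    by (simp add: Spec_def)
qed

lemma basic_open_mult:
  fixes A :: "'k::field set"
  assumes "subring_set A" "a \<in> A" "b \<in> A"
  shows "basic_open A a \<inter> basic_open A b = basic_open A (a * b)"
proof -
  have "a * b \<in> p \<longleftrightarrow> a \<in> p \<or> b \<in> p" if p: "prime_in A p" for p
    using prime_in_mult[OF p assms(2,3)] ideal_in_lmult[OF prime_in_ideal[OF p] assms(2), of b]
      ideal_in_rmult[OF prime_in_ideal[OF p] _ assms(3), of a] by blast
  then show ?thesis
    using assms(1) by (auto simp: basic_open_def Spec_iff)
qed

lemma basic_open_1: "subring_set (A :: 'k::field set) \<Longrightarrow> basic_open A 1 = Spec A"
  by (auto simp: basic_open_def Spec_iff prime_in_1)

lemma openin_zariski_basic_open: "a \<in> A \<Longrightarrow> openin (zariski A) (basic_open A a)"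
  unfolding zariski_def by (intro topology_generated_by_Basis) simp

text \<open>\<open>zariski\<close> is generated by a subbase; by \<open>basic_open_mult\<close> it
  is closed under intersection of two members, hence a base.\<close>

lemma openin_zariski_iff:
  fixes A :: "'k::field set"
  assumes A: "subring_set A"
  shows "openin (zariski A) W \<longleftrightarrow>
    W \<subseteq> Spec A \<and> (\<forall>p\<in>W. \<exists>a\<in>A. p \<in> basic_open A a \<and> basic_open A a \<subseteq> W)"
proof
  assume "openin (zariski A) W"
  then have "generate_topology_on (basic_open A ` A) W"
    by (simp add: zariski_def openin_topology_generated_by_iff)
  then show "W \<subseteq> Spec A \<and> (\<forall>p\<in>W. \<exists>a\<in>A. p \<in> basic_open A a \<and> basic_open A a \<subseteq> W)"
  proof (induction rule: generate_topology_on.induct)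
    case (Int U V)
    have "\<exists>c\<in>A. p \<in> basic_open A c \<and> basic_open A c \<subseteq> U \<inter> V" if p: "p \<in> U \<inter> V" for p
    proof -
      obtain a b where ab: "a \<in> A" "p \<in> basic_open A a" "basic_open A a \<subseteq> U"
        "b \<in> A" "p \<in> basic_open A b" "basic_open A b \<subseteq> V"
        using Int.IH p by blast
      then show ?thesis
        using A by (intro bexI[of _ "a * b"])
          (auto simp: basic_open_mult[symmetric] intro: subring_set_intros)
    qed
    then show ?case using Int.IH by blast
  next
    case (UN K)
    then show ?case by (meson Sup_le_iff UnionE subset_trans Union_upper)
  qed (auto simp: basic_open_def)
next
  assume *: "W \<subseteq> Spec A \<and> (\<forall>p\<in>W. \<exists>a\<in>A. p \<in> basic_open A a \<and> basic_open A a \<subseteq> W)"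
  then have "W = \<Union> {basic_open A a | a. a \<in> A \<and> basic_open A a \<subseteq> W}"
    by blast
  moreover have "openin (zariski A) (\<Union> {basic_open A a | a. a \<in> A \<and> basic_open A a \<subseteq> W})"
    by (intro openin_Union) (auto intro: openin_zariski_basic_open)
  ultimately show "openin (zariski A) W"
    by simp
qed

lemma topspace_zariski:
  fixes A :: "'k::field set"
  assumes A: "subring_set A"
  shows "topspace (zariski A) = Spec A"
proof (rule antisym)
  show "topspace (zariski A) \<subseteq> Spec A"
    using openin_topspace[of "zariski A"] unfolding openin_zariski_iff[OF A] by blast
  show "Spec A \<subseteq> topspace (zariski A)"
    using openin_zariski_basic_open[OF subring_set_1[OF A]]
    by (simp add: basic_open_1[OF A] openin_subset)
qed

lemma prime_in_zero: "subring_set A \<Longrightarrow> prime_in A {0::'r::idom}"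
  by (auto simp: prime_in_def ideal_in_def intro: subring_set_0)

lemma basic_open_nonempty:
  fixes A :: "'k::field set"
  assumes "subring_set A" "d \<noteq> 0"
  shows "{0} \<in> basic_open A d"
  using assms by (simp add: basic_open_def Spec_iff prime_in_zero)

text \<open>The zero ideal is a generic point: it lies in every nonempty basic open set.\<close>

lemma basic_open_dense:
  fixes A :: "'k::field set"
  assumes A: "subring_set A" and "d \<noteq> 0"
  shows "zariski A closure_of basic_open A d = Spec A"
proof -
  have "\<exists>q. q \<in> basic_open A d \<and> q \<in> T" if T: "p \<in> T" "openin (zariski A) T" for p T
  proof -
    obtain a where a: "a \<in> A" "p \<in> basic_open A a" "basic_open A a \<subseteq> T"
      using T by (auto simp: openin_zariski_iff[OF A])
    have "a \<noteq> 0"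
      using a(2) A by (auto simp: basic_open_def Spec_iff prime_in_def ideal_in_def)
    then show ?thesis
      using basic_open_nonempty[OF A] assms(2) a(3) by blast
  qed
  then show ?thesis
    by (auto simp: closure_of_def topspace_zariski[OF A])
qed

section \<open>Local rings and sections over basic open sets\<close>

lemma local_ring_iff:
  fixes A :: "'k::field set"
  assumes p: "prime_in A p"
  shows "h \<in> local_ring A p \<longleftrightarrow> (\<exists>s\<in>A - p. s * h \<in> A)"
proof
  assume "h \<in> local_ring A p"
  then obtain a s where *: "h = a / s" "a \<in> A" "s \<in> A - p"
    by (auto simp: local_ring_def)
  then have "s \<noteq> 0"
    using p by (auto simp: prime_in_def ideal_in_def)
  then have "s * h = a"
    using * by simp
  then show "\<exists>s\<in>A - p. s * h \<in> A"
    using * by blast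
next
  assume "\<exists>s\<in>A - p. s * h \<in> A"
  then obtain s where s: "s \<in> A - p" "s * h \<in> A"
    by blast
  then have "s \<noteq> 0"
    using p by (auto simp: prime_in_def ideal_in_def)
  then have "h = (s * h) / s"
    by simp
  then show "h \<in> local_ring A p"
    unfolding local_ring_def using s by blast
qed

text \<open>The possible denominators of \<open>h\<close> form an ideal \<open>J\<close>. Were no
  power of \<open>d\<close> in it, a prime containing \<open>J\<close> but not \<open>d\<close>
  would exist, and \<open>h\<close> would have no admissible denominator there.\<close>

lemma regular_basic_open:
  fixes A :: "'k::field set"
  assumes A: "subring_set A" and d: "d \<in> A" "d \<noteq> 0"
  shows "regular A (basic_open A d) = adjoin_inverse A d"
proof -
  have ne: "basic_open A d \<noteq> {}"
    using basic_open_nonempty[OF A d(2)] by blast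
  have "h \<in> adjoin_inverse A d" if h: "\<And>p. p \<in> basic_open A d \<Longrightarrow> h \<in> local_ring A p" for h
  proof -
    define J where "J = {s \<in> A. s * h \<in> A}"
    have J: "ideal_in A J"
      using A by (auto simp: J_def ideal_in_def distrib_right mult.assoc intro: subring_set_intros)
    have "\<exists>n. d ^ n \<in> J"
    proof (rule ccontr)
      assume "\<not> ?thesis"
      then obtain p where p: "prime_in A p" "J \<subseteq> p" "d \<notin> p"
        using ex_prime_avoiding[OF A J d(1)] by blast
      then have "h \<in> local_ring A p"
        using h A by (simp add: basic_open_def Spec_iff)
      then show False
        using p by (auto simp: local_ring_iff J_def)
    qed
    then obtain n where n: "d ^ n * h \<in> A"
      by (auto simp: J_def)
    have "h = (d ^ n * h) / d ^ n"
      using d by simp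
    then show ?thesis
      unfolding adjoin_inverse_def using n by blast
  qed
  moreover have "h \<in> local_ring A p" if h': "h \<in> adjoin_inverse A d" "p \<in> basic_open A d" for h p
  proof -
    obtain a n where h: "h = a / d ^ n" "a \<in> A"
      using h'(1) by (auto simp: adjoin_inverse_def)
    have "d ^ n \<notin> p"
      using prime_in_power[OF A _ d(1), of p n] h'(2) A by (auto simp: basic_open_def Spec_iff)
    then show ?thesis
      unfolding local_ring_def using h A d(1) by (auto intro: subring_set_power)
  qed
  ultimately show ?thesis
    using ne by (auto simp: regular_def)
qed

section \<open>Inverting one element\<close>

lemma adjoin_inverse_1: "adjoin_inverse A (1::'k::field) = A"
  by (auto simp: adjoin_inverse_def)

lemma regular_Spec: "subring_set (A :: 'k::field set) \<Longrightarrow> regular A (Spec A) = A"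
  using regular_basic_open[of A 1] by (simp add: basic_open_1 adjoin_inverse_1 subring_set_1)

lemma adjoin_inverse_superset: "A \<subseteq> adjoin_inverse A d"
proof
  fix a assume "a \<in> A"
  then show "a \<in> adjoin_inverse A d"
    unfolding adjoin_inverse_def by (intro CollectI exI[of _ a] exI[of _ 0]) simp
qed

lemma subring_set_adjoin_inverse:
  fixes R :: "'k::field set"
  assumes R: "subring_set R" and d: "d \<in> R" "d \<noteq> 0"
  shows "subring_set (adjoin_inverse R d)"
  unfolding subring_set_def
proof (intro conjI ballI)
  show "1 \<in> adjoin_inverse R d"
    using adjoin_inverse_superset subring_set_1[OF R] by blast
next
  fix x y assume "x \<in> adjoin_inverse R d" "y \<in> adjoin_inverse R d"
  then obtain a n b m where *: "x = a / d ^ n" "a \<in> R" "y = b / d ^ m" "b \<in> R"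
    by (auto simp: adjoin_inverse_def)
  have "x - y = (a * d ^ m - b * d ^ n) / d ^ (n + m)" "x * y = (a * b) / d ^ (n + m)"
    using d by (simp_all add: * field_simps power_add)
  then show "x - y \<in> adjoin_inverse R d" "x * y \<in> adjoin_inverse R d"
    unfolding adjoin_inverse_def using * R d by (blast intro: subring_set_intros)+
qed

lemma inverse_power_in_adjoin_inverse:
  "subring_set R \<Longrightarrow> 1 / d ^ n \<in> adjoin_inverse R (d::'k::field)"
  unfolding adjoin_inverse_def using subring_set_1 by blast

lemma Spec_adjoin_inverse:
  fixes R :: "'k::field set"
  assumes R: "subring_set R" and d: "d \<in> R" "d \<noteq> 0" and q: "prime_in (adjoin_inverse R d) q"
  shows "prime_in R (q \<inter> R)" "d \<notin> q" "r \<in> R \<Longrightarrow> r / d ^ n \<in> q \<longleftrightarrow> r \<in> q"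
proof -
  let ?B = "adjoin_inverse R d"
  have RB: "R \<subseteq> ?B" by (rule adjoin_inverse_superset)
  note id = prime_in_ideal[OF q]
  show "prime_in R (q \<inter> R)"
    unfolding prime_in_def ideal_in_def
    using R RB ideal_in_0[OF id] ideal_in_add[OF id] ideal_in_lmult[OF id] prime_in_mult[OF q] prime_in_1[OF q]
    by (auto intro: subring_set_intros) blast
  show "d \<notin> q"
  proof
    assume "d \<in> q"
    then have "1 / d ^ 1 * d \<in> q"
      using inverse_power_in_adjoin_inverse[OF R] by (intro ideal_in_lmult[OF id])
    then show False
      using d prime_in_1[OF q] by simp
  qed
  assume r: "r \<in> R"
  show "r / d ^ n \<in> q \<longleftrightarrow> r \<in> q"
  proof
    assume "r \<in> q"
    then show "r / d ^ n \<in> q"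
      using ideal_in_lmult[OF id inverse_power_in_adjoin_inverse[OF R], of r n] by simp
  next
    assume "r / d ^ n \<in> q"
    moreover have "d ^ n \<in> ?B"
      using RB R d by (auto intro: subring_set_power)
    ultimately have "d ^ n * (r / d ^ n) \<in> q"
      by (intro ideal_in_lmult[OF id])
    then show "r \<in> q"
      using d by simp
  qed
qed

lemma prime_in_adjoin_inverse_eqI:
  fixes R :: "'k::field set"
  assumes R: "subring_set R" and d: "d \<in> R" "d \<noteq> 0"
    and q: "prime_in (adjoin_inverse R d) q" and q': "prime_in (adjoin_inverse R d) q'"
    and eq: "\<And>r. r \<in> R \<Longrightarrow> r \<in> q \<longleftrightarrow> r \<in> q'"
  shows "q = q'"
proof -
  have "b \<in> q \<longleftrightarrow> b \<in> q'" if b: "b \<in> adjoin_inverse R d" for b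
  proof -
    obtain r n where "b = r / d ^ n" "r \<in> R"
      using b by (auto simp: adjoin_inverse_def)
    then show ?thesis
      using Spec_adjoin_inverse(3)[OF R d q] Spec_adjoin_inverse(3)[OF R d q'] eq by simp
  qed
  then show ?thesis
    using ideal_in_subset[OF prime_in_ideal[OF q]] ideal_in_subset[OF prime_in_ideal[OF q']] by blast
qed

lemma max_ideal_iff:
  fixes A :: "'k::field set"
  assumes A: "subring_set A" and p: "prime_in A p" and as: "a \<in> A" "s \<in> A - p"
  shows "a / s \<in> max_ideal A p \<longleftrightarrow> a \<in> p"
proof
  assume "a / s \<in> max_ideal A p"
  then obtain a' s' where *: "a / s = a' / s'" "a' \<in> p" "s' \<in> A - p"
    by (auto simp: max_ideal_def)
  have "s \<noteq> 0" "s' \<noteq> 0"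
    using as * p by (auto simp: prime_in_def ideal_in_def)
  then have "a * s' = s * a'"
    using *(1) by (simp add: field_simps)
  also have "\<dots> \<in> p"
    using as * prime_in_ideal[OF p] by (auto intro: ideal_in_lmult)
  finally show "a \<in> p"
    using prime_in_mult[OF p as(1), of s'] * by blast
qed (use as in \<open>auto simp: max_ideal_def\<close>)

text \<open>Since \<open>d\<close> does not vanish at \<open>p\<close>, a fraction vanishes there
  exactly if its numerator does. Thus the image point is the contraction of \<open>p\<close> to
  \<open>R\<close>, extended to the localisation, and the laws of a prime ideal can be checked on
  numerators.\<close>

lemma point_map_adjoin_inverse:
  fixes A :: "'k::field set"
  assumes A: "subring_set A" and R: "subring_set R" "R \<subseteq> A" and d: "d \<in> R"
    and p: "prime_in A p" "d \<notin> p"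
  shows "prime_in (adjoin_inverse R d) (point_map A (adjoin_inverse R d) p)"
    and "r \<in> R \<Longrightarrow> r \<in> point_map A (adjoin_inverse R d) p \<longleftrightarrow> r \<in> p"
    and "r \<in> R \<Longrightarrow> r / d ^ n \<in> point_map A (adjoin_inverse R d) p \<longleftrightarrow> r \<in> p"
proof -
  let ?B = "adjoin_inverse R d"
  let ?q = "point_map A ?B p"
  note id = prime_in_ideal[OF p(1)]
  have dn: "d ^ n \<in> A - p" for n
    using prime_in_power[OF A p(1), of d n] p(2) d R(2) A by (auto intro: subring_set_power)
  have d0: "d \<noteq> 0"
    using p(2) ideal_in_0[OF id] by auto
  show iff: "r / d ^ n \<in> ?q \<longleftrightarrow> r \<in> p" if "r \<in> R" for r n
    using max_ideal_iff[OF A p(1) _ dn] that R(2) by (auto simp: point_map_def adjoin_inverse_def)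
  show "r \<in> ?q \<longleftrightarrow> r \<in> p" if "r \<in> R" for r
    using iff[OF that, of 0] by simp
  show "prime_in ?B ?q"
    unfolding prime_in_def ideal_in_def
  proof (intro conjI ballI impI)
    show "?q \<subseteq> ?B"
      by (simp add: point_map_def)
    show "0 \<in> ?q" "1 \<notin> ?q"
      using iff[of 0 0] iff[of 1 0] R(1) ideal_in_0[OF id] prime_in_1[OF p(1)]
      by (auto intro: subring_set_intros)
  next
    fix x y assume "x \<in> ?q" "y \<in> ?q"
    moreover from this obtain a n b m where *: "x = a / d ^ n" "a \<in> R" "y = b / d ^ m" "b \<in> R"
      by (auto simp: adjoin_inverse_def point_map_def)
    ultimately have ab: "a \<in> p" "b \<in> p"
      using iff by auto
    have "x + y = (d ^ m * a + d ^ n * b) / d ^ (n + m)"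
      using d0 by (simp_all add: * field_simps power_add)
    moreover have "d ^ m * a + d ^ n * b \<in> p"
      using ab dn by (intro ideal_in_add[OF id] ideal_in_lmult[OF id]) auto
    moreover have "d ^ m * a + d ^ n * b \<in> R"
      using * R d by (auto intro!: subring_set_intros)
    ultimately show "x + y \<in> ?q"
      using iff by metis
  next
    fix x y assume x: "x \<in> ?B" and y: "y \<in> ?q"
    then obtain a n b m where *: "x = a / d ^ n" "a \<in> R" "y = b / d ^ m" "b \<in> R"
      by (auto simp: adjoin_inverse_def point_map_def)
    then have b: "b \<in> p"
      using iff y by auto
    have "x * y = (a * b) / d ^ (n + m)"
      using d0 by (simp_all add: * field_simps power_add)
    moreover have "a * b \<in> p"
      using b * R(2) by (auto intro: ideal_in_lmult[OF id])
    moreover have "a * b \<in> R"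
      using * R by (auto intro!: subring_set_intros)
    ultimately show "x * y \<in> ?q"
      using iff by metis
  next
    fix x y assume xy: "x \<in> ?B" "y \<in> ?B" "x * y \<in> ?q"
    then obtain a n b m where *: "x = a / d ^ n" "a \<in> R" "y = b / d ^ m" "b \<in> R"
      by (auto simp: adjoin_inverse_def point_map_def)
    have "x * y = (a * b) / d ^ (n + m)"
      using d0 by (simp_all add: * field_simps power_add)
    moreover have "a * b \<in> R"
      using * R by (auto intro!: subring_set_intros)
    ultimately have "a * b \<in> p"
      using iff xy(3) by metis
    then have "a \<in> p \<or> b \<in> p"
      using prime_in_mult[OF p(1)] * R(2) by blast
    then show "x \<in> ?q \<or> y \<in> ?q"
      using * iff by auto
  qed
qed

text \<open>Makes the definite description in \<open>val\<close> usable: two fractions for the same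
  element give the same value, by cross multiplication.\<close>

lemma val_eq:
  fixes A :: "'k::field set"
  assumes mult: "\<And>a b. a \<in> A \<Longrightarrow> b \<in> A \<Longrightarrow> x (a * b) = x a * x b" and 0: "x 0 = 0"
    and as: "a \<in> A" "s \<in> A" "x s \<noteq> 0"
  shows "val A x (a / s) = x a / x s"
  unfolding val_def
proof (rule the_equality)
  show "\<exists>a'\<in>A. \<exists>s'\<in>A. x s' \<noteq> 0 \<and> a / s = a' / s' \<and> x a / x s = x a' / x s'"
    using as by blast
next
  fix v assume "\<exists>a'\<in>A. \<exists>s'\<in>A. x s' \<noteq> 0 \<and> a / s = a' / s' \<and> v = x a' / x s'"
  then obtain a' s' where *: "a' \<in> A" "s' \<in> A" "x s' \<noteq> 0" "a / s = a' / s'" "v = x a' / x s'"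
    by blast
  then have "s \<noteq> 0" "s' \<noteq> 0"
    using as 0 by auto
  then have "a * s' = a' * s"
    using *(4) by (simp add: field_simps)
  then have "x a * x s' = x a' * x s"
    using mult as * by metis
  then have "x a = (x a' / x s') * x s"
    using * by (simp add: field_simps)
  then have "x a = v * x s"
    using *(5) by simp
  then show "v = x a / x s"
    using as by simp
qed

section \<open>The discriminant of a cubic\<close>

lemma charpoly_3:
  fixes M :: "'a::comm_ring_1^3^3"
  shows "charpoly M = [:- Determinants.det M,
    M$1$1 * M$2$2 - M$1$2 * M$2$1 + M$1$1 * M$3$3 - M$1$3 * M$3$1 + M$2$2 * M$3$3 - M$2$3 * M$3$2,
    - (M$1$1 + M$2$2 + M$3$3), 1:]"
  unfolding charpoly_def det_3 by (simp add: algebra_simps)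

text \<open>Lists of rows turn a concrete Sylvester determinant into a term that can be expanded by
  rewriting alone.\<close>

definition det_rows :: "'a::comm_ring_1 list list \<Rightarrow> 'a" where
  "det_rows rs = Determinant.det (Matrix.mat (length rs) (length rs) (\<lambda>(i, j). rs ! i ! j))"

lemma det_rows_Nil: "det_rows [] = 1"
  by (simp add: det_rows_def)

lemma det_rows_Cons:
  assumes "length r = Suc (length rs)" "\<forall>s\<in>set rs. length s = Suc (length rs)"
  shows "det_rows (r # rs) =
    (\<Sum>j<Suc (length rs). r ! j * ((-1) ^ j * det_rows (map (\<lambda>s. take j s @ drop (Suc j) s) rs)))"
proof -
  let ?n = "length rs" and ?A = "Matrix.mat (Suc (length rs)) (Suc (length rs)) (\<lambda>(i, j). (r # rs) ! i ! j)"
  have "mat_delete ?A 0 j =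
      Matrix.mat ?n ?n (\<lambda>(i, k). map (\<lambda>s. take j s @ drop (Suc j) s) rs ! i ! k)"
    if j: "j < Suc ?n" for j
  proof (rule eq_matI)
    fix i k assume "i < dim_row (Matrix.mat ?n ?n (\<lambda>(i, k). map (\<lambda>s. take j s @ drop (Suc j) s) rs ! i ! k))"
      "k < dim_col (Matrix.mat ?n ?n (\<lambda>(i, k). map (\<lambda>s. take j s @ drop (Suc j) s) rs ! i ! k))"
    then have ik: "i < ?n" "k < ?n"
      by simp_all
    then have len: "length (rs ! i) = Suc ?n"
      using assms(2) by simp
    \<comment> \<open>Positions before \<open>j\<close> stay, later ones shift by one; this is also
      the indexing of \<open>mat_delete\<close>.\<close>
    have "(take j (rs ! i) @ drop (Suc j) (rs ! i)) ! k = rs ! i ! (if k < j then k else Suc k)"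
    proof (cases "k < j")
      case False
      then have "Suc j + (k - j) = Suc k"
        by simp
      then show ?thesis
        using False j len ik by (simp add: nth_append del: add_Suc)
    qed (use j len in \<open>simp add: nth_append\<close>)
    then show "mat_delete ?A 0 j $$ (i, k) =
        Matrix.mat ?n ?n (\<lambda>(i, k). map (\<lambda>s. take j s @ drop (Suc j) s) rs ! i ! k) $$ (i, k)"
      using ik by (simp add: mat_delete_def)
  qed (simp_all add: mat_delete_def)
  then show ?thesis
    unfolding det_rows_def
    by (simp only: length_Cons, subst laplace_expansion_row[of _ "Suc ?n" 0])
      (auto simp: Determinant.cofactor_def mult_ac intro!: sum.cong)
qed

text \<open>The expansion along the first row as a recursion on lists, which the simplifier can unfold.\<close>

primrec delete_nth :: "nat \<Rightarrow> 'a list \<Rightarrow> 'a list" where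
  "delete_nth j [] = []"
| "delete_nth j (x # xs) = (case j of 0 \<Rightarrow> xs | Suc j \<Rightarrow> x # delete_nth j xs)"

primrec laplace_sum :: "nat \<Rightarrow> 'a::comm_ring_1 list \<Rightarrow> 'a list list \<Rightarrow> 'a" where
  "laplace_sum j [] rs = 0"
| "laplace_sum j (x # xs) rs = x * det_rows (map (delete_nth j) rs) - laplace_sum (Suc j) xs rs"

lemma delete_nth_conv: "delete_nth j xs = take j xs @ drop (Suc j) xs"
  by (induction xs arbitrary: j) (auto split: nat.split)

text \<open>The nested subtractions produce the alternating signs; \<open>j\<close> is the index of
  the column of the head entry.\<close>

lemma laplace_sum_conv:
  "laplace_sum j xs rs =
     (\<Sum>k<length xs. xs ! k * ((-1) ^ k * det_rows (map (delete_nth (j + k)) rs)))"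
proof (induction xs arbitrary: j)
  case (Cons x xs)
  show ?case
    by (simp only: laplace_sum.simps Cons.IH length_Cons sum.lessThan_Suc_shift o_def)
      (simp add: sum_negf)
qed simp

lemma det_rows_laplace:
  assumes "length r = Suc (length rs)" "\<forall>s\<in>set rs. length s = Suc (length rs)"
  shows "det_rows (r # rs) = laplace_sum 0 r rs"
  unfolding laplace_sum_conv det_rows_Cons[OF assms] assms(1)
  by (simp add: delete_nth_conv[abs_def])

lemma monic_discriminant_cubic:
  fixes a b c :: "'a::{idom, ring_char_0}"
  shows "monic_discriminant [:c, b, a, 1:] =
    a\<^sup>2 * b\<^sup>2 - 4 * b ^ 3 - 4 * a ^ 3 * c - 27 * c\<^sup>2 + 18 * a * b * c"
proof -
  let ?f = "[:c, b, a, 1:]"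
  have pd: "pderiv ?f = [:b, 2 * a, 3:]"
    by (simp add: pderiv_pCons)
  \<comment> \<open>The Sylvester matrix: two shifted copies of the coefficients of
    \<open>?f\<close> and three of those of its derivative.\<close>
  define L where "L = [[1, a, b, c, 0], [0, 1, a, b, c], [3, 2 * a, b, 0, 0], [0, 3, 2 * a, b, 0], [0, 0, 3, 2 * a, b]]"
  have "sylvester_mat ?f (pderiv ?f) = Matrix.mat (length L) (length L) (\<lambda>(i, j). L ! i ! j)"
  proof (rule eq_matI)
    fix i j assume "i < dim_row (Matrix.mat (length L) (length L) (\<lambda>(i, j). L ! i ! j))"
      "j < dim_col (Matrix.mat (length L) (length L) (\<lambda>(i, j). L ! i ! j))"
    then have "i \<in> {0, 1, 2, 3, 4}" "j \<in> {0, 1, 2, 3, 4}"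
      by (auto simp: L_def)
    then show "sylvester_mat ?f (pderiv ?f) $$ (i, j) =
        Matrix.mat (length L) (length L) (\<lambda>(i, j). L ! i ! j) $$ (i, j)"
      unfolding pd by (auto simp: sylvester_index_mat L_def eval_nat_numeral coeff_pCons)
  qed (simp_all add: pd L_def)
  then have "resultant ?f (pderiv ?f) = det_rows L"
    by (simp add: resultant_def det_rows_def)
  \<comment> \<open>The minus sign is the factor \<open>(-1) ^ 3\<close> that
    \<open>monic_discriminant\<close> contributes in degree three.\<close>
  also have "\<dots> = - (a\<^sup>2 * b\<^sup>2 - 4 * b ^ 3 - 4 * a ^ 3 * c - 27 * c\<^sup>2 + 18 * a * b * c)"
    by (simp add: L_def det_rows_laplace det_rows_Nil) (simp add: algebra_simps power2_eq_square power3_eq_cube)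
  finally show ?thesis
    by (simp add: monic_discriminant_def)
qed

section \<open>Roots of the characteristic polynomial\<close>

lemma cubic_roots_obtain:
  fixes a b c :: complex
  obtains r s t where "a = - (r + s + t)" "b = r * s + r * t + s * t" "c = - (r * s * t)"
proof -
  have "\<exists>r. poly [:c, b, a, 1:] r = 0"
    by (rule fundamental_theorem_of_algebra_alt) auto
  then obtain r where r: "c + r * (b + r * (a + r)) = 0"
    by auto
  \<comment> \<open>Horner's scheme: the quotient of the cubic by \<open>x - r\<close> is
    \<open>x^2 + (a + r) x + u\<close>.\<close>
  define u where "u = b + r * (a + r)"
  have "\<exists>s. poly [:u, a + r, 1:] s = 0"
    by (rule fundamental_theorem_of_algebra_alt) auto
  then obtain s where s: "u + s * (a + r + s) = 0"
    by auto
  define t where "t = - a - r - s"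
  have a: "a = - (r + s + t)"
    by (simp add: t_def)
  have u: "u = s * t"
    using s by (simp add: t_def algebra_simps eq_neg_iff_add_eq_0)
  then have "b = s * t - r * (a + r)"
    by (simp add: u_def eq_diff_eq)
  then have "b = r * s + r * t + s * t"
    by (simp add: a algebra_simps)
  moreover have "c = - (r * s * t)"
    using r u by (simp add: u_def eq_neg_iff_add_eq_0 mult.assoc)
  ultimately show ?thesis
    using a that by blast
qed

lemma det_eq_0_iff_kernel:
  fixes A :: "'a::field^'n^'n"
  shows "Determinants.det A = 0 \<longleftrightarrow> (\<exists>v. v \<noteq> 0 \<and> A *v v = 0)"
  using invertible_det_nz[of A] matrix_left_invertible_ker[of A]
  by (metis invertible_left_inverse)

lemma eigenvalue_iff_charpoly:
  fixes S :: "'a::field^3^3"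
  shows "(\<exists>v. v \<noteq> 0 \<and> S *v v = l *s v) \<longleftrightarrow> poly (charpoly S) l = 0"
proof -
  let ?A = "Finite_Cartesian_Product.mat l - S"
  have "poly (charpoly S) l = Determinants.det ?A"
    unfolding charpoly_3 det_3 by (simp add: Finite_Cartesian_Product.mat_def algebra_simps)
  moreover have "?A *v v = l *s v - S *v v" for v
    by (simp add: vec_eq_iff Finite_Cartesian_Product.mat_def matrix_vector_mult_def sum_3 forall_3
        algebra_simps)
  ultimately show ?thesis
    using det_eq_0_iff_kernel[of ?A] by auto
qed

text \<open>The discriminant is the square of the product of the root differences, and the roots are
  the eigenvalues.\<close>

lemma distinct_eigenvalues_iff:
  "distinct_eigenvalues S \<longleftrightarrow> monic_discriminant (charpoly S) \<noteq> 0"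
proof -
  obtain a b c where abc: "charpoly S = [:c, b, a, 1:]"
    using charpoly_3 by blast
  obtain r s t where rst: "a = - (r + s + t)" "b = r * s + r * t + s * t" "c = - (r * s * t)"
    by (rule cubic_roots_obtain)
  have "poly (charpoly S) l = (l - r) * (l - s) * (l - t)" for l
    unfolding abc rst by (simp add: algebra_simps)
  then have "{l. \<exists>v. v \<noteq> 0 \<and> S *v v = l *s v} = {r, s, t}"
    by (auto simp: eigenvalue_iff_charpoly)
  moreover have "card {r, s, t} = 3 \<longleftrightarrow> r \<noteq> s \<and> r \<noteq> t \<and> s \<noteq> t"
    by (auto simp: card_insert_if)
  moreover have "monic_discriminant (charpoly S) = ((r - s) * (r - t) * (s - t))\<^sup>2"
    unfolding abc monic_discriminant_cubic rst
    by (simp add: power2_eq_square power3_eq_cube algebra_simps)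
  ultimately show ?thesis
    by (auto simp: distinct_eigenvalues_def)
qed

section \<open>Orbits of pairs of special orthogonal matrices\<close>

text \<open>The coefficient ring is arbitrary so that the same term can be formed for
  \<open>generic_matrix\<close> and for complex matrices, and evaluation maps one to the
  other.\<close>

definition inv1 :: "'a::comm_ring_1^3^3 \<Rightarrow> 'a" where
  "inv1 M = - Polynomial.coeff (charpoly (M ** Finite_Cartesian_Product.transpose M)) 2"

definition inv2 :: "'a::comm_ring_1^3^3 \<Rightarrow> 'a" where
  "inv2 M = Polynomial.coeff (charpoly (M ** Finite_Cartesian_Product.transpose M)) 1"

lemma charpoly_times_transpose:
  fixes M :: "'a::comm_ring_1^3^3"
  shows "charpoly (M ** Finite_Cartesian_Product.transpose M) =
    [:- (Determinants.det M)\<^sup>2, inv2 M, - inv1 M, 1:]"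
proof -
  have "Polynomial.coeff (charpoly (M ** Finite_Cartesian_Product.transpose M)) 0 =
      - (Determinants.det M)\<^sup>2"
    by (simp add: charpoly_3 det_mul det_transpose power2_eq_square)
  then show ?thesis
    unfolding inv1_def inv2_def by (simp add: charpoly_3 eval_nat_numeral)
qed

lemma inv1_explicit:
  fixes M :: "'a::comm_ring_1^3^3"
  shows "inv1 M = (M$1$1)\<^sup>2 + (M$1$2)\<^sup>2 + (M$1$3)\<^sup>2 + (M$2$1)\<^sup>2 + (M$2$2)\<^sup>2 + (M$2$3)\<^sup>2
    + (M$3$1)\<^sup>2 + (M$3$2)\<^sup>2 + (M$3$3)\<^sup>2"
  by (simp add: inv1_def charpoly_3 eval_nat_numeral matrix_matrix_mult_def
      Finite_Cartesian_Product.transpose_def sum_3)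

text \<open>Cauchy-Binet: the sum of the squares of all nine minors of size two.\<close>

lemma inv2_explicit:
  fixes M :: "'a::comm_ring_1^3^3"
  shows "inv2 M =
    (M$1$1 * M$2$2 - M$1$2 * M$2$1)\<^sup>2 + (M$1$1 * M$2$3 - M$1$3 * M$2$1)\<^sup>2 + (M$1$2 * M$2$3 - M$1$3 * M$2$2)\<^sup>2
    + (M$1$1 * M$3$2 - M$1$2 * M$3$1)\<^sup>2 + (M$1$1 * M$3$3 - M$1$3 * M$3$1)\<^sup>2 + (M$1$2 * M$3$3 - M$1$3 * M$3$2)\<^sup>2
    + (M$2$1 * M$3$2 - M$2$2 * M$3$1)\<^sup>2 + (M$2$1 * M$3$3 - M$2$3 * M$3$1)\<^sup>2 + (M$2$2 * M$3$3 - M$2$3 * M$3$2)\<^sup>2"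
  by (simp add: inv2_def charpoly_3 eval_nat_numeral matrix_matrix_mult_def
      Finite_Cartesian_Product.transpose_def sum_3 algebra_simps)

text \<open>
  A Kostant-Rallis section: conjugated by an isotropic basis, it is the companion-like matrix with
  rows (1,0,0), (0,0,1), (x,d,z). No such section exists over the reals, since \<open>inv1\<close> is
  nonnegative on real matrices.
\<close>

definition sect :: "complex \<Rightarrow> complex \<Rightarrow> complex \<Rightarrow> complex^3^3" where
  "sect p q d = (let z = p / 2; x = (z\<^sup>2 - q) / 2 in
     vector [vector [1 + x / 2 + z / 4, \<i> * (1 + x / 2 - z / 4), d / 2],
             vector [\<i> * (1 - x / 2 - z / 4), - 1 + x / 2 - z / 4, - \<i> * d / 2],
             vector [1 / 2, - \<i> / 2, 0]])"

lemma inv_sect: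
  "inv1 (sect p q d) = p" "inv2 (sect p q d) = q" "Determinants.det (sect p q d) = d"
proof -
  have ii: "\<i> * (\<i> * t) = - t" for t
    by (simp add: mult.assoc[symmetric])
  \<comment> \<open>A quarter of the parameters \<open>z\<close> and \<open>x\<close> in
    \<open>sect\<close>, so that the entries become integer combinations of them.\<close>
  define z x where "z = p / 8" "x = ((p / 2)\<^sup>2 - q) / 8"
  define a b e f c where "a = 1 + 2 * x + z" "b = 1 + 2 * x - z" "e = 1 - 2 * x - z"
    "f = - 1 + 2 * x - z" "c = d / 2"
  have pq: "p = 8 * z" "q = 16 * z\<^sup>2 - 8 * x" "d = 2 * c"
    by (simp_all add: z_x_def a_b_e_f_c_def power2_eq_square diff_divide_distrib)
  have S: "sect p q d = vector [vector [a, \<i> * b, c], vector [\<i> * e, f, - (\<i> * c)], vector [1 / 2, - (\<i> / 2), 0]]"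
    by (simp add: sect_def z_x_def a_b_e_f_c_def Let_def diff_divide_distrib)
  have "inv1 (sect p q d) = a\<^sup>2 - b\<^sup>2 - e\<^sup>2 + f\<^sup>2"
    unfolding S by (simp add: inv1_explicit power_mult_distrib power_divide)
  also have "\<dots> = p"
    unfolding pq a_b_e_f_c_def by (simp add: power2_eq_square algebra_simps)
  finally show "inv1 (sect p q d) = p" .
  have "inv2 (sect p q d) = (a * f + b * e)\<^sup>2 - (a + b)\<^sup>2 / 4 + (e - f)\<^sup>2 / 4 + c\<^sup>2 * ((b - f)\<^sup>2 - (a + e)\<^sup>2)"
    unfolding S by (simp add: inv2_explicit power2_eq_square ii algebra_simps add_divide_distrib diff_divide_distrib)
  also have "\<dots> = q"
  proof -
    \<comment> \<open>As \<open>a + e\<close> and \<open>b - f\<close> agree, the term with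
      \<open>c\<close> cancels, so \<open>inv2\<close> does not depend on \<open>d\<close>; the
      determinant below is their sum times \<open>c / 2\<close>.\<close>
    have "a + e = 2" "b - f = 2" "(a + b) / 2 = 1 + 2 * x" "(e - f) / 2 = 1 - 2 * x"
      by (simp_all add: a_b_e_f_c_def)
    moreover have "a * f + b * e = - 4 * z"
      unfolding a_b_e_f_c_def by (simp add: algebra_simps)
    moreover have "(a + b)\<^sup>2 / 4 = ((a + b) / 2)\<^sup>2" "(e - f)\<^sup>2 / 4 = ((e - f) / 2)\<^sup>2"
      by (simp_all add: power_divide)
    ultimately show ?thesis
      unfolding pq by (simp only:) (simp add: power2_eq_square algebra_simps)
  qed
  finally show "inv2 (sect p q d) = q" .
  have "Determinants.det (sect p q d) = c * (b - f) / 2 + c * (a + e) / 2"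
    unfolding S by (simp add: det_3 ii algebra_simps add_divide_distrib diff_divide_distrib)
  also have "\<dots> = d"
    by (simp add: a_b_e_f_c_def)
  finally show "Determinants.det (sect p q d) = d" .
qed

text \<open>The bilinear form without conjugation, which is the one that complex \<open>SO3\<close>
  preserves. Nonzero vectors can therefore be isotropic.\<close>

definition dot3 :: "complex^3 \<Rightarrow> complex^3 \<Rightarrow> complex" where
  "dot3 u v = u$1 * v$1 + u$2 * v$2 + u$3 * v$3"

definition cross :: "complex^3 \<Rightarrow> complex^3 \<Rightarrow> complex^3" where
  "cross u v = vector [u$2 * v$3 - u$3 * v$2, u$3 * v$1 - u$1 * v$3, u$1 * v$2 - u$2 * v$1]"

lemma dot3_commute: "dot3 u v = dot3 v u"
  by (simp add: dot3_def mult.commute)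

lemma dot3_scale [simp]: "dot3 (c *s u) v = c * dot3 u v" "dot3 u (c *s v) = c * dot3 u v"
  by (simp_all add: dot3_def algebra_simps)

lemma dot3_cross [simp]: "dot3 u (cross u v) = 0" "dot3 v (cross u v) = 0"
  "dot3 (cross u v) u = 0" "dot3 (cross u v) v = 0"
  by (simp_all add: dot3_def cross_def algebra_simps)

lemma dot3_cross_cross: "dot3 (cross u v) (cross u v) = dot3 u u * dot3 v v - (dot3 u v)\<^sup>2"
  by (simp add: dot3_def cross_def algebra_simps power2_eq_square)

lemma dot3_matrix_left: "dot3 (S *v u) v = dot3 u (Finite_Cartesian_Product.transpose S *v v)"
  by (simp add: dot3_def matrix_vector_mult_def Finite_Cartesian_Product.transpose_def sum_3 algebra_simps)

lemma sandwich_nth: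
  fixes A M B :: "complex^3^3"
  shows "(A ** M ** Finite_Cartesian_Product.transpose B) $ i $ j = dot3 (A $ i) (M *v (B $ j))"
  by (simp add: dot3_def matrix_vector_mult_def matrix_matrix_mult_def
      Finite_Cartesian_Product.transpose_def sum_3 algebra_simps)

text \<open>Combining the equations with the coefficients of \<open>(x - m) (x - n)\<close>
  eliminates \<open>b\<close> and \<open>c\<close>.\<close>

lemma vandermonde_3:
  fixes a b c :: "'a::field"
  assumes "a + b + c = 0" "a * l + b * m + c * n = 0" "a * l\<^sup>2 + b * m\<^sup>2 + c * n\<^sup>2 = 0"
    and "l \<noteq> m" "l \<noteq> n"
  shows "a = 0"
proof -
  have "a * ((l - m) * (l - n)) =
      (a * l\<^sup>2 + b * m\<^sup>2 + c * n\<^sup>2) - (m + n) * (a * l + b * m + c * n) + m * n * (a + b + c)"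
    by (simp add: algebra_simps power2_eq_square)
  also have "\<dots> = 0"
    by (simp only: assms) simp
  finally show ?thesis
    using assms(4,5) by simp
qed

lemma eigenvectors_orthogonal:
  assumes S: "Finite_Cartesian_Product.transpose S = S"
    and "S *v u = l *s u" "S *v v = m *s v" "l \<noteq> m"
  shows "dot3 u v = 0"
proof -
  have "l * dot3 u v = dot3 (S *v u) v"
    using assms by simp
  also have "\<dots> = m * dot3 u v"
    by (simp only: dot3_matrix_left S assms(3) dot3_scale)
  finally show ?thesis
    using assms(4) by simp
qed

text \<open>Applying \<open>S\<close> once and twice to the relation yields a Vandermonde system in
  each coordinate; a coordinate in which \<open>u\<close> is nonzero gives the claim.\<close>

lemma eigenvectors_independent:
  fixes S :: "'a::field^'n^'n"
  assumes eig: "S *v u = l *s u" "S *v v = m *s v" "S *v w = n *s w" and "u \<noteq> 0" and "l \<noteq> m" "l \<noteq> n"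
    and zero: "a *s u + b *s v + c *s w = 0"
  shows "a = 0"
proof -
  have 1: "(a * l) *s u + (b * m) *s v + (c * n) *s w = 0"
    using arg_cong[OF zero, of "\<lambda>x. S *v x"] eig
    by (simp add: matrix_vector_right_distrib vector_scalar_commute vector_smult_assoc mult.commute)
  have 2: "(a * l\<^sup>2) *s u + (b * m\<^sup>2) *s v + (c * n\<^sup>2) *s w = 0"
    using arg_cong[OF 1, of "\<lambda>x. S *v x"] eig
    by (simp add: matrix_vector_right_distrib vector_scalar_commute vector_smult_assoc
        power2_eq_square mult.assoc)
  obtain k where k: "u $ k \<noteq> 0"
    using \<open>u \<noteq> 0\<close> by (auto simp: vec_eq_iff)
  have "a * u$k = 0"
  proof (rule vandermonde_3)
    show "a * u$k + b * v$k + c * w$k = 0"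
      using arg_cong[OF zero, of "\<lambda>x. x $ k"] by simp
    show "a * u$k * l + b * v$k * m + c * w$k * n = 0"
      using arg_cong[OF 1, of "\<lambda>x. x $ k"] by (simp add: mult_ac)
    show "a * u$k * l\<^sup>2 + b * v$k * m\<^sup>2 + c * w$k * n\<^sup>2 = 0"
      using arg_cong[OF 2, of "\<lambda>x. x $ k"] by (simp add: mult_ac)
  qed (use assms in auto)
  then show ?thesis
    using k by simp
qed

text \<open>
  Over the complex numbers an eigenvector may be isotropic; this is excluded for simple eigenvalues,
  since the eigenvector would be orthogonal to a basis.
\<close>

lemma eigenvector_not_isotropic:
  assumes S: "Finite_Cartesian_Product.transpose S = S"
    and eig: "S *v u = l *s u" "S *v v = m *s v" "S *v w = n *s w"
    and ne: "u \<noteq> 0" "v \<noteq> 0" "w \<noteq> 0" and dist: "l \<noteq> m" "l \<noteq> n" "m \<noteq> n"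
  shows "dot3 u u \<noteq> 0"
proof
  assume iso: "dot3 u u = 0"
  define A :: "complex^3^3" where "A = vector [u, v, w]"
  have "A *v u = 0"
    using iso eigenvectors_orthogonal[OF S eig(2,1)] eigenvectors_orthogonal[OF S eig(3,1)] dist
    by (simp add: A_def vec_eq_iff forall_3 matrix_vector_mult_def sum_3 dot3_def)
  then have "Determinants.det A = 0"
    using ne(1) unfolding det_eq_0_iff_kernel by blast
  then have "Determinants.det (Finite_Cartesian_Product.transpose A) = 0"
    by (simp only: det_transpose)
  then obtain c where c: "c \<noteq> 0" "Finite_Cartesian_Product.transpose A *v c = 0"
    unfolding det_eq_0_iff_kernel by blast
  have uvw: "c$1 *s u + c$2 *s v + c$3 *s w = 0"
    using c(2)
    by (simp add: A_def vec_eq_iff forall_3 matrix_vector_mult_def sum_3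
        Finite_Cartesian_Product.transpose_def mult.commute del: transpose_matrix_vector)
  have "c$1 = 0"
    using eigenvectors_independent[OF eig ne(1) dist(1,2) uvw] .
  moreover have "c$2 = 0"
    using eigenvectors_independent[OF eig(2,1,3) ne(2) dist(1)[symmetric] dist(3), of "c$2" "c$1" "c$3"] uvw
    by (simp add: add_ac)
  moreover have "c$3 = 0"
    using eigenvectors_independent[OF eig(3,1,2) ne(3) dist(2,3)[symmetric], of "c$3" "c$1" "c$2"] uvw
    by (simp add: add_ac)
  ultimately show False
    using c(1) by (simp add: vec_eq_iff forall_3)
qed

lemma normalised_eigenvector:
  assumes "S *v u = l *s u" "dot3 u u \<noteq> 0"
  shows "\<exists>u'. S *v u' = l *s u' \<and> dot3 u' u' = 1"
proof (intro exI conjI)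
  let ?c = "1 / csqrt (dot3 u u)"
  show "S *v (?c *s u) = l *s (?c *s u)"
    using assms(1) by (simp add: vector_scalar_commute vector_smult_assoc mult.commute)
  show "dot3 (?c *s u) (?c *s u) = 1"
    using assms(2) by (simp add: power2_eq_square[symmetric])
qed

text \<open>The squared length of the cross product is 1 by Lagrange's identity, and it is at the
  same time the determinant of the frame.\<close>

lemma SO3_frame:
  assumes "dot3 u u = 1" "dot3 v v = 1" "dot3 u v = 0"
  shows "vector [u, v, cross u v] \<in> carrier SO3"
proof -
  let ?A = "vector [u, v, cross u v] :: complex^3^3"
  have cc: "dot3 (cross u v) (cross u v) = 1"
    using assms by (simp add: dot3_cross_cross)
  have "(?A ** Finite_Cartesian_Product.transpose ?A) $ i $ j = dot3 (?A $ i) (?A $ j)" for i j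
    using sandwich_nth[of ?A "Finite_Cartesian_Product.mat 1" ?A i j] by simp
  moreover have "dot3 v u = 0"
    using assms by (simp add: dot3_commute)
  ultimately have "?A ** Finite_Cartesian_Product.transpose ?A = Finite_Cartesian_Product.mat 1"
    using assms cc by (simp add: vec_eq_iff forall_3 Finite_Cartesian_Product.mat_def)
  moreover from this have "Finite_Cartesian_Product.transpose ?A ** ?A = Finite_Cartesian_Product.mat 1"
    by (simp add: matrix_left_right_inverse)
  moreover have "Determinants.det ?A = dot3 (cross u v) (cross u v)"
    by (simp add: det_3 dot3_def cross_def algebra_simps)
  ultimately show ?thesis
    using cc by (simp add: SO3_def orthogonal_matrix_def)
qed

text \<open>A singular value decomposition from two singular pairs. The right vectors are
  \<open>M^t u / s\<close> and \<open>M^t v / t\<close>, and cross products complete both frames.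
  Orthogonality kills the entries off the diagonal; the last diagonal entry follows from the
  determinant, so the third eigenvalue may be zero.\<close>

lemma normal_form:
  fixes M :: "complex^3^3"
  defines "S \<equiv> M ** Finite_Cartesian_Product.transpose M"
  assumes eig: "S *v u = s\<^sup>2 *s u" "S *v v = t\<^sup>2 *s v" and st: "s \<noteq> 0" "t \<noteq> 0"
    and uv: "dot3 u u = 1" "dot3 v v = 1" "dot3 u v = 0"
  shows "\<exists>R1\<in>carrier SO3. \<exists>R2\<in>carrier SO3. R1 ** M ** Finite_Cartesian_Product.transpose R2 =
    vector [vector [s, 0, 0], vector [0, t, 0], vector [0, 0, Determinants.det M / (s * t)]]"
proof -
  note transpose_matrix_vector [simp del]
  let ?Mt = "Finite_Cartesian_Product.transpose M"
  define x y where "x = (1 / s) *s (?Mt *v u)" "y = (1 / t) *s (?Mt *v v)"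
  have adj: "dot3 (?Mt *v a) b = dot3 a (M *v b)" for a b
    by (simp only: dot3_matrix_left transpose_transpose)
  have Mx: "M *v x = s *s u" and My: "M *v y = t *s v"
    using eig st by (simp_all add: x_y_def vector_scalar_commute matrix_vector_mul_assoc
        S_def vector_smult_assoc power2_eq_square)
  have x: "dot3 x b = dot3 u (M *v b) / s" and y: "dot3 y b = dot3 v (M *v b) / t" for b
    by (simp_all add: x_y_def adj)
  have vu: "dot3 v u = 0"
    using uv by (simp add: dot3_commute)
  have xy: "dot3 x x = 1" "dot3 y y = 1" "dot3 x y = 0"
    using uv st by (simp_all add: x y Mx My)
  define z where "z = cross x y"
  have z: "dot3 u (M *v z) = 0" "dot3 v (M *v z) = 0"
    using x[of z] y[of z] st by (simp_all add: z_def)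
  let ?R1 = "vector [u, v, cross u v] :: complex^3^3" and ?R2 = "vector [x, y, z] :: complex^3^3"
  let ?N = "?R1 ** M ** Finite_Cartesian_Product.transpose ?R2"
  define c where "c = dot3 (cross u v) (M *v z)"
  have R: "?R1 \<in> carrier SO3" "?R2 \<in> carrier SO3"
    using SO3_frame[OF uv] SO3_frame[OF xy] by (simp_all add: z_def)
  have N: "?N = vector [vector [s, 0, 0], vector [0, t, 0], vector [0, 0, c]]"
    using uv vu z by (simp add: vec_eq_iff forall_3 sandwich_nth Mx My c_def)
  have "Determinants.det ?N = Determinants.det M"
    using R by (simp add: det_mul det_transpose SO3_def)
  then have "c = Determinants.det M / (s * t)"
    using st unfolding N det_3 by (simp add: field_simps)
  then show ?thesis
    using R N by blast
qed

section \<open>Separation of orbits\<close>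

lemma SO3_mult: "R \<in> carrier SO3 \<Longrightarrow> Q \<in> carrier SO3 \<Longrightarrow> R ** Q \<in> carrier SO3"
proof -
  assume R: "R \<in> carrier SO3" and Q: "Q \<in> carrier SO3"
  let ?t = Finite_Cartesian_Product.transpose
  have "?t (R ** Q) ** (R ** Q) = ?t Q ** (?t R ** R) ** Q"
    by (simp add: matrix_transpose_mul matrix_mul_assoc)
  moreover have "(R ** Q) ** ?t (R ** Q) = R ** (Q ** ?t Q) ** ?t R"
    by (simp add: matrix_transpose_mul matrix_mul_assoc)
  ultimately show ?thesis
    using R Q by (simp add: SO3_def orthogonal_matrix_def det_mul)
qed

lemma SO3_transpose: "R \<in> carrier SO3 \<Longrightarrow> Finite_Cartesian_Product.transpose R \<in> carrier SO3"
  by (simp add: SO3_def orthogonal_matrix_def det_transpose)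

lemma SO3_transpose_mult:
  assumes "R \<in> carrier SO3"
  shows "Finite_Cartesian_Product.transpose R ** R = Finite_Cartesian_Product.mat 1"
    "R ** Finite_Cartesian_Product.transpose R = Finite_Cartesian_Product.mat 1"
  using assms by (simp_all add: SO3_def orthogonal_matrix_def)

lemma SO3_one: "Finite_Cartesian_Product.mat 1 \<in> carrier SO3"
  by (simp add: SO3_def orthogonal_matrix_def)

text \<open>At most one of three distinct eigenvalues is zero; it is put in the last place.\<close>

lemma distinct_eigenvalues_obtain:
  assumes "distinct_eigenvalues S"
  obtains l m n where "l \<noteq> m" "l \<noteq> n" "m \<noteq> n" "l \<noteq> 0" "m \<noteq> 0"
    "poly (charpoly S) l = 0" "poly (charpoly S) m = 0" "poly (charpoly S) n = 0"
proof -
  obtain a b c where abc: "{l. poly (charpoly S) l = 0} = {a, b, c}" "a \<noteq> b" "a \<noteq> c" "b \<noteq> c"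
    using assms unfolding distinct_eigenvalues_def eigenvalue_iff_charpoly card_3_iff by metis
  then have "poly (charpoly S) a = 0" "poly (charpoly S) b = 0" "poly (charpoly S) c = 0"
    by blast+
  then show ?thesis
    using that[of a b c] that[of a c b] that[of b c a] abc(2-4) by metis
qed

text \<open>The square roots \<open>s\<close> and \<open>t\<close> are parameters so that two
  matrices with equal invariants can be brought to literally the same diagonal matrix.\<close>

lemma orbit_normal_form:
  fixes M :: "complex^3^3"
  defines "S \<equiv> M ** Finite_Cartesian_Product.transpose M"
  assumes dist: "l \<noteq> m" "l \<noteq> n" "m \<noteq> n" and st: "s\<^sup>2 = l" "t\<^sup>2 = m" "s \<noteq> 0" "t \<noteq> 0"
    and roots: "poly (charpoly S) l = 0" "poly (charpoly S) m = 0" "poly (charpoly S) n = 0"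
  shows "\<exists>R1\<in>carrier SO3. \<exists>R2\<in>carrier SO3. R1 ** M ** Finite_Cartesian_Product.transpose R2 =
    vector [vector [s, 0, 0], vector [0, t, 0], vector [0, 0, Determinants.det M / (s * t)]]"
proof -
  have S: "Finite_Cartesian_Product.transpose S = S"
    by (simp add: S_def matrix_transpose_mul)
  obtain u v w where eig: "S *v u = l *s u" "S *v v = m *s v" "S *v w = n *s w"
    and ne: "u \<noteq> 0" "v \<noteq> 0" "w \<noteq> 0"
    using roots unfolding eigenvalue_iff_charpoly[symmetric] by blast
  have "dot3 u u \<noteq> 0"
    by (rule eigenvector_not_isotropic[OF S eig ne dist])
  moreover have "dot3 v v \<noteq> 0"
    by (rule eigenvector_not_isotropic[OF S eig(2,1,3) ne(2,1,3) dist(1)[symmetric] dist(3,2)])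
  ultimately obtain u' v' where *: "S *v u' = l *s u'" "S *v v' = m *s v'" "dot3 u' u' = 1" "dot3 v' v' = 1"
    using normalised_eigenvector eig by metis
  then have "dot3 u' v' = 0"
    using eigenvectors_orthogonal[OF S] dist(1) by blast
  then show ?thesis
    using normal_form[of M u' s v' t] * st by (simp add: S_def)
qed

lemma same_orbit:
  fixes M N :: "complex^3^3"
  assumes dist: "distinct_eigenvalues (M ** Finite_Cartesian_Product.transpose M)"
    and inv: "inv1 M = inv1 N" "inv2 M = inv2 N" "Determinants.det M = Determinants.det N"
  shows "\<exists>R1\<in>carrier SO3. \<exists>R2\<in>carrier SO3. R1 ** M ** Finite_Cartesian_Product.transpose R2 = N"
proof -
  let ?t = Finite_Cartesian_Product.transpose
  have cp: "charpoly (M ** ?t M) = charpoly (N ** ?t N)"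
    by (simp add: charpoly_times_transpose inv)
  obtain l m n where lmn: "l \<noteq> m" "l \<noteq> n" "m \<noteq> n" "l \<noteq> 0" "m \<noteq> 0"
    and roots: "poly (charpoly (M ** ?t M)) l = 0" "poly (charpoly (M ** ?t M)) m = 0"
      "poly (charpoly (M ** ?t M)) n = 0"
    using distinct_eigenvalues_obtain[OF dist] by blast
  have sq: "(csqrt l)\<^sup>2 = l" "(csqrt m)\<^sup>2 = m" "csqrt l \<noteq> 0" "csqrt m \<noteq> 0"
    using lmn by simp_all
  obtain R1 R2 Q1 Q2 where R: "R1 \<in> carrier SO3" "R2 \<in> carrier SO3"
    and Q: "Q1 \<in> carrier SO3" "Q2 \<in> carrier SO3" and eq: "R1 ** M ** ?t R2 = Q1 ** N ** ?t Q2"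
    using orbit_normal_form[OF lmn(1-3) sq roots] orbit_normal_form[OF lmn(1-3) sq roots[unfolded cp]]
    unfolding inv by metis
  have "(?t Q1 ** R1) ** M ** ?t (?t Q2 ** R2) = ?t Q1 ** (R1 ** M ** ?t R2) ** Q2"
    by (simp add: matrix_transpose_mul matrix_mul_assoc)
  also have "\<dots> = (?t Q1 ** Q1) ** N ** (?t Q2 ** Q2)"
    unfolding eq by (simp add: matrix_mul_assoc)
  also have "\<dots> = N"
    using Q by (simp add: SO3_transpose_mult)
  finally show ?thesis
    using R Q SO3_mult SO3_transpose by blast
qed

section \<open>Invariance of the basic invariants\<close>

lemma matrix_diff_sandwich:
  fixes R A B Q :: "complex^3^3"
  shows "R ** (A - B) ** Q = R ** A ** Q - R ** B ** Q"
  by (simp add: vec_eq_iff forall_3 matrix_matrix_mult_def sum_3 algebra_simps)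

text \<open>\<open>N N^t\<close> is the conjugate of \<open>M M^t\<close> by \<open>R1\<close>.
  Equality of the characteristic polynomials is tested at all complex numbers, where it is an
  identity of determinants.\<close>

lemma inv_SO3:
  fixes M :: "complex^3^3"
  assumes R: "R1 \<in> carrier SO3" "R2 \<in> carrier SO3"
  defines "N \<equiv> R1 ** M ** Finite_Cartesian_Product.transpose R2"
  shows "inv1 N = inv1 M" "inv2 N = inv2 M" "Determinants.det N = Determinants.det M"
proof -
  let ?t = Finite_Cartesian_Product.transpose
  let ?S = "M ** ?t M"
  show "Determinants.det N = Determinants.det M"
    using R by (simp add: N_def det_mul det_transpose SO3_def)
  have "N ** ?t N = R1 ** M ** (?t R2 ** R2) ** ?t M ** ?t R1"
    by (simp add: N_def matrix_transpose_mul matrix_mul_assoc)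
  then have NN: "N ** ?t N = R1 ** ?S ** ?t R1"
    using R by (simp add: SO3_transpose_mult matrix_mul_assoc)
  have cp: "poly (charpoly S) l = Determinants.det (Finite_Cartesian_Product.mat l - S)" for S :: "complex^3^3" and l
    unfolding charpoly_3 det_3 by (simp add: Finite_Cartesian_Product.mat_def algebra_simps)
  have "poly (charpoly (N ** ?t N)) l = poly (charpoly ?S) l" for l
  proof -
    let ?I = "Finite_Cartesian_Product.mat l :: complex^3^3"
    have "R1 ** ?I = ?I ** R1"
      by (simp add: vec_eq_iff forall_3 matrix_matrix_mult_def sum_3 Finite_Cartesian_Product.mat_def)
    then have "R1 ** ?I ** ?t R1 = ?I"
      using R by (simp add: matrix_mul_assoc[symmetric] SO3_transpose_mult)
    then have "?I - N ** ?t N = R1 ** (?I - ?S) ** ?t R1"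
      unfolding NN by (simp add: matrix_diff_sandwich)
    then show ?thesis
      unfolding cp using R by (simp add: det_mul det_transpose SO3_def)
  qed
  then have "charpoly (N ** ?t N) = charpoly ?S"
    by (simp add: poly_eq_poly_eq_iff[symmetric] fun_eq_iff)
  then show "inv1 N = inv1 M" "inv2 N = inv2 M"
    by (simp_all add: inv1_def inv2_def)
qed

section \<open>Complex points of real prime ideals\<close>

text \<open>Infinitely many vectors with finitely many coordinates are dependent. For a further
  coordinate, two relations with disjoint supports are combined so that this coordinate
  cancels.\<close>

lemma ex_linear_dependency:
  fixes b :: "'i \<Rightarrow> 'k \<Rightarrow> 'f::field"
  assumes "finite K" "infinite I"
  shows "\<exists>J c. finite J \<and> J \<subseteq> I \<and> (\<exists>i\<in>J. c i \<noteq> 0) \<and> (\<forall>k\<in>K. (\<Sum>i\<in>J. c i * b i k) = 0)"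
  using assms
proof (induction K arbitrary: I rule: finite_induct)
  case empty
  then obtain i where "i \<in> I"
    by fastforce
  then show ?case
    by (intro exI[of _ "{i}"] exI[of _ "\<lambda>_. 1"]) auto
next
  case (insert k K)
  obtain J1 c1 where 1: "finite J1" "J1 \<subseteq> I" "\<exists>i\<in>J1. c1 i \<noteq> 0" "\<forall>k\<in>K. (\<Sum>i\<in>J1. c1 i * b i k) = 0"
    using insert.IH[OF insert.prems] by blast
  have inf: "infinite (I - J1)"
    using insert.prems 1(1) by simp
  obtain J2 c2 where 2: "finite J2" "J2 \<subseteq> I - J1" "\<exists>i\<in>J2. c2 i \<noteq> 0"
    "\<forall>k\<in>K. (\<Sum>i\<in>J2. c2 i * b i k) = 0"
    using insert.IH[OF inf] by blast
  define x1 x2 where "x1 = (\<Sum>i\<in>J1. c1 i * b i k)" "x2 = (\<Sum>i\<in>J2. c2 i * b i k)"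
  show ?case
  proof (cases "x1 = 0")
    case True
    then show ?thesis
      using 1 by (intro exI[of _ J1] exI[of _ c1]) (auto simp: x1_x2_def)
  next
    case False
    \<comment> \<open>Disjoint supports keep the coefficients on \<open>J2\<close> free of
      cancellation; they are nonzero multiples of \<open>c2\<close> because \<open>x1\<close> is
      nonzero.\<close>
    define c where "c i = (if i \<in> J1 then x2 * c1 i else - (x1 * c2 i))" for i
    have sum: "(\<Sum>i\<in>J1 \<union> J2. c i * b i l) = x2 * (\<Sum>i\<in>J1. c1 i * b i l) - x1 * (\<Sum>i\<in>J2. c2 i * b i l)" for l
    proof -
      have "(\<Sum>i\<in>J1. c i * b i l) = x2 * (\<Sum>i\<in>J1. c1 i * b i l)"
        by (simp add: c_def sum_distrib_left mult.assoc)
      moreover have "(\<Sum>i\<in>J2. c i * b i l) = - x1 * (\<Sum>i\<in>J2. c2 i * b i l)"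
        unfolding sum_distrib_left using 2(2) by (intro sum.cong) (auto simp: c_def)
      moreover have "J1 \<inter> J2 = {}"
        using 2(2) by blast
      ultimately show ?thesis
        using 1(1) 2(1) by (simp add: sum.union_disjoint)
    qed
    obtain i where "i \<in> J2" "c2 i \<noteq> 0"
      using 2(3) by blast
    then have "i \<in> J1 \<union> J2" "c i \<noteq> 0"
      using False 2(2) by (auto simp: c_def)
    moreover have "(\<Sum>i\<in>J1 \<union> J2. c i * b i l) = 0" if "l \<in> insert k K" for l
      using that 1(4) 2(4) by (auto simp: sum x1_x2_def)
    ultimately show ?thesis
      using 1(1,2) 2(1,2) by (intro exI[of _ "J1 \<union> J2"] exI[of _ c]) blast
  qed
qed

section \<open>Residues modulo primes of complex polynomials\<close>

lemma const_poly_hom: "comm_ring_hom (const_poly :: 'c::comm_ring_1 \<Rightarrow> ('v \<Rightarrow>\<^sub>0 nat) \<Rightarrow>\<^sub>0 'c)"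
  by unfold_locales (simp_all add: const_poly_def single_add mult_single)

lemma prime_in_const:
  fixes M :: "(('v \<Rightarrow>\<^sub>0 nat) \<Rightarrow>\<^sub>0 'f::field) set"
  assumes M: "prime_in UNIV M" and c: "const_poly c \<in> M"
  shows "c = 0"
proof (rule ccontr)
  interpret comm_ring_hom "const_poly :: 'f \<Rightarrow> ('v \<Rightarrow>\<^sub>0 nat) \<Rightarrow>\<^sub>0 'f"
    by (rule const_poly_hom)
  assume "c \<noteq> 0"
  then have "const_poly (1 / c) * const_poly c = (1 :: ('v \<Rightarrow>\<^sub>0 nat) \<Rightarrow>\<^sub>0 'f)"
    by (simp add: hom_mult[symmetric])
  then show False
    using ideal_in_lmult[OF prime_in_ideal[OF M] _ c, of "const_poly (1 / c)"] prime_in_1[OF M] by simp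
qed

text \<open>Over the complex numbers \<open>h\<close> splits into linear factors, one of which must
  lie in the prime \<open>M\<close> after substituting \<open>t\<close>; a nonzero constant
  cannot.\<close>

lemma prime_in_root:
  fixes M :: "(('v \<Rightarrow>\<^sub>0 nat) \<Rightarrow>\<^sub>0 complex) set"
  assumes M: "prime_in UNIV M" and h: "h \<noteq> 0" "poly (map_poly const_poly h) t \<in> M"
  shows "\<exists>z. t - const_poly z \<in> M"
  using h
proof (induction "Polynomial.degree h" arbitrary: h)
  case 0
  then obtain c where c: "h = [:c:]" "c \<noteq> 0"
    by (metis degree_eq_zeroE pCons_0_0)
  then show ?case
    using 0 prime_in_const[OF M, of c] by (simp add: map_poly_pCons)
next
  case (Suc n)
  interpret map_poly_comm_ring_hom "const_poly :: complex \<Rightarrow> ('v \<Rightarrow>\<^sub>0 nat) \<Rightarrow>\<^sub>0 complex"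
    by (intro map_poly_comm_ring_hom.intro const_poly_hom)
  have "\<not> constant (poly h)"
    using Suc.hyps(2) by (simp add: constant_degree)
  then obtain z where "poly h z = 0"
    using fundamental_theorem_of_algebra by blast
  then obtain g where g: "h = [:- z, 1:] * g"
    by (metis dvdE poly_eq_0_iff_dvd)
  then have g0: "g \<noteq> 0"
    using Suc.prems(1) by auto
  have "Polynomial.degree h = Suc (Polynomial.degree g)"
    unfolding g using degree_mult_eq[of "[:- z, 1:]" g] g0 by (simp del: mult_pCons_left)
  then have "Polynomial.degree g = n"
    using Suc.hyps(2) by simp
  moreover have "(t - const_poly z) * poly (map_poly const_poly g) t \<in> M"
    using Suc.prems(2) unfolding g hom_mult
    by (simp add: map_poly_pCons base.hom_uminus algebra_simps)
  then have "t - const_poly z \<in> M \<or> poly (map_poly const_poly g) t \<in> M"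
    using prime_in_mult[OF M] by blast
  ultimately show ?case
    using Suc.hyps(1) g0 by blast
qed

lemma ideal_in_sum:
  assumes "ideal_in A p" "\<And>i. i \<in> I \<Longrightarrow> f i \<in> p"
  shows "sum f I \<in> p"
  using assms(2)
  by (induction I rule: infinite_finite_induct) (auto intro: ideal_in_0[OF assms(1)] ideal_in_add[OF assms(1)])

lemma finite_bounded_monomials:
  "finite {m :: 'v::finite \<Rightarrow>\<^sub>0 nat. \<forall>v. Poly_Mapping.lookup m v \<le> D}"
proof -
  have fin: "finite (PiE (UNIV :: 'v set) (\<lambda>_. {..D}))"
    by (intro finite_PiE) auto
  have "Poly_Mapping.lookup ` {m :: 'v \<Rightarrow>\<^sub>0 nat. \<forall>v. Poly_Mapping.lookup m v \<le> D} \<subseteq> PiE UNIV (\<lambda>_. {..D})"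
    by auto
  from finite_subset[OF this fin] show ?thesis
  proof (rule finite_imageD)
    show "inj_on Poly_Mapping.lookup {m :: 'v \<Rightarrow>\<^sub>0 nat. \<forall>v. Poly_Mapping.lookup m v \<le> D}"
      by (rule inj_onI, rule poly_mapping_eqI) simp
  qed
qed

lemma lookup_const_poly_times:
  "Poly_Mapping.lookup (const_poly c * p) m = (c::'c::comm_ring_1) * Poly_Mapping.lookup p m"
  by (simp add: const_poly_def mult_map_scale_conv_mult[symmetric] Poly_Mapping.map.rep_eq when_def)

text \<open>
  The quotient by \<open>M\<close> with \<open>d\<close> inverted is a field of countable dimension over the complex numbers.
  For a transcendental \<open>t\<close> the uncountably many \<open>1 / (t - r)\<close> would be linearly independent.
\<close>

lemma ex_residue_constant:
  fixes M :: "(('v::finite \<Rightarrow>\<^sub>0 nat) \<Rightarrow>\<^sub>0 complex) set"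
  assumes M: "prime_in UNIV M" and d: "d \<notin> M"
    and max: "\<And>t. t \<notin> M \<Longrightarrow> \<exists>n::nat. \<exists>b. d ^ n - t * b \<in> M"
  shows "\<exists>c. t - const_poly c \<in> M"
proof (rule ccontr)
  assume contra: "\<not> ?thesis"
  interpret C: map_poly_comm_ring_hom "const_poly :: complex \<Rightarrow> ('v \<Rightarrow>\<^sub>0 nat) \<Rightarrow>\<^sub>0 complex"
    by (intro map_poly_comm_ring_hom.intro const_poly_hom)
  note id = prime_in_ideal[OF M]
  \<comment> \<open>\<open>b / d ^ n\<close> is the inverse of \<open>t - r\<close> in the localised
    residue ring; \<open>D\<close> bounds the exponents in \<open>b\<close>.\<close>
  have "\<exists>n b D. d ^ n - (t - const_poly (of_real r)) * b \<in> M \<and>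
      (\<forall>m\<in>Poly_Mapping.keys b. \<forall>v. Poly_Mapping.lookup m v \<le> D)" for r :: real
    using max[of "t - const_poly (of_real r)"] contra keys_bounded by meson
  then obtain n b D where nbD: "\<And>r::real. d ^ n r - (t - const_poly (of_real r)) * b r \<in> M"
    "\<And>r m v. m \<in> Poly_Mapping.keys (b r) \<Longrightarrow> Poly_Mapping.lookup m v \<le> D r"
    by metis
  \<comment> \<open>Pigeonhole: uncountably many \<open>r\<close> but countably many pairs. For a
    fixed pair, the \<open>b r\<close> lie in one finite-dimensional space and are hence
    dependent.\<close>
  have "\<exists>k. infinite {r. (n r, D r) = k}"
  proof (rule ccontr)
    assume "\<not> ?thesis"
    then have "countable (\<Union>k. {r. (n r, D r) = k})"
      by (intro countable_UN) (auto intro: countable_finite)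
    moreover have "(\<Union>k. {r. (n r, D r) = k}) = UNIV"
      by auto
    ultimately show False
      using uncountable_UNIV_real by simp
  qed
  then obtain n0 D0 where inf: "infinite {r. (n r, D r) = (n0, D0)}"
    by (metis surj_pair)
  have "\<exists>J c. finite J \<and> J \<subseteq> {r. (n r, D r) = (n0, D0)} \<and> (\<exists>r\<in>J. c r \<noteq> 0) \<and>
      (\<forall>m\<in>{m. \<forall>v. Poly_Mapping.lookup m v \<le> D0}. (\<Sum>r\<in>J. c r * Poly_Mapping.lookup (b r) m) = 0)"
    by (rule ex_linear_dependency[OF finite_bounded_monomials inf])
  then obtain J c where J: "finite J" "J \<subseteq> {r. (n r, D r) = (n0, D0)}" "\<exists>r\<in>J. c r \<noteq> 0"
    and dep: "\<And>m. \<forall>v. Poly_Mapping.lookup m v \<le> D0 \<Longrightarrow> (\<Sum>r\<in>J. c r * Poly_Mapping.lookup (b r) m) = 0"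
    by (elim exE conjE) simp
  have "(\<Sum>r\<in>J. const_poly (c r) * b r) = 0"
  proof (rule poly_mapping_eqI)
    fix m
    have "(\<Sum>r\<in>J. c r * Poly_Mapping.lookup (b r) m) = 0"
    proof (cases "\<forall>v. Poly_Mapping.lookup m v \<le> D0")
      case False
      then have "Poly_Mapping.lookup (b r) m = 0" if "r \<in> J" for r
        using nbD(2)[of m r] that J(2) by (auto simp: in_keys_iff)
      then show ?thesis
        by simp
    qed (rule dep)
    then show "Poly_Mapping.lookup (\<Sum>r\<in>J. const_poly (c r) * b r) m = Poly_Mapping.lookup 0 m"
      by (simp add: lookup_sum lookup_const_poly_times)
  qed
  \<comment> \<open>The numerator of the sum of \<open>c r / (T - r)\<close> over the common
    denominator.\<close>
  define h where "h = (\<Sum>r\<in>J. [:c r:] * (\<Prod>s\<in>J - {r}. [:- of_real s, 1:]))"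
  define x where "x r = t - const_poly (of_real r)" for r :: real
  have phi: "poly (map_poly const_poly h) t = (\<Sum>r\<in>J. const_poly (c r) * (\<Prod>s\<in>J - {r}. x s))"
  proof -
    have "poly (map_poly const_poly [:c r:]) t = const_poly (c r)"
      "poly (map_poly const_poly [:- of_real r, 1:]) t = x r" for r
      by (cases "c r = 0"; simp add: map_poly_pCons C.base.hom_uminus x_def)+
    then show ?thesis
      by (simp only: h_def C.hom_sum C.hom_mult C.hom_prod poly_sum poly_prod poly_mult)
  qed
  \<comment> \<open>Modulo \<open>M\<close>, \<open>d ^ n0\<close> may be replaced by
    \<open>x r * b r\<close>; the factor \<open>x r\<close> completes each product, and what remains
    is the linear dependency.\<close>
  have "d ^ n0 * poly (map_poly const_poly h) t = (\<Sum>r\<in>J. const_poly (c r) * (\<Prod>s\<in>J - {r}. x s) * (d ^ n0 - x r * b r))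
      + (\<Prod>s\<in>J. x s) * (\<Sum>r\<in>J. const_poly (c r) * b r)"
    unfolding phi sum_distrib_left sum.distrib[symmetric]
  proof (rule sum.cong[OF refl])
    fix r assume "r \<in> J"
    then have "(\<Prod>s\<in>J. x s) = x r * (\<Prod>s\<in>J - {r}. x s)"
      using J(1) by (simp add: prod.remove)
    then show "d ^ n0 * (const_poly (c r) * (\<Prod>s\<in>J - {r}. x s)) =
        const_poly (c r) * (\<Prod>s\<in>J - {r}. x s) * (d ^ n0 - x r * b r) + (\<Prod>s\<in>J. x s) * (const_poly (c r) * b r)"
      by (simp add: algebra_simps)
  qed
  also have "\<dots> = (\<Sum>r\<in>J. const_poly (c r) * (\<Prod>s\<in>J - {r}. x s) * (d ^ n0 - x r * b r))"
    using \<open>(\<Sum>r\<in>J. const_poly (c r) * b r) = 0\<close> by simp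
  also have "\<dots> \<in> M"
  proof (intro ideal_in_sum[OF id] ideal_in_lmult[OF id] UNIV_I)
    fix r assume "r \<in> J"
    then have "n r = n0"
      using J(2) by auto
    then show "d ^ n0 - x r * b r \<in> M"
      using nbD(1)[of r] by (simp add: x_def)
  qed
  finally have "d ^ n0 * poly (map_poly const_poly h) t \<in> M" .
  moreover have "d ^ n0 \<notin> M"
    using prime_in_power[OF subring_set_UNIV M] d by blast
  ultimately have "poly (map_poly const_poly h) t \<in> M"
    using prime_in_mult[OF M] by blast
  moreover have "h \<noteq> 0"
  proof
    assume "h = 0"
    obtain r where r: "r \<in> J" "c r \<noteq> 0"
      using J(3) by blast
    \<comment> \<open>At the node \<open>r\<close> only the summand of \<open>r\<close> survives, as
      in Lagrange interpolation.\<close>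
    have "poly h (of_real r) = (\<Sum>r'\<in>J. c r' * (\<Prod>s\<in>J - {r'}. of_real r - of_real s))"
      by (simp add: h_def poly_sum poly_prod)
    also have "\<dots> = (\<Sum>r'\<in>J. if r' = r then c r * (\<Prod>s\<in>J - {r}. of_real r - of_real s) else 0)"
    proof (rule sum.cong[OF refl])
      fix r' assume "r' \<in> J"
      show "c r' * (\<Prod>s\<in>J - {r'}. of_real r - of_real s) =
          (if r' = r then c r * (\<Prod>s\<in>J - {r}. of_real r - of_real s) else 0)"
        using r(1) J(1) by (auto intro!: prod_zero)
    qed
    also have "\<dots> = c r * (\<Prod>s\<in>J - {r}. of_real r - of_real s)"
      using r J(1) by simp
    also have "\<dots> \<noteq> 0"
      using r J(1) by auto
    finally show False
      using \<open>h = 0\<close> by simp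
  qed
  ultimately show False
    using prime_in_root[OF M] contra by blast
qed

text \<open>A Nullstellensatz. The prime is extended to complex polynomials and enlarged to an ideal
  modulo which every element is congruent to a constant; the constants for the variables are the
  coordinates of \<open>w\<close>.\<close>

theorem ex_complex_point:
  fixes p :: "(('v::finite \<Rightarrow>\<^sub>0 nat) \<Rightarrow>\<^sub>0 real) set"
  assumes p: "prime_in UNIV p" and a: "a \<notin> p"
  shows "\<exists>w. (\<forall>s\<in>p. peval complex_of_real w s = 0) \<and> peval complex_of_real w a \<noteq> 0"
proof -
  let ?C = "const_poly :: complex \<Rightarrow> ('v \<Rightarrow>\<^sub>0 nat) \<Rightarrow>\<^sub>0 complex"
  interpret C: comm_ring_hom ?C
    by (rule const_poly_hom)
  have Cr: "comm_ring_hom (?C \<circ> of_real)"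
    by unfold_locales (simp_all add: C.hom_add C.hom_mult)
  define emb where "emb = peval (?C \<circ> of_real) var_poly"
  interpret emb: comm_ring_hom emb
    unfolding emb_def by (rule peval_hom[OF Cr])
  have ev_hom: "comm_ring_hom (peval (\<lambda>c::complex. c) w)" for w :: "'v \<Rightarrow> complex"
    by (rule peval_hom[OF comm_ring_hom_id])
  have ev_emb: "peval (\<lambda>c. c) w (emb s) = peval complex_of_real w s" for w s
    unfolding emb_def comp_peval[OF Cr ev_hom]
    by (simp add: o_def peval_const[OF comm_ring_hom_id] peval_var[OF comm_ring_hom_id])
  have ii: "?C \<i> * (?C \<i> * s) = - s" for s
    by (simp add: mult.assoc[symmetric] C.hom_mult[symmetric]) (simp add: C.hom_uminus)
  have decomp: "\<exists>u v. s = emb u + ?C \<i> * emb v" for s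
  proof (induction s rule: mpoly_induct)
    case (const c)
    have "emb (const_poly r) = ?C (of_real r)" for r
      by (simp add: emb_def peval_const[OF Cr])
    then have "?C c = emb (const_poly (Re c)) + ?C \<i> * emb (const_poly (Im c))"
      by (simp add: C.hom_mult[symmetric] C.hom_add[symmetric] complex_eq[symmetric])
    then show ?case by blast
  next
    case (var v)
    have "var_poly v = emb (var_poly v) + ?C \<i> * emb 0"
      by (simp add: emb_def peval_var[OF Cr] peval_0[OF Cr])
    then show ?case by blast
  next
    case (add s s')
    then obtain u v u' v' where "s = emb u + ?C \<i> * emb v" "s' = emb u' + ?C \<i> * emb v'"
      by blast
    then have "s + s' = emb (u + u') + ?C \<i> * emb (v + v')"
      by (simp add: emb.hom_add algebra_simps)
    then show ?case by blast
  next
    case (mult s s')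
    then obtain u v u' v' where "s = emb u + ?C \<i> * emb v" "s' = emb u' + ?C \<i> * emb v'"
      by blast
    then have "s * s' = emb (u * u' - v * v') + ?C \<i> * emb (u * v' + v * u')"
      by (simp add: emb.hom_add emb.hom_minus emb.hom_mult ii algebra_simps)
    then show ?case by blast
  qed
  note id = prime_in_ideal[OF p]
  \<comment> \<open>The extension of \<open>p\<close> to complex polynomials, split into real and
    imaginary parts.\<close>
  define J where "J = {emb u + ?C \<i> * emb v | u v. u \<in> p \<and> v \<in> p}"
  have "ideal_in UNIV J"
    unfolding ideal_in_def
  proof (intro conjI ballI)
    show "0 \<in> J"
      unfolding J_def using ideal_in_0[OF id] by (force simp: emb_def peval_0[OF Cr])
  next
    fix s s' assume "s \<in> J" "s' \<in> J"
    then obtain u v u' v' where *: "s = emb u + ?C \<i> * emb v" "s' = emb u' + ?C \<i> * emb v'"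
      "u \<in> p" "v \<in> p" "u' \<in> p" "v' \<in> p"
      by (auto simp: J_def)
    then have "s + s' = emb (u + u') + ?C \<i> * emb (v + v')"
      by (simp add: emb.hom_add algebra_simps)
    then show "s + s' \<in> J"
      unfolding J_def using * ideal_in_add[OF id] by blast
  next
    fix s s' assume "s' \<in> J"
    then obtain u v u' v' where *: "s = emb u + ?C \<i> * emb v" "s' = emb u' + ?C \<i> * emb v'"
      "u' \<in> p" "v' \<in> p"
      using decomp[of s] by (auto simp: J_def)
    then have "s * s' = emb (u * u' - v * v') + ?C \<i> * emb (u * v' + v * u')"
      by (simp add: emb.hom_add emb.hom_minus emb.hom_mult ii algebra_simps)
    moreover have "u * u' - v * v' \<in> p" "u * v' + v * u' \<in> p"
      using * by (intro ideal_in_diff[OF subring_set_UNIV id] ideal_in_add[OF id] ideal_in_lmult[OF id]; simp)+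
    ultimately show "s * s' \<in> J"
      unfolding J_def by blast
  qed simp
  moreover have "emb a ^ n \<notin> J" for n
  proof
    assume "emb a ^ n \<in> J"
    then obtain u v where uv: "emb (a ^ n) = emb u + ?C \<i> * emb v" "u \<in> p"
      by (auto simp: J_def emb.hom_power)
    \<comment> \<open>At real points, comparing real parts turns \<open>a ^ n = u + i v\<close> into
      \<open>a ^ n = u\<close>, which puts \<open>a\<close> into \<open>p\<close>.\<close>
    have "peval (\<lambda>c. c) w (a ^ n - u) = 0" for w
    proof -
      have real: "peval complex_of_real (\<lambda>v. of_real (w v)) s = of_real (peval (\<lambda>c. c) w s)" for s
        using comp_peval[OF comm_ring_hom_id comm_ring_hom_of_real[where 'a = complex], of w s] by (simp add: o_def)
      interpret ev: comm_ring_hom "peval (\<lambda>c::complex. c) (\<lambda>v. of_real (w v))"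
        by (rule ev_hom)
      interpret evr: comm_ring_hom "peval (\<lambda>c::real. c) w"
        by (rule peval_hom[OF comm_ring_hom_id])
      have "complex_of_real (peval (\<lambda>c. c) w (a ^ n)) =
          of_real (peval (\<lambda>c. c) w u) + \<i> * of_real (peval (\<lambda>c. c) w v)"
        using arg_cong[OF uv(1), of "peval (\<lambda>c. c) (\<lambda>v. of_real (w v))"]
        by (simp only: ev.hom_add ev.hom_mult ev_emb real peval_const[OF comm_ring_hom_id])
      then have "peval (\<lambda>c. c) w (a ^ n) = peval (\<lambda>c. c) w u"
        by (simp add: complex_eq_iff)
      then show ?thesis
        by (simp add: evr.hom_minus)
    qed
    then have "a ^ n = u"
      using peval_nonzero[of "a ^ n - u"] by auto
    then show False
      using prime_in_power[OF subring_set_UNIV p UNIV_I, of a n] uv(2) a by simp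
  qed
  ultimately obtain M where M: "prime_in UNIV M" "J \<subseteq> M" "emb a \<notin> M"
    and max: "\<And>t. t \<notin> M \<Longrightarrow> \<exists>n::nat. \<exists>b. emb a ^ n - t * b \<in> M"
    using ex_prime_avoiding[OF subring_set_UNIV, of J "emb a"] by blast
  note idM = prime_in_ideal[OF M(1)]
  have "\<exists>c. t - ?C c \<in> M" for t
    by (rule ex_residue_constant[OF M(1,3) max])
  then have "\<exists>w. \<forall>v. var_poly v - ?C (w v) \<in> M"
    by (intro choice) blast
  then obtain w where w: "\<And>v. var_poly v - ?C (w v) \<in> M"
    by blast
  have res: "s - ?C (peval (\<lambda>c. c) w s) \<in> M" for s
  proof (induction s rule: mpoly_induct)
    case (const c)
    then show ?case
      using ideal_in_0[OF idM] by (simp add: peval_const[OF comm_ring_hom_id])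
  next
    case (var v)
    then show ?case
      using w by (simp add: peval_var[OF comm_ring_hom_id])
  next
    case (add s s')
    then show ?case
      using ideal_in_add[OF idM add.IH]
      by (simp add: peval_add[OF comm_ring_hom_id] C.hom_add algebra_simps)
  next
    case (mult s s')
    have "s * s' - ?C (peval (\<lambda>c. c) w (s * s')) =
        s * (s' - ?C (peval (\<lambda>c. c) w s')) + ?C (peval (\<lambda>c. c) w s') * (s - ?C (peval (\<lambda>c. c) w s))"
      by (simp add: peval_mult[OF comm_ring_hom_id] C.hom_mult algebra_simps)
    then show ?case
      using mult.IH ideal_in_add[OF idM ideal_in_lmult[OF idM] ideal_in_lmult[OF idM]] by simp
  qed
  have "peval complex_of_real w s = 0" if "s \<in> p" for s
  proof -
    have "emb s + ?C \<i> * emb 0 \<in> J"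
      unfolding J_def using that ideal_in_0[OF id] by blast
    then have "emb s \<in> M"
      using M(2) by (auto simp: emb_def peval_0[OF Cr])
    then have "?C (peval (\<lambda>c. c) w (emb s)) \<in> M"
      using ideal_in_diff[OF subring_set_UNIV idM _ res[of "emb s"], of "emb s"] by simp
    then show ?thesis
      using prime_in_const[OF M(1)] by (simp add: ev_emb)
  qed
  moreover have "peval complex_of_real w a \<noteq> 0"
    using res[of "emb a"] M(3) by (auto simp: ev_emb)
  ultimately show ?thesis
    by blast
qed

section \<open>Invariant polynomials and the section\<close>

lemma eval_at_conv: "eval_at M = peval complex_of_real (\<lambda>e. M $ row e $ col e)"
proof
  fix P
  have bij: "bij_betw (\<lambda>(i, j). Entry i j) (UNIV \<times> UNIV) UNIV"
    by (rule bij_betwI[of _ _ _ "\<lambda>e. (row e, col e)"]) auto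
  have "(\<Prod>i\<in>UNIV. \<Prod>j\<in>UNIV. M $ i $ j ^ Poly_Mapping.lookup m (Entry i j)) =
      (\<Prod>e\<in>UNIV. M $ row e $ col e ^ Poly_Mapping.lookup m e)" for m
    unfolding prod.cartesian_product
    using prod.reindex_bij_betw[OF bij, of "\<lambda>e. M $ row e $ col e ^ Poly_Mapping.lookup m e"]
    by (simp add: case_prod_unfold)
  then show "eval_at M P = peval complex_of_real (\<lambda>e. M $ row e $ col e) P"
    by (simp add: eval_at_def peval_def)
qed

lemma eval_at_hom: "comm_ring_hom (eval_at M)"
  unfolding eval_at_conv by (rule peval_hom[OF comm_ring_hom_of_real])

lemma eval_at_simps [simp]:
  "eval_at M 0 = 0" "eval_at M 1 = 1" "eval_at M (p + q) = eval_at M p + eval_at M q"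
  "eval_at M (p - q) = eval_at M p - eval_at M q" "eval_at M (- p) = - eval_at M p"
  "eval_at M (p * q) = eval_at M p * eval_at M q" "eval_at M (p ^ n) = eval_at M p ^ n"
proof -
  interpret comm_ring_hom "eval_at M"
    by (rule eval_at_hom)
  show "eval_at M 0 = 0" "eval_at M 1 = 1" "eval_at M (p + q) = eval_at M p + eval_at M q"
    "eval_at M (p - q) = eval_at M p - eval_at M q" "eval_at M (- p) = - eval_at M p"
    "eval_at M (p * q) = eval_at M p * eval_at M q" "eval_at M (p ^ n) = eval_at M p ^ n"
    by (simp_all add: hom_add hom_minus hom_uminus hom_mult hom_power)
qed

lemma eval_at_const [simp]: "eval_at M (const_poly c) = of_real c"
  by (simp add: eval_at_conv peval_const[OF comm_ring_hom_of_real])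

lemma generic_matrix_nth: "generic_matrix $ i $ j = var_poly (Entry i j)"
  by (simp add: generic_matrix_def var_poly_def)

lemma eval_at_var [simp]: "eval_at M (var_poly e) = M $ row e $ col e"
  by (simp add: eval_at_conv peval_var[OF comm_ring_hom_of_real])

lemma of_real_eq_const_poly: "(of_real r :: mpoly9) = const_poly r"
  by (simp add: of_real_def scaleR_eq_single_times const_poly_def)

lemma eval_at_numeral [simp]: "eval_at M (numeral k) = numeral k"
  using eval_at_const[of M "numeral k"] by (simp add: const_poly_def)

lemma eval_at_inv [simp]:
  "eval_at M (inv1 generic_matrix) = inv1 M" "eval_at M (inv2 generic_matrix) = inv2 M"
  "eval_at M (Determinants.det generic_matrix) = Determinants.det M"
  by (simp_all add: inv1_explicit inv2_explicit det_3 generic_matrix_nth)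

section \<open>Real matrices as test points\<close>

definition complex_matrix :: "real^3^3 \<Rightarrow> complex^3^3" where
  "complex_matrix N = (\<chi> i j. of_real (N $ i $ j))"

lemma eval_at_complex_matrix: "Im (eval_at (complex_matrix N) p) = 0"
proof -
  have "eval_at (complex_matrix N) p = of_real (peval (\<lambda>c. c) (\<lambda>e. N $ row e $ col e) p)"
    using comp_peval[OF comm_ring_hom_id comm_ring_hom_of_real[where 'a = complex],
        of "\<lambda>e. N $ row e $ col e" p]
    by (simp add: eval_at_conv complex_matrix_def o_def)
  then show ?thesis
    by simp
qed

text \<open>Real points are Zariski dense; on them, moreover, real polynomials have real values, so
  that identities with complex coefficients can be split.\<close>

lemma eval_at_eq_0:
  assumes "\<And>N. eval_at (complex_matrix N) p = 0"
  shows "p = 0"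
proof (rule ccontr)
  assume "p \<noteq> 0"
  then obtain w where w: "peval (\<lambda>c. c) w p \<noteq> 0"
    using peval_nonzero by blast
  have "eval_at (complex_matrix (\<chi> i j. w (Entry i j))) p = of_real (peval (\<lambda>c. c) w p)"
    using comp_peval[OF comm_ring_hom_id comm_ring_hom_of_real[where 'a = complex], of w p]
    by (simp add: eval_at_conv complex_matrix_def o_def)
  then show False
    using w assms by simp
qed

text \<open>Only the algebra generated by the three basic invariants; that it contains every
  invariant polynomial follows with \<open>invariant_poly\<close>.\<close>

inductive_set inv_polys :: "mpoly9 set" where
  const: "const_poly c \<in> inv_polys"
| inv1: "inv1 generic_matrix \<in> inv_polys"
| inv2: "inv2 generic_matrix \<in> inv_polys"
| det: "Determinants.det generic_matrix \<in> inv_polys"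
| add: "p \<in> inv_polys \<Longrightarrow> q \<in> inv_polys \<Longrightarrow> p + q \<in> inv_polys"
| mult: "p \<in> inv_polys \<Longrightarrow> q \<in> inv_polys \<Longrightarrow> p * q \<in> inv_polys"

lemma const_poly_minus_1: "const_poly (- 1) = (- 1 :: mpoly9)"
  by (simp add: const_poly_def single_uminus)

lemma subring_set_inv_polys: "subring_set inv_polys"
proof -
  have "p - q \<in> inv_polys" if "p \<in> inv_polys" "q \<in> inv_polys" for p q
    using inv_polys.add[OF that(1) inv_polys.mult[OF inv_polys.const[of "- 1"] that(2)]]
    by (simp add: const_poly_minus_1)
  then show ?thesis
    using inv_polys.const[of 1] inv_polys.mult by (auto simp: subring_set_def const_poly_1)
qed

lemma eval_at_inv_polys:
  assumes "p \<in> inv_polys" "inv1 M = inv1 N" "inv2 M = inv2 N" "Determinants.det M = Determinants.det N"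
  shows "eval_at M p = eval_at N p"
  using assms(1) by (induction p) (use assms(2-4) in simp_all)

definition inv_sect :: "complex^3^3 \<Rightarrow> complex^3^3" where
  "inv_sect M = sect (inv1 M) (inv2 M) (Determinants.det M)"

definition act :: "(complex^3^3) \<times> (complex^3^3) \<Rightarrow> complex^3^3 \<Rightarrow> complex^3^3" where
  "act g M = fst g ** M ** Finite_Cartesian_Product.transpose (snd g)"

lemma inv_inv_sect [simp]: "inv1 (inv_sect M) = inv1 M" "inv2 (inv_sect M) = inv2 M"
  "Determinants.det (inv_sect M) = Determinants.det M"
  by (simp_all add: inv_sect_def inv_sect)

lemma carrier_matrix_group: "carrier matrix_group = carrier SO3 \<times> carrier SO3"
  by (simp add: matrix_group_def)

lemma inv_act:
  assumes "g \<in> carrier matrix_group"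
  shows "inv1 (act g M) = inv1 M" "inv2 (act g M) = inv2 M"
    "Determinants.det (act g M) = Determinants.det M"
  using assms inv_SO3[of "fst g" "snd g" M] by (auto simp: carrier_matrix_group act_def)

text \<open>The complexification of \<open>inv_polys\<close>, as functions. At a complex matrix the
  values of \<open>u\<close> and \<open>v\<close> are complex themselves, so they are real and
  imaginary part of the polynomial \<open>F\<close> but not of its value.\<close>

definition complex_inv_poly :: "(complex^3^3 \<Rightarrow> complex) \<Rightarrow> bool" where
  "complex_inv_poly F \<longleftrightarrow>
     (\<exists>u\<in>inv_polys. \<exists>v\<in>inv_polys. \<forall>M. F M = eval_at M u + \<i> * eval_at M v)"

lemma complex_inv_poly_const: "complex_inv_poly (\<lambda>M. c)"
  unfolding complex_inv_poly_def
  by (intro bexI[of _ "const_poly (Re c)"] bexI[of _ "const_poly (Im c)"])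
    (simp_all add: complex_eq[symmetric] inv_polys.const)

lemma complex_inv_poly_real: "u \<in> inv_polys \<Longrightarrow> complex_inv_poly (\<lambda>M. eval_at M u)"
  unfolding complex_inv_poly_def using subring_set_0[OF subring_set_inv_polys]
  by (intro bexI[of _ u] bexI[of _ 0]) simp_all

lemma complex_inv_poly_inv: "complex_inv_poly inv1" "complex_inv_poly inv2" "complex_inv_poly Determinants.det"
  using complex_inv_poly_real[OF inv_polys.inv1] complex_inv_poly_real[OF inv_polys.inv2]
    complex_inv_poly_real[OF inv_polys.det] by simp_all

lemma complex_inv_poly_add:
  assumes "complex_inv_poly F" "complex_inv_poly G"
  shows "complex_inv_poly (\<lambda>M. F M + G M)"
proof -
  obtain u v u' v' where *: "u \<in> inv_polys" "v \<in> inv_polys" "u' \<in> inv_polys" "v' \<in> inv_polys"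
    and F: "\<forall>M. F M = eval_at M u + \<i> * eval_at M v" and G: "\<forall>M. G M = eval_at M u' + \<i> * eval_at M v'"
    using assms by (auto simp: complex_inv_poly_def)
  show ?thesis
    unfolding complex_inv_poly_def
    by (intro bexI[of _ "u + u'"] bexI[of _ "v + v'"])
      (simp_all add: F G algebra_simps inv_polys.add *)
qed

lemma complex_inv_poly_mult:
  assumes "complex_inv_poly F" "complex_inv_poly G"
  shows "complex_inv_poly (\<lambda>M. F M * G M)"
proof -
  obtain u v u' v' where *: "u \<in> inv_polys" "v \<in> inv_polys" "u' \<in> inv_polys" "v' \<in> inv_polys"
    and F: "\<forall>M. F M = eval_at M u + \<i> * eval_at M v" and G: "\<forall>M. G M = eval_at M u' + \<i> * eval_at M v'"
    using assms by (auto simp: complex_inv_poly_def)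
  have ii: "\<i> * (\<i> * t) = - t" for t
    by (simp add: mult.assoc[symmetric])
  show ?thesis
    unfolding complex_inv_poly_def
    using * subring_set_inv_polys
    by (intro bexI[of _ "u * u' - v * v'"] bexI[of _ "u * v' + v * u'"])
      (simp_all add: F G ii algebra_simps inv_polys.add inv_polys.mult subring_set_diff)
qed

lemma complex_inv_poly_uminus: "complex_inv_poly F \<Longrightarrow> complex_inv_poly (\<lambda>M. - F M)"
  using complex_inv_poly_mult[OF complex_inv_poly_const[of "- 1"]] by simp

lemma complex_inv_poly_diff:
  "complex_inv_poly F \<Longrightarrow> complex_inv_poly G \<Longrightarrow> complex_inv_poly (\<lambda>M. F M - G M)"
  using complex_inv_poly_add[OF _ complex_inv_poly_uminus] by simp

lemma complex_inv_poly_divide: "complex_inv_poly F \<Longrightarrow> complex_inv_poly (\<lambda>M. F M / c)"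
  using complex_inv_poly_mult[OF _ complex_inv_poly_const[of "1 / c"]] by simp

lemma complex_inv_poly_power: "complex_inv_poly F \<Longrightarrow> complex_inv_poly (\<lambda>M. F M ^ n)"
  by (induction n) (auto intro: complex_inv_poly_const complex_inv_poly_mult)

lemmas complex_inv_poly_intros = complex_inv_poly_const complex_inv_poly_inv complex_inv_poly_add
  complex_inv_poly_mult complex_inv_poly_uminus complex_inv_poly_diff complex_inv_poly_divide
  complex_inv_poly_power

lemma complex_inv_poly_sect: "complex_inv_poly (\<lambda>M. inv_sect M $ i $ j)"
proof -
  have "\<forall>i j. complex_inv_poly (\<lambda>M. inv_sect M $ i $ j)"
    unfolding forall_3 inv_sect_def sect_def Let_def
    by (simp only: vector_3) (intro conjI complex_inv_poly_intros)
  then show ?thesis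
    by blast
qed

lemma complex_inv_poly_act: "complex_inv_poly (\<lambda>M. act g (inv_sect M) $ i $ j)"
  unfolding act_def matrix_matrix_mult_def sum_3 Finite_Cartesian_Product.transpose_def vec_lambda_beta
  by (intro complex_inv_poly_intros complex_inv_poly_sect)

lemma complex_inv_poly_pullback: "complex_inv_poly (\<lambda>M. eval_at (act g (inv_sect M)) s)"
  by (induction s rule: mpoly_induct)
    (simp_all add: complex_inv_poly_const complex_inv_poly_act complex_inv_poly_add complex_inv_poly_mult)

text \<open>
  Real and imaginary part of the pullback of \<open>s\<close> along \<open>M \<mapsto> g \<cdot> \<sigma>(f(M))\<close>, where \<open>f\<close> is the
  quotient map and \<open>\<sigma>\<close> the section.
\<close>

definition pullback :: "(complex^3^3) \<times> (complex^3^3) \<Rightarrow> mpoly9 \<Rightarrow> mpoly9 \<times> mpoly9" where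
  "pullback g s = (SOME (u, v). u \<in> inv_polys \<and> v \<in> inv_polys \<and>
     (\<forall>M. eval_at (act g (inv_sect M)) s = eval_at M u + \<i> * eval_at M v))"

definition re_pullback where "re_pullback g s = fst (pullback g s)"
definition im_pullback where "im_pullback g s = snd (pullback g s)"

lemma pullback:
  "re_pullback g s \<in> inv_polys" "im_pullback g s \<in> inv_polys"
  "eval_at (act g (inv_sect M)) s = eval_at M (re_pullback g s) + \<i> * eval_at M (im_pullback g s)"
proof -
  have "\<exists>uv. case uv of (u, v) \<Rightarrow> u \<in> inv_polys \<and> v \<in> inv_polys \<and>
     (\<forall>M. eval_at (act g (inv_sect M)) s = eval_at M u + \<i> * eval_at M v)"
    using complex_inv_poly_pullback[of g s] unfolding complex_inv_poly_def by auto
  from someI_ex[OF this]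
  show "re_pullback g s \<in> inv_polys" "im_pullback g s \<in> inv_polys"
    "eval_at (act g (inv_sect M)) s = eval_at M (re_pullback g s) + \<i> * eval_at M (im_pullback g s)"
    unfolding pullback_def[symmetric] re_pullback_def im_pullback_def by (auto simp: case_prod_unfold)
qed

text \<open>At real matrices the four values are real, so real and imaginary parts can be compared.
  This makes the pair chosen in \<open>pullback\<close> unique.\<close>

lemma complex_eval_at_eq:
  assumes "\<And>N. eval_at (complex_matrix N) u + \<i> * eval_at (complex_matrix N) v =
    eval_at (complex_matrix N) u' + \<i> * eval_at (complex_matrix N) v'"
  shows "u = u'" "v = v'"
proof -
  have "eval_at (complex_matrix N) (u - u') = 0 \<and> eval_at (complex_matrix N) (v - v') = 0" for N
    using assms[of N] eval_at_complex_matrix[of N] by (simp add: complex_eq_iff)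
  then show "u = u'" "v = v'"
    using eval_at_eq_0[of "u - u'"] eval_at_eq_0[of "v - v'"] by auto
qed

lemma pullback_unique:
  assumes "\<And>N. eval_at (act g (inv_sect (complex_matrix N))) s =
    eval_at (complex_matrix N) u + \<i> * eval_at (complex_matrix N) v"
  shows "re_pullback g s = u" "im_pullback g s = v"
  using complex_eval_at_eq[of "re_pullback g s" "im_pullback g s" u v] assms
  by (simp_all add: pullback(3))

text \<open>The matrix \<open>act g (inv_sect M)\<close> has the same basic invariants as
  \<open>M\<close>.\<close>

lemma pullback_inv_polys:
  assumes g: "g \<in> carrier matrix_group" and "s \<in> inv_polys"
  shows "re_pullback g s = s" "im_pullback g s = 0"
proof -
  have "eval_at (act g (inv_sect M)) s = eval_at M s" for M
    by (rule eval_at_inv_polys[OF assms(2)]) (simp_all add: inv_act[OF g])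
  then show "re_pullback g s = s" "im_pullback g s = 0"
    using pullback_unique[of g s s 0] by simp_all
qed

lemma pullback_add:
  "re_pullback g (s + t) = re_pullback g s + re_pullback g t"
  "im_pullback g (s + t) = im_pullback g s + im_pullback g t"
  using pullback_unique[of g "s + t" "re_pullback g s + re_pullback g t" "im_pullback g s + im_pullback g t"]
  by (simp_all add: pullback(3) algebra_simps)

text \<open>Complex multiplication: with \<open>pullback_add\<close>, the map from \<open>s\<close>
  to \<open>re_pullback + i im_pullback\<close> is a ring homomorphism into the extension of
  \<open>inv_polys\<close> by the imaginary unit, and preimages of primes are prime.\<close>

lemma pullback_mult:
  "re_pullback g (s * t) = re_pullback g s * re_pullback g t - im_pullback g s * im_pullback g t"
  "im_pullback g (s * t) = re_pullback g s * im_pullback g t + im_pullback g s * re_pullback g t"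
proof -
  have ii: "\<i> * (\<i> * t) = - t" for t
    by (simp add: mult.assoc[symmetric])
  show "re_pullback g (s * t) = re_pullback g s * re_pullback g t - im_pullback g s * im_pullback g t"
    "im_pullback g (s * t) = re_pullback g s * im_pullback g t + im_pullback g s * re_pullback g t"
    using pullback_unique[of g "s * t" "re_pullback g s * re_pullback g t - im_pullback g s * im_pullback g t"
        "re_pullback g s * im_pullback g t + im_pullback g s * re_pullback g t"]
    by (simp_all add: pullback(3) ii algebra_simps)
qed

section \<open>Lifting prime ideals along the quotient map\<close>

text \<open>
  Lying over for the extension by the imaginary unit. If the residue field of \<open>q\<close> contains no square
  root of -1, the extension of \<open>q\<close> is prime. Otherwise the two primes over \<open>q\<close> are the kernels
  of the two maps sending the imaginary unit to \<open>\<plusminus>a / b\<close>, and they intersect in the extension of \<open>q\<close>.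
\<close>

lemma ex_complex_prime:
  assumes R: "subring_set R" and q: "prime_in R q" and half: "h \<in> R" "2 * h = 1"
    and uv0: "u0 \<in> R" "v0 \<in> R" "u0 \<notin> q \<or> v0 \<notin> q"
  shows "\<exists>Q. \<not> Q u0 v0 \<and> (\<forall>u\<in>R. Q u 0 \<longleftrightarrow> u \<in> q) \<and>
    (\<forall>u\<in>R. \<forall>v\<in>R. \<forall>u'\<in>R. \<forall>v'\<in>R.
      (Q u v \<and> Q u' v' \<longrightarrow> Q (u + u') (v + v')) \<and>
      (Q (u * u' - v * v') (u * v' + v * u') \<longleftrightarrow> Q u v \<or> Q u' v'))"
proof (cases "\<forall>a\<in>R. \<forall>b\<in>R. a * a + b * b \<in> q \<longrightarrow> b \<in> q")
  note id = prime_in_ideal[OF q]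
  note mem = subring_set_add[OF R] subring_set_mult[OF R] subring_set_diff[OF R]
  note ideal = ideal_in_add[OF id] ideal_in_diff[OF R id] ideal_in_lmult[OF id] ideal_in_rmult[OF id]
  case True
  have prime: "u \<in> q \<and> v \<in> q \<or> u' \<in> q \<and> v' \<in> q"
    if m: "u \<in> R" "v \<in> R" "u' \<in> R" "v' \<in> R" and "u * u' - v * v' \<in> q" "u * v' + v * u' \<in> q" for u v u' v'
  proof -
    have sq: "x \<in> q \<and> y \<in> q" if "x \<in> R" "y \<in> R" "x * x + y * y \<in> q" for x y
      using True that by (metis add.commute)
    \<comment> \<open>Multiplicativity of the norm \<open>u^2 + v^2\<close>. In this case a norm
      lies in \<open>q\<close> only if both components do.\<close>
    have "(u * u + v * v) * (u' * u' + v' * v') =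
        (u * u' - v * v') * (u * u' - v * v') + (u * v' + v * u') * (u * v' + v * u')"
      by (simp add: algebra_simps)
    also have "\<dots> \<in> q"
      using that mem by (intro ideal(1)) (auto intro!: ideal(3))
    finally have "u * u + v * v \<in> q \<or> u' * u' + v' * v' \<in> q"
      by (intro prime_in_mult[OF q] mem m)
    then show ?thesis
      using sq[OF m(1,2)] sq[OF m(3,4)] by blast
  qed
  have mult: "u * u' - v * v' \<in> q \<and> u * v' + v * u' \<in> q \<longleftrightarrow> u \<in> q \<and> v \<in> q \<or> u' \<in> q \<and> v' \<in> q"
    if m: "u \<in> R" "v \<in> R" "u' \<in> R" "v' \<in> R" for u v u' v'
  proof
    assume "u \<in> q \<and> v \<in> q \<or> u' \<in> q \<and> v' \<in> q"
    then show "u * u' - v * v' \<in> q \<and> u * v' + v * u' \<in> q"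
    proof
      assume "u \<in> q \<and> v \<in> q"
      then show ?thesis
        using m by (intro conjI ideal(1,2) ideal(4)) auto
    next
      assume "u' \<in> q \<and> v' \<in> q"
      then show ?thesis
        using m by (intro conjI ideal(1,2) ideal(3)) auto
    qed
  qed (use prime[OF m] in blast)
  show ?thesis
  proof (rule exI[of _ "\<lambda>u v. u \<in> q \<and> v \<in> q"], intro conjI ballI)
    show "\<not> (u0 \<in> q \<and> v0 \<in> q)"
      using uv0(3) by blast
    show "u \<in> q \<and> 0 \<in> q \<longleftrightarrow> u \<in> q" for u
      using ideal_in_0[OF id] by blast
    show "(u \<in> q \<and> v \<in> q) \<and> u' \<in> q \<and> v' \<in> q \<longrightarrow> u + u' \<in> q \<and> v + v' \<in> q" for u v u' v'
      using ideal(1) by blast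
  qed (rule mult)
next
  note id = prime_in_ideal[OF q]
  note mem = subring_set_add[OF R] subring_set_mult[OF R] subring_set_diff[OF R]
  note ideal = ideal_in_add[OF id] ideal_in_diff[OF R id] ideal_in_lmult[OF id] ideal_in_rmult[OF id]
  case False
  then obtain a b where ab: "a \<in> R" "b \<in> R" "a * a + b * b \<in> q" "b \<notin> q"
    by blast
  have a: "a \<notin> q"
  proof
    assume "a \<in> q"
    then have "(a * a + b * b) - a * a \<in> q"
      using ab by (intro ideal(2,3))
    then show False
      using prime_in_mult[OF q ab(2,2)] ab(4) by simp
  qed
  \<comment> \<open>\<open>Q u v\<close> encodes membership of \<open>u + i v\<close> in a prime.
    Here it is the kernel of the map sending the imaginary unit to \<open>c / b\<close>, multiplied
    by \<open>b\<close>; a square root of -1 modulo \<open>q\<close> is what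
    \<open>c * c + b * b \<in> q\<close> provides.\<close>
  have key: "b * u0 + c * v0 \<notin> q \<Longrightarrow> ?thesis" if c: "c \<in> R" "c * c + b * b \<in> q" for c
  proof (rule exI[of _ "\<lambda>u v. b * u + c * v \<in> q"], intro conjI ballI)
    fix u assume "u \<in> R"
    then show "b * u + c * 0 \<in> q \<longleftrightarrow> u \<in> q"
      using prime_in_mult[OF q ab(2), of u] ab(4) ideal(3)[OF ab(2), of u] by auto
  next
    fix u v u' v' assume m: "u \<in> R" "v \<in> R" "u' \<in> R" "v' \<in> R"
    have "b * (u + u') + c * (v + v') = (b * u + c * v) + (b * u' + c * v')"
      by (simp add: algebra_simps)
    then show "b * u + c * v \<in> q \<and> b * u' + c * v' \<in> q \<longrightarrow> b * (u + u') + c * (v + v') \<in> q"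
      using ideal(1) by simp
    let ?x = "b * (u * u' - v * v') + c * (u * v' + v * u')"
    \<comment> \<open>The map is multiplicative up to a multiple of \<open>c * c + b * b\<close>;
      the extra factor \<open>b\<close> clears the denominator and is harmless as
      \<open>b \<notin> q\<close>.\<close>
    have x: "b * ?x = (b * u + c * v) * (b * u' + c * v') - (c * c + b * b) * (v * v')"
      "(b * u + c * v) * (b * u' + c * v') = b * ?x + (c * c + b * b) * (v * v')"
      by (simp_all add: algebra_simps)
    have z: "(c * c + b * b) * (v * v') \<in> q"
      using c m mem by (intro ideal(4)) auto
    have R': "?x \<in> R" "b * u + c * v \<in> R" "b * u' + c * v' \<in> R"
      using m ab c mem by auto
    have "?x \<in> q \<longleftrightarrow> b * ?x \<in> q"
      using prime_in_mult[OF q ab(2) R'(1)] ab(4) ideal(3)[OF ab(2), of ?x] by blast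
    also have "\<dots> \<longleftrightarrow> (b * u + c * v) * (b * u' + c * v') \<in> q"
      using ideal(2)[OF _ z, of "(b * u + c * v) * (b * u' + c * v')"] ideal(1)[OF _ z, of "b * ?x"]
      by (simp only: x(1)[symmetric] x(2)[symmetric]) blast
    also have "\<dots> \<longleftrightarrow> b * u + c * v \<in> q \<or> b * u' + c * v' \<in> q"
      using prime_in_mult[OF q R'(2,3)] ideal(3)[OF R'(2)] ideal(4)[OF _ R'(3)] by blast
    finally show "?x \<in> q \<longleftrightarrow> b * u + c * v \<in> q \<or> b * u' + c * v' \<in> q" .
  qed
  \<comment> \<open>Sum and difference of the two expressions recover \<open>u0\<close> and
    \<open>v0\<close> up to factors outside \<open>q\<close>; the sum needs \<open>h\<close>, the
    inverse of 2.\<close>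
  have "b * u0 + a * v0 \<notin> q \<or> b * u0 + (- a) * v0 \<notin> q"
  proof (rule ccontr)
    assume "\<not> ?thesis"
    then have *: "b * u0 + a * v0 \<in> q" "b * u0 + (- a) * v0 \<in> q"
      by auto
    have "b * u0 = h * ((b * u0 + a * v0) + (b * u0 + (- a) * v0))"
      using half(2) by (simp add: algebra_simps) (metis mult.assoc mult.commute mult.left_neutral mult_2)
    also have "\<dots> \<in> q"
      by (intro ideal(3) ideal(1) * half)
    finally have bu: "b * u0 \<in> q" .
    then have "(b * u0 + a * v0) - b * u0 \<in> q"
      by (intro ideal(2) *)
    then have "a * v0 \<in> q"
      by simp
    then show False
      using bu prime_in_mult[OF q ab(2) uv0(1)] prime_in_mult[OF q ab(1) uv0(2)] a ab(4) uv0(3) by blast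
  qed
  then show ?thesis
    using key[of a] key[of "- a"] ab subring_set_uminus[OF R ab(1)] by auto
qed

text \<open>\<open>p\<close> is the preimage, under the pullback homomorphism, of a prime over
  \<open>q\<close> that misses the pullback of \<open>a\<close>. It contracts to \<open>q\<close>
  because invariants are their own pullbacks. The last clause later yields denominators that do not
  vanish at \<open>q\<close>.\<close>

lemma ex_prime_over:
  assumes g: "g \<in> carrier matrix_group" and q: "prime_in inv_polys q"
    and a: "re_pullback g a \<notin> q \<or> im_pullback g a \<notin> q"
  shows "\<exists>p. prime_in UNIV p \<and> a \<notin> p \<and> p \<inter> inv_polys = q \<and>
    (\<forall>s. re_pullback g s \<in> q \<longrightarrow> im_pullback g s \<in> q \<longrightarrow> s \<in> p)"
proof -
  have half: "(const_poly (1 / 2) :: mpoly9) \<in> inv_polys" "2 * const_poly (1 / 2) = (1 :: mpoly9)"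
  proof -
    have "2 * const_poly (1 / 2) = const_poly (1 / 2) + (const_poly (1 / 2) :: mpoly9)"
      by simp
    also have "\<dots> = 1"
      by (simp add: const_poly_def single_add[symmetric])
    finally show "2 * const_poly (1 / 2) = (1 :: mpoly9)" .
  qed (rule inv_polys.const)
  let ?r = "re_pullback g" and ?i = "im_pullback g"
  obtain Q where Q: "\<not> Q (?r a) (?i a)" "\<And>u. u \<in> inv_polys \<Longrightarrow> Q u 0 \<longleftrightarrow> u \<in> q"
    and Qadd: "\<And>u v u' v'. u \<in> inv_polys \<Longrightarrow> v \<in> inv_polys \<Longrightarrow> u' \<in> inv_polys \<Longrightarrow> v' \<in> inv_polys \<Longrightarrow>
      Q u v \<Longrightarrow> Q u' v' \<Longrightarrow> Q (u + u') (v + v')"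
    and Qmult: "\<And>u v u' v'. u \<in> inv_polys \<Longrightarrow> v \<in> inv_polys \<Longrightarrow> u' \<in> inv_polys \<Longrightarrow> v' \<in> inv_polys \<Longrightarrow>
      Q (u * u' - v * v') (u * v' + v * u') \<longleftrightarrow> Q u v \<or> Q u' v'"
    using ex_complex_prime[OF subring_set_inv_polys q half pullback(1,2) a] by (elim exE conjE) simp
  define p where "p = {s. Q (?r s) (?i s)}"
  have p_inv: "s \<in> p \<longleftrightarrow> s \<in> q" if "s \<in> inv_polys" for s
    using that by (simp add: p_def pullback_inv_polys[OF g] Q(2))
  have mult: "s * t \<in> p \<longleftrightarrow> s \<in> p \<or> t \<in> p" for s t
    by (simp add: p_def pullback_mult Qmult pullback(1,2))
  have "prime_in UNIV p"
    unfolding prime_in_def ideal_in_def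
  proof (intro conjI ballI)
    show "0 \<in> p" "1 \<notin> p"
      using p_inv subring_set_0[OF subring_set_inv_polys] subring_set_1[OF subring_set_inv_polys]
        ideal_in_0[OF prime_in_ideal[OF q]] prime_in_1[OF q] by auto
    show "s + t \<in> p" if "s \<in> p" "t \<in> p" for s t
      using that by (simp add: p_def pullback_add Qadd pullback(1,2))
  qed (simp_all add: mult)
  moreover have "a \<notin> p"
    using Q(1) by (simp add: p_def)
  moreover have "p \<inter> inv_polys = q"
    using p_inv ideal_in_subset[OF prime_in_ideal[OF q]] by blast
  moreover have "s \<in> p" if s: "?r s \<in> q" "?i s \<in> q" for s
  proof -
    have 0: "0 \<in> inv_polys" "1 \<in> inv_polys"
      by (rule subring_set_0[OF subring_set_inv_polys], rule subring_set_1[OF subring_set_inv_polys])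
    have "Q (?r s) 0" "Q (?i s) 0"
      using s by (simp_all add: Q(2) pullback(1,2))
    \<comment> \<open>\<open>i v\<close> is the product of \<open>0 + i 1\<close> and
      \<open>v + i 0\<close>.\<close>
    then have "Q 0 (?i s)"
      using Qmult[of 0 1 "?i s" 0] 0 by (simp add: pullback(2))
    then show ?thesis
      using Qadd[of "?r s" 0 0 "?i s"] \<open>Q (?r s) 0\<close> 0 by (simp add: p_def pullback(1,2))
  qed
  ultimately show ?thesis
    by blast
qed

section \<open>The discriminant\<close>

definition disc_poly :: mpoly9 where
  "disc_poly = monic_discriminant
     (charpoly (generic_matrix ** Finite_Cartesian_Product.transpose generic_matrix))"

lemma Delta_eq: "Delta = to_fract disc_poly"
  by (simp add: Delta_def disc_poly_def)

lemma disc_poly_in_inv_polys: "disc_poly \<in> inv_polys"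
proof -
  have num: "numeral k \<in> inv_polys" for k
    using inv_polys.const[of "numeral k"] by (simp add: const_poly_def)
  show ?thesis
    unfolding disc_poly_def charpoly_times_transpose monic_discriminant_cubic
    by (intro subring_set_add[OF subring_set_inv_polys] subring_set_diff[OF subring_set_inv_polys]
        subring_set_mult[OF subring_set_inv_polys] subring_set_power[OF subring_set_inv_polys]
        subring_set_uminus[OF subring_set_inv_polys] num inv_polys.inv1 inv_polys.inv2 inv_polys.det)
qed

lemma eval_at_disc_poly:
  "eval_at M disc_poly = monic_discriminant (charpoly (M ** Finite_Cartesian_Product.transpose M))"
  unfolding disc_poly_def charpoly_times_transpose monic_discriminant_cubic by simp

lemma eval_at_disc_poly_nonzero:
  "eval_at M disc_poly \<noteq> 0 \<longleftrightarrow> distinct_eigenvalues (M ** Finite_Cartesian_Product.transpose M)"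
  by (simp add: eval_at_disc_poly distinct_eigenvalues_iff)

lemma disc_poly_nonzero: "disc_poly \<noteq> 0"
proof
  assume "disc_poly = 0"
  \<comment> \<open>For the invariants (0, 1, 0) the characteristic polynomial is
    \<open>x^3 + x\<close>, of discriminant -4.\<close>
  then have "eval_at (sect 0 1 0) disc_poly = 0"
    by simp
  then show False
    unfolding eval_at_disc_poly charpoly_times_transpose monic_discriminant_cubic inv_sect by simp
qed

lemma ex_act_eq:
  assumes "eval_at M disc_poly \<noteq> 0" "inv1 M = inv1 N" "inv2 M = inv2 N" "Determinants.det M = Determinants.det N"
  shows "\<exists>g\<in>carrier matrix_group. act g M = N"
  using same_orbit[of M N] assms by (auto simp: eval_at_disc_poly_nonzero carrier_matrix_group act_def)

text \<open>The Nullstellensatz gives a complex zero \<open>M\<close> of \<open>p\<close> at which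
  \<open>a\<close> and the discriminant are nonzero. Some \<open>g\<close> moves the section's
  representative of the orbit to \<open>M\<close>, and then the pullback of \<open>a\<close> along
  \<open>g\<close> does not vanish at \<open>M\<close>.\<close>

lemma ex_pullback_notin:
  assumes p: "prime_in UNIV p" and "disc_poly \<notin> p" "a \<notin> p"
  shows "\<exists>g\<in>carrier matrix_group. re_pullback g a \<notin> p \<or> im_pullback g a \<notin> p"
proof -
  have "a * disc_poly \<notin> p"
    using prime_in_mult[OF p] assms by blast
  then obtain w where w: "\<And>s. s \<in> p \<Longrightarrow> peval complex_of_real w s = 0"
    "peval complex_of_real w (a * disc_poly) \<noteq> 0"
    using ex_complex_point[OF p] by blast
  define M where "M = (\<chi> i j. w (Entry i j))"
  have ev: "peval complex_of_real w = eval_at M"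
    by (simp add: eval_at_conv M_def)
  have "eval_at (inv_sect M) disc_poly = eval_at M disc_poly"
    by (rule eval_at_inv_polys[OF disc_poly_in_inv_polys]) simp_all
  then have "eval_at (inv_sect M) disc_poly \<noteq> 0"
    using w(2) by (simp add: ev)
  then obtain g where g: "g \<in> carrier matrix_group" "act g (inv_sect M) = M"
    using ex_act_eq[of "inv_sect M" M] by auto
  have "eval_at M (re_pullback g a) + \<i> * eval_at M (im_pullback g a) \<noteq> 0"
    using pullback(3)[of g M a] w(2) g(2) by (simp add: ev)
  then have "re_pullback g a \<notin> p \<or> im_pullback g a \<notin> p"
    using w(1)[of "re_pullback g a"] w(1)[of "im_pullback g a"] by (auto simp: ev)
  then show ?thesis
    using g(1) by blast
qed

definition unit_element :: "(complex^3^3) \<times> (complex^3^3)" where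
  "unit_element = (Finite_Cartesian_Product.mat 1, Finite_Cartesian_Product.mat 1)"

lemma act_unit_element [simp]: "act unit_element M = M"
  by (simp add: act_def unit_element_def)

lemma unit_element_in_group: "unit_element \<in> carrier matrix_group"
  by (simp add: unit_element_def carrier_matrix_group SO3_one)

text \<open>
  If \<open>a / s\<close> is invariant where \<open>w\<close> does not vanish, it equals the pullbacks' quotients, which are
  quotients of invariants.
\<close>

lemma invariant_fraction:
  assumes "w \<noteq> 0"
    and inv: "\<And>M. eval_at M w \<noteq> 0 \<Longrightarrow>
      eval_at (inv_sect M) a * eval_at M s = eval_at M a * eval_at (inv_sect M) s"
  shows "re_pullback unit_element a * s = a * re_pullback unit_element s"
    and "im_pullback unit_element a * s = a * im_pullback unit_element s"
proof -
  let ?r = "re_pullback unit_element" and ?i = "im_pullback unit_element"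
  \<comment> \<open>The factor \<open>w\<close> covers the real matrices where invariance is not
    assumed; it cancels in the end, as polynomials form a domain.\<close>
  have "eval_at (complex_matrix N) ((?r a * s - a * ?r s) * w) = 0 \<and>
      eval_at (complex_matrix N) ((?i a * s - a * ?i s) * w) = 0" for N
  proof (cases "eval_at (complex_matrix N) w = 0")
    case False
    let ?e = "eval_at (complex_matrix N)"
    have "(?e (?r a) + \<i> * ?e (?i a)) * ?e s = ?e a * (?e (?r s) + \<i> * ?e (?i s))"
      using inv[OF False] pullback(3)[of unit_element "complex_matrix N"] by simp
    then have "?e (?r a) * ?e s = ?e a * ?e (?r s) \<and> ?e (?i a) * ?e s = ?e a * ?e (?i s)"
      using eval_at_complex_matrix[of N] by (simp add: complex_eq_iff)
    then show ?thesis
      by simp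
  qed simp
  then have "(?r a * s - a * ?r s) * w = 0" "(?i a * s - a * ?i s) * w = 0"
    by (blast intro: eval_at_eq_0)+
  then show "?r a * s = a * ?r s" "?i a * s = a * ?i s"
    using assms(1) by simp_all
qed

section \<open>Complex points and the group action\<close>

lemma ring_hom_subring_of_iff:
  fixes A :: "'k::field set" and x :: "'k \<Rightarrow> complex"
  shows "x \<in> ring_hom (subring_of A) ring_of_type_algebra \<longleftrightarrow>
    x 1 = 1 \<and> (\<forall>a\<in>A. \<forall>b\<in>A. x (a + b) = x a + x b \<and> x (a * b) = x a * x b)"
  by (auto simp: ring_hom_def subring_of_def ring_of_type_algebra_def)

lemma kernel_in_Spec:
  fixes A :: "'k::field set" and x :: "'k \<Rightarrow> complex"
  assumes A: "subring_set A" and x: "x \<in> ring_hom (subring_of A) ring_of_type_algebra"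
  shows "{a \<in> A. x a = 0} \<in> Spec A"
proof -
  have hom: "x 1 = 1" "\<And>a b. a \<in> A \<Longrightarrow> b \<in> A \<Longrightarrow> x (a + b) = x a + x b"
    "\<And>a b. a \<in> A \<Longrightarrow> b \<in> A \<Longrightarrow> x (a * b) = x a * x b"
    using x by (auto simp: ring_hom_subring_of_iff)
  have "x 0 = 0"
    using hom(2)[of 0 0] subring_set_0[OF A] by simp
  then show ?thesis
    unfolding Spec_iff[OF A] prime_in_def ideal_in_def
    using hom subring_set_0[OF A] subring_set_add[OF A] subring_set_mult[OF A] by auto
qed

lemma subring_set_coord_ring: "subring_set coord_ring"
proof -
  have "to_fract p - to_fract q \<in> coord_ring" "to_fract p * to_fract q \<in> coord_ring" for p q
    unfolding coord_ring_def by (simp_all only: to_fract_diff[symmetric] to_fract_mult[symmetric] rangeI)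
  moreover have "(1 :: mpoly9 fract) \<in> coord_ring"
    unfolding coord_ring_def by (metis rangeI to_fract_1)
  ultimately show ?thesis
    by (auto simp: subring_set_def coord_ring_def)
qed

lemma real_const_eq: "real_const r = (to_fract (const_poly r) :: mpoly9 fract)"
  by (simp add: real_const_def scaleR_fract_def of_real_eq_const_poly)

lemma matrix_to_point_to_fract [simp]: "matrix_to_point M (to_fract s) = eval_at M s"
proof -
  have "inj (to_fract :: mpoly9 \<Rightarrow> _)"
    by (simp add: inj_on_def)
  then show ?thesis
    by (simp add: matrix_to_point_def coord_ring_def the_inv_f_f)
qed

lemma point_to_matrix_to_point [simp]: "point_to_matrix (matrix_to_point M) = M"
  by (simp add: point_to_matrix_def vec_eq_iff generic_matrix_nth)

definition matrix_kernel :: "complex^3^3 \<Rightarrow> mpoly9 fract set" where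
  "matrix_kernel M = to_fract ` {s. eval_at M s = 0}"

lemma matrix_kernel_iff [simp]: "to_fract s \<in> matrix_kernel M \<longleftrightarrow> eval_at M s = 0"
  by (auto simp: matrix_kernel_def)

lemma matrix_to_point_hom: "matrix_to_point M \<in> ring_hom (subring_of coord_ring) ring_of_type_algebra"
proof -
  have "matrix_to_point M 1 = 1"
    using matrix_to_point_to_fract[of M 1] by simp
  moreover have "matrix_to_point M (to_fract p + to_fract q) = eval_at M p + eval_at M q"
    "matrix_to_point M (to_fract p * to_fract q) = eval_at M p * eval_at M q" for p q
    by (simp_all only: to_fract_add[symmetric] to_fract_mult[symmetric] matrix_to_point_to_fract eval_at_simps)
  ultimately show ?thesis
    by (auto simp: ring_hom_subring_of_iff coord_ring_def)
qed

lemma matrix_kernel_eq: "{a \<in> coord_ring. matrix_to_point M a = 0} = matrix_kernel M"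
  by (auto simp: coord_ring_def matrix_kernel_def)

lemma matrix_kernel_in_Spec: "matrix_kernel M \<in> Spec coord_ring"
  using kernel_in_Spec[OF subring_set_coord_ring matrix_to_point_hom[of M]] by (simp add: matrix_kernel_eq)

text \<open>A homomorphism of real algebras is determined by its values at the nine variables, which
  form a complex matrix.\<close>

lemma cpoints_coord_ring: "cpoints coord_ring U = matrix_to_point ` {M. matrix_kernel M \<in> U}"
proof (intro equalityI subsetI)
  fix x assume x: "x \<in> cpoints coord_ring U"
  then have hom: "x 1 = 1" "\<And>a b. a \<in> coord_ring \<Longrightarrow> b \<in> coord_ring \<Longrightarrow> x (a + b) = x a + x b"
    "\<And>a b. a \<in> coord_ring \<Longrightarrow> b \<in> coord_ring \<Longrightarrow> x (a * b) = x a * x b"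
    and real: "\<And>r. x (real_const r) = of_real r" and ext: "x \<in> extensional coord_ring"
    and U: "{a \<in> coord_ring. x a = 0} \<in> U"
    by (auto simp: cpoints_def ring_hom_subring_of_iff)
  have mem: "to_fract s \<in> coord_ring" for s
    by (simp add: coord_ring_def)
  have "x (to_fract s) = eval_at (point_to_matrix x) s" for s
  proof (induction s rule: mpoly_induct)
    case (const c)
    then show ?case
      using real[of c] by (simp add: real_const_eq)
  next
    case (var e)
    then show ?case
      by (cases e) (simp add: point_to_matrix_def generic_matrix_nth)
  qed (simp_all add: hom mem)
  then have "x h = matrix_to_point (point_to_matrix x) h" if "h \<in> coord_ring" for h
    using that by (auto simp: coord_ring_def)
  then have "x = matrix_to_point (point_to_matrix x)"
    by (intro extensionalityI[OF ext]) (simp_all add: matrix_to_point_def)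
  moreover from this have "matrix_kernel (point_to_matrix x) \<in> U"
    using U matrix_kernel_eq[of "point_to_matrix x"] by simp
  ultimately show "x \<in> matrix_to_point ` {M. matrix_kernel M \<in> U}"
    by blast
next
  fix x assume "x \<in> matrix_to_point ` {M. matrix_kernel M \<in> U}"
  then obtain M where M: "x = matrix_to_point M" "matrix_kernel M \<in> U"
    by blast
  then show "x \<in> cpoints coord_ring U"
    using matrix_to_point_hom[of M] matrix_kernel_eq[of M]
    by (simp add: cpoints_def real_const_eq) (simp add: matrix_to_point_def)
qed

lemma prime_in_coord_ring:
  "p \<in> Spec coord_ring \<longleftrightarrow> (\<exists>p'. prime_in UNIV p' \<and> p = to_fract ` p')"
proof
  assume "p \<in> Spec coord_ring"
  then have p: "prime_in coord_ring p"
    by (simp add: Spec_iff[OF subring_set_coord_ring])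
  have "p = to_fract ` (to_fract -` p)"
    using p by (auto simp: prime_in_def ideal_in_def coord_ring_def)
  moreover have "prime_in UNIV (to_fract -` p)"
    using p unfolding prime_in_def ideal_in_def coord_ring_def by auto
  ultimately show "\<exists>p'. prime_in UNIV p' \<and> p = to_fract ` p'"
    by blast
next
  assume "\<exists>p'. prime_in UNIV p' \<and> p = to_fract ` p'"
  then obtain p' where p': "prime_in UNIV p'" "p = to_fract ` p'"
    by blast
  have mem: "to_fract s \<in> p \<longleftrightarrow> s \<in> p'" for s
    by (auto simp: p'(2))
  have 0: "0 \<in> p \<longleftrightarrow> 0 \<in> p'" and 1: "1 \<in> p \<longleftrightarrow> 1 \<in> p'"
    using mem[of 0] mem[of 1] by simp_all
  have "to_fract s + to_fract t \<in> p \<longleftrightarrow> s + t \<in> p'" "to_fract s * to_fract t \<in> p \<longleftrightarrow> s * t \<in> p'" for s t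
    by (simp_all only: to_fract_add[symmetric] to_fract_mult[symmetric] mem)
  then have "prime_in coord_ring p"
    using p'(1) 0 1 unfolding prime_in_def ideal_in_def coord_ring_def
    by (auto simp: mem) (auto simp: p'(2))
  then show "p \<in> Spec coord_ring"
    by (simp add: Spec_iff[OF subring_set_coord_ring])
qed

lemma val_matrix_to_point:
  assumes "eval_at M s \<noteq> 0"
  shows "val coord_ring (matrix_to_point M) (to_fract a / to_fract s) = eval_at M a / eval_at M s"
proof -
  have "val coord_ring (matrix_to_point M) (to_fract a / to_fract s) =
      matrix_to_point M (to_fract a) / matrix_to_point M (to_fract s)"
  proof (rule val_eq)
    show "matrix_to_point M 0 = 0"
      using matrix_to_point_to_fract[of M 0] by simp
    show "matrix_to_point M (a * b) = matrix_to_point M a * matrix_to_point M b"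
      if "a \<in> coord_ring" "b \<in> coord_ring" for a b
      using matrix_to_point_hom[of M] that by (simp add: ring_hom_subring_of_iff)
  qed (use assms in \<open>simp_all add: coord_ring_def\<close>)
  then show ?thesis
    by simp
qed

section \<open>The group and its action on complex points\<close>

lemma group_SO3: "group SO3"
proof (rule groupI)
  show "\<one>\<^bsub>SO3\<^esub> \<in> carrier SO3"
    using SO3_one by (simp add: SO3_def)
  show "x \<otimes>\<^bsub>SO3\<^esub> y \<in> carrier SO3" if "x \<in> carrier SO3" "y \<in> carrier SO3" for x y
    using SO3_mult[OF that] by (simp add: SO3_def)
  show "\<exists>y\<in>carrier SO3. y \<otimes>\<^bsub>SO3\<^esub> x = \<one>\<^bsub>SO3\<^esub>" if "x \<in> carrier SO3" for x
    using SO3_transpose[OF that] SO3_transpose_mult(1)[OF that]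
    by (intro bexI[of _ "Finite_Cartesian_Product.transpose x"]) (simp_all add: SO3_def)
qed (simp_all add: SO3_def matrix_mul_assoc)

lemma group_matrix_group: "group matrix_group"
  unfolding matrix_group_def by (rule DirProd_group[OF group_SO3 group_SO3])

lemma act_mult: "act (g \<otimes>\<^bsub>matrix_group\<^esub> h) M = act g (act h M)"
  by (cases g; cases h) (simp add: act_def matrix_group_def SO3_def matrix_transpose_mul matrix_mul_assoc)

lemma act_one: "act \<one>\<^bsub>matrix_group\<^esub> M = M"
  by (simp add: act_def matrix_group_def SO3_def)

lemma matrix_action_matrix_to_point: "matrix_action g (matrix_to_point M) = matrix_to_point (act g M)"
  by (simp add: matrix_action_def cpoints_coord_ring matrix_kernel_in_Spec act_def case_prod_unfold)

text \<open>\<open>group_action\<close> asks for a homomorphism into extensional bijections; the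
  action of the inverse supplies bijectivity.\<close>

lemma group_actionI:
  assumes G: "group G" and ext: "\<And>g. g \<in> carrier G \<Longrightarrow> \<phi> g \<in> extensional E"
    and closed: "\<And>g x. g \<in> carrier G \<Longrightarrow> x \<in> E \<Longrightarrow> \<phi> g x \<in> E"
    and one: "\<And>x. x \<in> E \<Longrightarrow> \<phi> \<one>\<^bsub>G\<^esub> x = x"
    and mult: "\<And>g h x. g \<in> carrier G \<Longrightarrow> h \<in> carrier G \<Longrightarrow> x \<in> E \<Longrightarrow> \<phi> (g \<otimes>\<^bsub>G\<^esub> h) x = \<phi> g (\<phi> h x)"
  shows "group_action G E \<phi>"
proof -
  interpret group G by (rule G)
  have bij: "\<phi> g \<in> Bij E" if g: "g \<in> carrier G" for g
  proof -
    have "bij_betw (\<phi> g) E E"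
    proof (rule bij_betw_byWitness[where f' = "\<phi> (inv\<^bsub>G\<^esub> g)"])
      show "\<forall>x\<in>E. \<phi> (inv\<^bsub>G\<^esub> g) (\<phi> g x) = x" "\<forall>x\<in>E. \<phi> g (\<phi> (inv\<^bsub>G\<^esub> g) x) = x"
        using g one by (simp_all add: mult[symmetric])
    qed (use closed g in auto)
    then show ?thesis
      using ext[OF g] by (simp add: Bij_def)
  qed
  have "\<phi> (g \<otimes>\<^bsub>G\<^esub> h) = compose E (\<phi> g) (\<phi> h)" if "g \<in> carrier G" "h \<in> carrier G" for g h
    using that ext mult by (intro extensionalityI[of _ E]) (auto simp: compose_def)
  then have "\<phi> \<in> hom G (BijGroup E)"
    using bij by (auto simp: hom_def BijGroup_def)
  then show ?thesis
    by (intro group_action.intro group_hom.intro group_hom_axioms.intro G group_BijGroup)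
qed

section \<open>The quotient\<close>

definition inv_ring :: "mpoly9 fract set" where
  "inv_ring = to_fract ` inv_polys"

definition quot_ring :: "mpoly9 fract set" where
  "quot_ring = adjoin_inverse inv_ring Delta"

lemma subring_set_inv_ring: "subring_set inv_ring"
  unfolding subring_set_def
proof (intro conjI ballI)
  show "1 \<in> inv_ring"
    using imageI[OF subring_set_1[OF subring_set_inv_polys], of to_fract] by (simp add: inv_ring_def)
next
  fix a b assume "a \<in> inv_ring" "b \<in> inv_ring"
  then obtain p q where *: "a = to_fract p" "b = to_fract q" "p \<in> inv_polys" "q \<in> inv_polys"
    by (auto simp: inv_ring_def)
  then show "a - b \<in> inv_ring" "a * b \<in> inv_ring"
    using imageI[OF subring_set_diff[OF subring_set_inv_polys *(3,4)], of to_fract]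
      imageI[OF subring_set_mult[OF subring_set_inv_polys *(3,4)], of to_fract]
    by (simp_all add: inv_ring_def)
qed

lemma to_fract_in_inv_ring [simp]: "to_fract s \<in> inv_ring \<longleftrightarrow> s \<in> inv_polys"
  by (auto simp: inv_ring_def)

lemma to_fract_in_coord_ring [simp]: "to_fract s \<in> coord_ring"
  by (simp add: coord_ring_def)

lemma inv_ring_subset: "inv_ring \<subseteq> coord_ring"
  by (auto simp: inv_ring_def coord_ring_def)

lemma Delta_in_inv_ring: "Delta \<in> inv_ring"
  by (simp add: Delta_eq disc_poly_in_inv_polys)

lemma Delta_nonzero: "Delta \<noteq> 0"
  by (simp add: Delta_eq disc_poly_nonzero)

lemma to_fract_power: "to_fract (p ^ n) = to_fract p ^ n"
  by (induction n) simp_all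

lemma quot_ring_iff: "h \<in> quot_ring \<longleftrightarrow> (\<exists>r\<in>inv_polys. \<exists>n. h = to_fract r / to_fract (disc_poly ^ n))"
  by (auto simp: quot_ring_def adjoin_inverse_def inv_ring_def Delta_eq to_fract_power)

lemma subring_set_quot_ring: "subring_set quot_ring"
  unfolding quot_ring_def
  by (rule subring_set_adjoin_inverse[OF subring_set_inv_ring Delta_in_inv_ring Delta_nonzero])

lemma to_fract_in_quot_ring: "s \<in> inv_polys \<Longrightarrow> to_fract s \<in> quot_ring"
  using adjoin_inverse_superset[of inv_ring Delta] by (auto simp: quot_ring_def inv_ring_def)

lemma X0_iff: "to_fract ` p \<in> X0 \<longleftrightarrow> to_fract ` p \<in> Spec coord_ring \<and> disc_poly \<notin> p"
  by (auto simp: X0_def basic_open_def Delta_eq)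

lemma matrix_kernel_X0: "matrix_kernel M \<in> X0 \<longleftrightarrow> eval_at M disc_poly \<noteq> 0"
  by (simp add: X0_def basic_open_def Delta_eq matrix_kernel_in_Spec)

lemma matrix_kernel_act_X0:
  "g \<in> carrier matrix_group \<Longrightarrow> matrix_kernel (act g M) \<in> X0 \<longleftrightarrow> matrix_kernel M \<in> X0"
  using eval_at_inv_polys[OF disc_poly_in_inv_polys, of "act g M" M] by (simp add: matrix_kernel_X0 inv_act)

lemma matrix_action_X0_matrix_to_point:
  "matrix_kernel M \<in> X0 \<Longrightarrow> matrix_action_X0 g (matrix_to_point M) = matrix_to_point (act g M)"
  by (auto simp: matrix_action_X0_def restrict_action_def cpoints_coord_ring matrix_action_matrix_to_point)

lemma group_action_Spec: "group_action matrix_group (cpoints coord_ring (Spec coord_ring)) matrix_action"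
  by (rule group_actionI[OF group_matrix_group])
    (auto simp: cpoints_coord_ring matrix_kernel_in_Spec matrix_action_matrix_to_point act_mult act_one,
      auto simp: matrix_action_def case_prod_unfold cpoints_coord_ring)

lemma group_action_X0: "group_action matrix_group (cpoints coord_ring X0) matrix_action_X0"
  by (rule group_actionI[OF group_matrix_group])
    (auto simp: cpoints_coord_ring matrix_action_X0_matrix_to_point matrix_kernel_act_X0 act_mult act_one,
      auto simp: matrix_action_X0_def restrict_action_def cpoints_coord_ring)

text \<open>Where the discriminant is nonzero, \<open>M\<close> and \<open>inv_sect M\<close> share
  an orbit, so \<open>a\<close> has equal values there. \<open>invariant_fraction\<close> with
  denominator 1 identifies \<open>a\<close> with the real part of its pullback.\<close>

lemma invariant_poly:
  assumes "\<And>M g. g \<in> carrier matrix_group \<Longrightarrow> eval_at M disc_poly \<noteq> 0 \<Longrightarrow> eval_at (act g M) a = eval_at M a"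
  shows "a \<in> inv_polys"
proof -
  have "eval_at (inv_sect M) a * eval_at M 1 = eval_at M a * eval_at (inv_sect M) 1"
    if M: "eval_at M disc_poly \<noteq> 0" for M
  proof -
    obtain g where g: "g \<in> carrier matrix_group" "act g M = inv_sect M"
      using ex_act_eq[OF M, of "inv_sect M"] by auto
    then show ?thesis
      using assms[OF g(1) M] by simp
  qed
  from invariant_fraction(1)[OF disc_poly_nonzero this]
  have "re_pullback unit_element a = a"
    using pullback_inv_polys(1)[OF unit_element_in_group subring_set_1[OF subring_set_inv_polys]] by simp
  then show ?thesis
    using pullback(1) by metis
qed

lemma eval_at_act:
  "s \<in> inv_polys \<Longrightarrow> g \<in> carrier matrix_group \<Longrightarrow> eval_at (act g M) s = eval_at M s"
  by (rule eval_at_inv_polys) (simp_all add: inv_act)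

lemma inv_regular_Spec:
  "inv_regular coord_ring (Spec coord_ring) matrix_group matrix_action = inv_ring"
proof -
  have val: "val coord_ring (matrix_to_point M) (to_fract s) = eval_at M s" for M s
    using val_matrix_to_point[of M 1 s] by simp
  have "to_fract s \<in> inv_regular coord_ring (Spec coord_ring) matrix_group matrix_action \<longleftrightarrow> s \<in> inv_polys" for s
  proof
    assume "to_fract s \<in> inv_regular coord_ring (Spec coord_ring) matrix_group matrix_action"
    then show "s \<in> inv_polys"
      by (intro invariant_poly)
        (auto simp: inv_regular_def cpoints_coord_ring matrix_kernel_in_Spec matrix_action_matrix_to_point val)
  next
    assume "s \<in> inv_polys"
    then show "to_fract s \<in> inv_regular coord_ring (Spec coord_ring) matrix_group matrix_action"
      by (auto simp: inv_regular_def cpoints_coord_ring matrix_kernel_in_Spec matrix_action_matrix_to_point val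
          regular_Spec[OF subring_set_coord_ring] eval_at_act)
  qed
  moreover have "inv_regular coord_ring (Spec coord_ring) matrix_group matrix_action \<subseteq> coord_ring"
    by (auto simp: inv_regular_def regular_Spec[OF subring_set_coord_ring])
  ultimately show ?thesis
    by (auto simp: inv_ring_def coord_ring_def)
qed

lemma regular_X0: "regular coord_ring X0 = adjoin_inverse coord_ring Delta"
  unfolding X0_def
  using inv_ring_subset Delta_in_inv_ring
  by (intro regular_basic_open subring_set_coord_ring Delta_nonzero) auto

text \<open>The only denominators are powers of the discriminant, which is itself invariant; a
  fraction is thus invariant exactly if its numerator is.\<close>

lemma inv_regular_X0: "inv_regular coord_ring X0 matrix_group matrix_action_X0 = quot_ring"
proof -
  have val: "val coord_ring (matrix_to_point M) (to_fract s / to_fract (disc_poly ^ n)) =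
      eval_at M s / eval_at M disc_poly ^ n" if "matrix_kernel M \<in> X0" for M s n
    using val_matrix_to_point[of M "disc_poly ^ n" s] that by (simp add: matrix_kernel_X0)
  have iff: "to_fract s / to_fract (disc_poly ^ n) \<in> inv_regular coord_ring X0 matrix_group matrix_action_X0 \<longleftrightarrow>
      s \<in> inv_polys" (is "?h \<in> ?I \<longleftrightarrow> _") for s n
  proof
    assume h: "?h \<in> ?I"
    have "eval_at (act g M) s = eval_at M s"
      if "g \<in> carrier matrix_group" and M: "eval_at M disc_poly \<noteq> 0" for g M
    proof -
      have M': "matrix_kernel M \<in> X0"
        using M by (simp add: matrix_kernel_X0)
      then have "val coord_ring (matrix_to_point (act g M)) ?h = val coord_ring (matrix_to_point M) ?h"
        using h that(1) M' unfolding inv_regular_def cpoints_coord_ring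
        by (simp add: matrix_action_X0_matrix_to_point[OF M', symmetric])
      then show ?thesis
        using val[OF M', of s n] val[of "act g M" s n] that M' M
        by (simp add: matrix_kernel_act_X0 eval_at_act[OF disc_poly_in_inv_polys])
    qed
    then show "s \<in> inv_polys"
      by (rule invariant_poly)
  next
    assume s: "s \<in> inv_polys"
    have "?h \<in> regular coord_ring X0"
      unfolding regular_X0 adjoin_inverse_def Delta_eq to_fract_power by auto
    then show "?h \<in> ?I"
      using s by (auto simp: inv_regular_def cpoints_coord_ring matrix_action_X0_matrix_to_point
          val matrix_kernel_act_X0 eval_at_act disc_poly_in_inv_polys)
  qed
  have "?thesis \<longleftrightarrow> (\<forall>h. h \<in> inv_regular coord_ring X0 matrix_group matrix_action_X0 \<longleftrightarrow> h \<in> quot_ring)"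
    by blast
  also have "\<dots>"
  proof (intro allI iffI)
    fix h assume h: "h \<in> inv_regular coord_ring X0 matrix_group matrix_action_X0"
    then have "h \<in> adjoin_inverse coord_ring Delta"
      by (simp add: inv_regular_def regular_X0)
    then obtain s n where "h = to_fract s / to_fract (disc_poly ^ n)"
      by (auto simp: adjoin_inverse_def coord_ring_def Delta_eq to_fract_power)
    then show "h \<in> quot_ring"
      using h iff by (auto simp: quot_ring_iff)
  next
    fix h assume "h \<in> quot_ring"
    then show "h \<in> inv_regular coord_ring X0 matrix_group matrix_action_X0"
      using iff by (auto simp: quot_ring_iff)
  qed
  finally show ?thesis .
qed

section \<open>The quotient map on prime ideals\<close>

definition quot_map :: "mpoly9 fract set \<Rightarrow> mpoly9 fract set" where
  "quot_map = point_map coord_ring quot_ring"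

lemma quot_map:
  assumes p: "prime_in UNIV p" "disc_poly \<notin> p"
  shows "prime_in quot_ring (quot_map (to_fract ` p))"
    and "s \<in> inv_polys \<Longrightarrow> to_fract s \<in> quot_map (to_fract ` p) \<longleftrightarrow> s \<in> p"
    and "s \<in> inv_polys \<Longrightarrow> to_fract s / to_fract (disc_poly ^ n) \<in> quot_map (to_fract ` p) \<longleftrightarrow> s \<in> p"
proof -
  have "prime_in coord_ring (to_fract ` p)"
    using p(1) prime_in_coord_ring[of "to_fract ` p"] Spec_iff[OF subring_set_coord_ring] by blast
  moreover have "Delta \<notin> to_fract ` p"
    using p(2) by (auto simp: Delta_eq)
  moreover have mem: "to_fract s \<in> to_fract ` p \<longleftrightarrow> s \<in> p" for s
    by auto
  ultimately show "prime_in quot_ring (quot_map (to_fract ` p))"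
    "s \<in> inv_polys \<Longrightarrow> to_fract s \<in> quot_map (to_fract ` p) \<longleftrightarrow> s \<in> p"
    "s \<in> inv_polys \<Longrightarrow> to_fract s / to_fract (disc_poly ^ n) \<in> quot_map (to_fract ` p) \<longleftrightarrow> s \<in> p"
    using point_map_adjoin_inverse[OF subring_set_coord_ring subring_set_inv_ring inv_ring_subset Delta_in_inv_ring,
        of "to_fract ` p"]
    unfolding quot_ring_def quot_map_def to_fract_power Delta_eq by (simp_all del: image_iff)
qed

lemma quot_ring_prime:
  assumes q: "prime_in quot_ring q"
  shows "prime_in inv_polys {s \<in> inv_polys. to_fract s \<in> q}" "to_fract disc_poly \<notin> q"
proof -
  note id = prime_in_ideal[OF q]
  have mem: "\<And>s. s \<in> inv_polys \<Longrightarrow> to_fract s \<in> quot_ring"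
    by (rule to_fract_in_quot_ring)
  show "to_fract disc_poly \<notin> q"
    using Spec_adjoin_inverse(2)[OF subring_set_inv_ring Delta_in_inv_ring Delta_nonzero] q
    by (simp add: quot_ring_def Delta_eq)
  show "prime_in inv_polys {s \<in> inv_polys. to_fract s \<in> q}"
    unfolding prime_in_def ideal_in_def
  proof (intro conjI ballI impI)
    show "0 \<in> {s \<in> inv_polys. to_fract s \<in> q}"
      using ideal_in_0[OF id] subring_set_0[OF subring_set_inv_polys] by simp
    show "1 \<notin> {s \<in> inv_polys. to_fract s \<in> q}"
      using prime_in_1[OF q] by simp
  next
    fix a b assume "a \<in> {s \<in> inv_polys. to_fract s \<in> q}" "b \<in> {s \<in> inv_polys. to_fract s \<in> q}"
    then show "a + b \<in> {s \<in> inv_polys. to_fract s \<in> q}"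
      using ideal_in_add[OF id] by (simp add: inv_polys.add)
  next
    fix a b assume "a \<in> inv_polys" "b \<in> {s \<in> inv_polys. to_fract s \<in> q}"
    then show "a * b \<in> {s \<in> inv_polys. to_fract s \<in> q}"
      using ideal_in_lmult[OF id mem] by (simp add: inv_polys.mult)
  next
    fix a b assume "a \<in> inv_polys" "b \<in> inv_polys" "a * b \<in> {s \<in> inv_polys. to_fract s \<in> q}"
    then show "a \<in> {s \<in> inv_polys. to_fract s \<in> q} \<or> b \<in> {s \<in> inv_polys. to_fract s \<in> q}"
      using prime_in_mult[OF q mem mem] by simp
  qed auto
qed

text \<open>\<open>ex_prime_over\<close> for the trace of \<open>q\<close> on
  \<open>inv_polys\<close>, which determines \<open>q\<close>. The discriminant avoids
  \<open>p\<close> because \<open>p\<close> and \<open>q\<close> contain the same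
  invariants.\<close>

lemma ex_quot_map_eq:
  assumes q: "prime_in quot_ring q" and g: "g \<in> carrier matrix_group"
    and a: "to_fract (re_pullback g a) \<notin> q \<or> to_fract (im_pullback g a) \<notin> q"
  shows "\<exists>p. prime_in UNIV p \<and> disc_poly \<notin> p \<and> a \<notin> p \<and> quot_map (to_fract ` p) = q \<and>
    (\<forall>s. to_fract (re_pullback g s) \<in> q \<longrightarrow> to_fract (im_pullback g s) \<in> q \<longrightarrow> s \<in> p)"
proof -
  let ?q = "{s \<in> inv_polys. to_fract s \<in> q}"
  obtain p where p: "prime_in UNIV p" "a \<notin> p" "p \<inter> inv_polys = ?q"
    "\<forall>s. re_pullback g s \<in> ?q \<longrightarrow> im_pullback g s \<in> ?q \<longrightarrow> s \<in> p"
    using ex_prime_over[OF g quot_ring_prime(1)[OF q], of a] a by auto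
  have d: "disc_poly \<notin> p"
    using p(3) quot_ring_prime(2)[OF q] disc_poly_in_inv_polys by blast
  have "quot_map (to_fract ` p) = q"
  proof (rule prime_in_adjoin_inverse_eqI[OF subring_set_inv_ring Delta_in_inv_ring Delta_nonzero])
    show "prime_in (adjoin_inverse inv_ring Delta) (quot_map (to_fract ` p))" "prime_in (adjoin_inverse inv_ring Delta) q"
      using quot_map(1)[OF p(1) d] q by (simp_all add: quot_ring_def)
    fix r assume "r \<in> inv_ring"
    then obtain s where "r = to_fract s" "s \<in> inv_polys"
      by (auto simp: inv_ring_def)
    then show "r \<in> quot_map (to_fract ` p) \<longleftrightarrow> r \<in> q"
      using quot_map(2)[OF p(1) d, of s] p(3) by blast
  qed
  then show ?thesis
    using p(1,2,4) d pullback(1,2) by blast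
qed

lemma X0_obtain:
  assumes "p \<in> X0"
  obtains p' where "p = to_fract ` p'" "prime_in UNIV p'" "disc_poly \<notin> p'"
proof -
  have "p \<in> Spec coord_ring" "Delta \<notin> p"
    using assms by (auto simp: X0_def basic_open_def)
  then show ?thesis
    using that by (auto simp: prime_in_coord_ring Delta_eq)
qed

lemma to_fract_image_X0:
  assumes "prime_in UNIV p" "disc_poly \<notin> p"
  shows "to_fract ` p \<in> X0"
  using assms prime_in_coord_ring by (auto simp: X0_iff)

lemma matrix_kernel_prime: "prime_in UNIV {s. eval_at M s = 0}"
  by (auto simp: prime_in_def ideal_in_def)

lemma quot_map_matrix_kernel:
  assumes "matrix_kernel M \<in> X0" "s \<in> inv_polys"
  shows "to_fract s / to_fract (disc_poly ^ n) \<in> quot_map (matrix_kernel M) \<longleftrightarrow> eval_at M s = 0"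
  using quot_map(3)[OF matrix_kernel_prime, of M s n] assms matrix_kernel_X0[of M]
  by (simp add: matrix_kernel_def)

lemma quot_map_act:
  assumes g: "g \<in> carrier matrix_group" and M: "matrix_kernel M \<in> X0"
  shows "quot_map (matrix_kernel (act g M)) = quot_map (matrix_kernel M)"
proof -
  have M': "matrix_kernel (act g M) \<in> X0"
    using g M by (simp add: matrix_kernel_act_X0)
  have sub: "quot_map (matrix_kernel N) \<subseteq> quot_ring" for N
    by (auto simp: quot_map_def point_map_def)
  have "h \<in> quot_map (matrix_kernel (act g M)) \<longleftrightarrow> h \<in> quot_map (matrix_kernel M)" if "h \<in> quot_ring" for h
    using that by (auto simp: quot_ring_iff quot_map_matrix_kernel M M' eval_at_act[OF _ g])
  then show ?thesis
    using sub by blast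
qed

lemma quot_map_in_Spec: "p \<in> X0 \<Longrightarrow> quot_map p \<in> Spec quot_ring"
  by (erule X0_obtain) (simp add: Spec_iff[OF subring_set_quot_ring] quot_map(1))

text \<open>Lifting along the section itself with \<open>a = 1\<close>, whose pullback 1 lies in no
  prime.\<close>

lemma quot_map_surj:
  assumes "prime_in quot_ring q"
  shows "\<exists>p\<in>X0. quot_map p = q"
proof -
  have "to_fract (re_pullback unit_element 1) \<notin> q"
    using prime_in_1[OF assms] pullback_inv_polys(1)[OF unit_element_in_group subring_set_1[OF subring_set_inv_polys]]
    by simp
  then show ?thesis
    using ex_quot_map_eq[OF assms unit_element_in_group, of 1] to_fract_image_X0 by blast
qed

lemma open_quot_map: "open_map (subtopology (zariski coord_ring) X0) (zariski quot_ring) quot_map"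
  unfolding open_map_def
proof (intro allI impI)
  fix U assume "openin (subtopology (zariski coord_ring) X0) U"
  then obtain T where T: "openin (zariski coord_ring) T" and U: "U = T \<inter> X0"
    by (auto simp: openin_subtopology)
  show "openin (zariski quot_ring) (quot_map ` U)"
    unfolding openin_zariski_iff[OF subring_set_quot_ring]
  proof (intro conjI ballI)
    show "quot_map ` U \<subseteq> Spec quot_ring"
      using quot_map_in_Spec by (auto simp: U)
  next
    fix q assume "q \<in> quot_map ` U"
    then obtain p where p: "p \<in> T" "p \<in> X0" "q = quot_map p"
      by (auto simp: U)
    obtain p' where p': "p = to_fract ` p'" "prime_in UNIV p'" "disc_poly \<notin> p'"
      using X0_obtain[OF p(2)] by blast
    obtain a where a: "to_fract a \<notin> p" "basic_open coord_ring (to_fract a) \<subseteq> T"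
      using T p(1) unfolding openin_zariski_iff[OF subring_set_coord_ring]
      by (auto simp: basic_open_def coord_ring_def)
    then have "a \<notin> p'"
      by (auto simp: p'(1))
    then obtain g where g: "g \<in> carrier matrix_group" "re_pullback g a \<notin> p' \<or> im_pullback g a \<notin> p'"
      using ex_pullback_notin[OF p'(2,3)] by blast
    then obtain r where r: "r \<notin> p'" "r = re_pullback g a \<or> r = im_pullback g a"
      by blast
    then have rI: "r \<in> inv_polys"
      using pullback(1,2) by blast
    \<comment> \<open>The locus of \<open>r\<close> is the required neighbourhood: it contains
      \<open>q\<close> since \<open>r \<notin> p'\<close>, and with the same \<open>g\<close> each
      of its primes lifts to one not containing \<open>a\<close>.\<close>
    show "\<exists>b\<in>quot_ring. q \<in> basic_open quot_ring b \<and> basic_open quot_ring b \<subseteq> quot_map ` U"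
    proof (intro bexI conjI subsetI)
      show "q \<in> basic_open quot_ring (to_fract r)"
        using quot_map_in_Spec[OF p(2)] quot_map(2)[OF p'(2,3) rI] r(1) by (simp add: basic_open_def p(3) p'(1))
    next
      fix q2 assume "q2 \<in> basic_open quot_ring (to_fract r)"
      then have q2: "prime_in quot_ring q2" "to_fract r \<notin> q2"
        by (auto simp: basic_open_def Spec_iff[OF subring_set_quot_ring])
      then obtain p2 where p2: "prime_in UNIV p2" "disc_poly \<notin> p2" "a \<notin> p2" "quot_map (to_fract ` p2) = q2"
        using ex_quot_map_eq[OF q2(1) g(1), of a] r(2) by blast
      have "to_fract ` p2 \<in> basic_open coord_ring (to_fract a)"
        using p2(1,3) prime_in_coord_ring by (auto simp: basic_open_def)
      then show "q2 \<in> quot_map ` U"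
        using a(2) p2 to_fract_image_X0[OF p2(1,2)] by (auto simp: U)
    qed (rule to_fract_in_quot_ring[OF rI])
  qed
qed

section \<open>Sections over open subsets of the quotient\<close>

lemma local_ring_quot_map:
  assumes p: "prime_in UNIV p" "disc_poly \<notin> p" and h: "h \<in> local_ring quot_ring (quot_map (to_fract ` p))"
  shows "\<exists>a\<in>inv_polys. \<exists>s\<in>inv_polys. h = to_fract a / to_fract s \<and> s \<notin> p"
proof -
  obtain b t where bt: "h = b / t" "b \<in> quot_ring" "t \<in> quot_ring" "t \<notin> quot_map (to_fract ` p)"
    using h by (auto simp: local_ring_def)
  obtain a m s n where as: "b = to_fract a / to_fract (disc_poly ^ m)" "t = to_fract s / to_fract (disc_poly ^ n)"
    "a \<in> inv_polys" "s \<in> inv_polys"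
    using bt(2,3) by (auto simp: quot_ring_iff)
  have s: "s \<notin> p"
    using quot_map(3)[OF p as(4)] bt(4) as(2) by simp
  have d: "disc_poly ^ k \<in> inv_polys" "disc_poly ^ k \<notin> p" for k
    using subring_set_power[OF subring_set_inv_polys disc_poly_in_inv_polys]
      prime_in_power[OF subring_set_UNIV p(1)] p(2) by auto
  have "h = to_fract (a * disc_poly ^ n) / to_fract (s * disc_poly ^ m)"
    by (simp add: bt(1) as(1,2))
  moreover have "s * disc_poly ^ m \<notin> p"
    using prime_in_mult[OF p(1), of s "disc_poly ^ m"] s d(2) by auto
  ultimately show ?thesis
    using as(3,4) d(1) inv_polys.mult by blast
qed

text \<open>The hard inclusion needs, at each \<open>q\<close> in \<open>V\<close>, a denominator
  that is invariant and nonzero at \<open>q\<close>. A fraction for \<open>h\<close> is taken at a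
  prime \<open>p\<close> over \<open>q\<close> lifted along the section, and is then replaced by the
  quotients of its pullbacks.\<close>

lemma regular_quot_ring:
  assumes V: "openin (zariski quot_ring) V"
  defines "W \<equiv> {p \<in> X0. quot_map p \<in> V}"
  shows "regular quot_ring V = inv_regular coord_ring W matrix_group matrix_action_X0"
proof (cases "V = {}")
  case True
  then show ?thesis
    by (simp add: W_def regular_def inv_regular_def cpoints_coord_ring)
next
  case False
  have Vsub: "V \<subseteq> Spec quot_ring"
    using V by (simp add: openin_zariski_iff[OF subring_set_quot_ring])
  obtain q0 where q0: "q0 \<in> V" "prime_in quot_ring q0"
    using False Vsub Spec_iff[OF subring_set_quot_ring] by blast
  then have Wne: "W \<noteq> {}"
    using quot_map_surj[OF q0(2)] by (auto simp: W_def)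
  have W: "matrix_kernel M \<in> X0" if "matrix_kernel M \<in> W" for M
    using that by (simp add: W_def)
  have W_act: "matrix_kernel (act g M) \<in> W" if "matrix_kernel M \<in> W" "g \<in> carrier matrix_group" for g M
    using that by (simp add: W_def quot_map_act matrix_kernel_act_X0)
  show ?thesis
  proof (intro equalityI subsetI)
    fix h assume "h \<in> regular quot_ring V"
    then have h: "h \<in> local_ring quot_ring q" if "q \<in> V" for q
      using that by (auto simp: regular_def split: if_splits)
    have ex: "\<exists>a\<in>inv_polys. \<exists>s\<in>inv_polys. h = to_fract a / to_fract s \<and> to_fract s \<notin> p" if p: "p \<in> W" for p
    proof -
      obtain p' where p': "p = to_fract ` p'" "prime_in UNIV p'" "disc_poly \<notin> p'"
        using p X0_obtain[of p] by (auto simp: W_def)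
      have "h \<in> local_ring quot_ring (quot_map (to_fract ` p'))"
        using h p p'(1) by (simp add: W_def)
      then obtain a s where "a \<in> inv_polys" "s \<in> inv_polys" "h = to_fract a / to_fract s" "s \<notin> p'"
        using local_ring_quot_map[OF p'(2,3)] by blast
      moreover from this have "to_fract s \<notin> p"
        by (auto simp: p'(1))
      ultimately show ?thesis
        by blast
    qed
    have "h \<in> local_ring coord_ring p" if "p \<in> W" for p
      using ex[OF that] unfolding local_ring_def by (blast intro: to_fract_in_coord_ring)
    moreover have "val coord_ring (matrix_action_X0 g (matrix_to_point M)) h = val coord_ring (matrix_to_point M) h"
      if g: "g \<in> carrier matrix_group" and M: "matrix_kernel M \<in> W" for g M
    proof -
      obtain a s where as: "a \<in> inv_polys" "s \<in> inv_polys" "h = to_fract a / to_fract s" "to_fract s \<notin> matrix_kernel M"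
        using ex[OF M] by blast
      then show ?thesis
        using val_matrix_to_point[of M s a] val_matrix_to_point[of "act g M" s a]
        by (simp add: matrix_action_X0_matrix_to_point[OF W[OF M]] eval_at_act[OF _ g])
    qed
    ultimately show "h \<in> inv_regular coord_ring W matrix_group matrix_action_X0"
      using Wne by (auto simp: inv_regular_def regular_def cpoints_coord_ring)
  next
    fix h assume h: "h \<in> inv_regular coord_ring W matrix_group matrix_action_X0"
    then have loc: "h \<in> local_ring coord_ring p" if "p \<in> W" for p
      using that Wne by (auto simp: inv_regular_def regular_def)
    have inv: "val coord_ring (matrix_to_point (act g M)) h = val coord_ring (matrix_to_point M) h"
      if M: "matrix_kernel M \<in> W" and g: "g \<in> carrier matrix_group" for g M
      using h g M unfolding inv_regular_def cpoints_coord_ring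
      by (simp add: matrix_action_X0_matrix_to_point[OF W[OF M], symmetric])
    \<comment> \<open>The relation also holds where \<open>s\<close> vanishes: it is transported
      from a fraction \<open>b / t\<close> with \<open>t\<close> nonzero at
      \<open>M\<close>.\<close>
    have val: "eval_at M a = val coord_ring (matrix_to_point M) h * eval_at M s"
      if M: "matrix_kernel M \<in> W" and "h = to_fract a / to_fract s" "s \<noteq> 0" for M a s
    proof -
      obtain b t where bt: "h = to_fract b / to_fract t" "eval_at M t \<noteq> 0"
        using loc[OF M] by (auto simp: local_ring_def coord_ring_def)
      then have "t \<noteq> 0"
        by auto
      then have "to_fract a * to_fract t = to_fract b * to_fract s"
        using that(2,3) bt(1) by (simp add: field_simps)
      then have "a * t = b * s"
        by (simp only: to_fract_mult[symmetric] to_fract_eq_iff)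
      then have "eval_at M (a * t) = eval_at M (b * s)"
        by (rule arg_cong)
      then have "eval_at M a * eval_at M t = eval_at M b * eval_at M s"
        by (simp only: eval_at_simps)
      then have "eval_at M a = eval_at M b / eval_at M t * eval_at M s"
        using bt(2) by (simp add: eq_divide_eq)
      then show ?thesis
        using val_matrix_to_point[OF bt(2), of b] bt(1) by simp
    qed
    \<comment> \<open>A basic open set inside \<open>V\<close> provides the nonzero polynomial
      \<open>r0 * disc_poly\<close> off whose zeros every complex matrix lies over \<open>V\<close>;
      \<open>invariant_fraction\<close> is applied with it.\<close>
    obtain b0 where b0: "b0 \<in> quot_ring" "q0 \<in> basic_open quot_ring b0" "basic_open quot_ring b0 \<subseteq> V"
      using V q0(1) unfolding openin_zariski_iff[OF subring_set_quot_ring] by blast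
    obtain r0 n0 where r0: "b0 = to_fract r0 / to_fract (disc_poly ^ n0)" "r0 \<in> inv_polys"
      using b0(1) by (auto simp: quot_ring_iff)
    have "r0 \<noteq> 0"
      using b0(2) r0(1) ideal_in_0[OF prime_in_ideal[OF q0(2)]] by (auto simp: basic_open_def)
    then have w: "r0 * disc_poly \<noteq> 0"
      using disc_poly_nonzero by simp
    have wW: "matrix_kernel M \<in> W" if "eval_at M (r0 * disc_poly) \<noteq> 0" for M
    proof -
      have M: "matrix_kernel M \<in> X0"
        using that by (simp add: matrix_kernel_X0)
      then have "quot_map (matrix_kernel M) \<in> basic_open quot_ring b0"
        using quot_map_in_Spec[OF M] quot_map_matrix_kernel[OF M r0(2)] that
        by (simp add: basic_open_def r0(1))
      then show ?thesis
        using b0(3) M by (auto simp: W_def)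
    qed
    have "h \<in> local_ring quot_ring q" if q: "q \<in> V" for q
    proof -
      have qp: "prime_in quot_ring q"
        using q Vsub Spec_iff[OF subring_set_quot_ring] by blast
      let ?r = "re_pullback unit_element" and ?i = "im_pullback unit_element"
      have "to_fract (?r 1) \<notin> q"
        using prime_in_1[OF qp] pullback_inv_polys(1)[OF unit_element_in_group subring_set_1[OF subring_set_inv_polys]]
        by simp
      then obtain p where p: "prime_in UNIV p" "disc_poly \<notin> p" "quot_map (to_fract ` p) = q"
        "\<And>s. to_fract (?r s) \<in> q \<Longrightarrow> to_fract (?i s) \<in> q \<Longrightarrow> s \<in> p"
        using ex_quot_map_eq[OF qp unit_element_in_group, of 1] by blast
      have "to_fract ` p \<in> W"
        using to_fract_image_X0[OF p(1,2)] p(3) q by (simp add: W_def)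
      then obtain a s where as: "h = to_fract a / to_fract s" "s \<notin> p"
        using loc[of "to_fract ` p"] by (auto simp: local_ring_def coord_ring_def)
      then have s0: "s \<noteq> 0"
        using ideal_in_0[OF prime_in_ideal[OF p(1)]] by auto
      have cross: "eval_at (inv_sect M) a * eval_at M s = eval_at M a * eval_at (inv_sect M) s"
        if M: "eval_at M (r0 * disc_poly) \<noteq> 0" for M
      proof -
        have MW: "matrix_kernel M \<in> W"
          by (rule wW[OF M])
        obtain g where g: "g \<in> carrier matrix_group" "act g M = inv_sect M"
          using ex_act_eq[of M "inv_sect M"] M by auto
        show ?thesis
          using val[OF MW as(1) s0] val[OF W_act[OF MW g(1)] as(1) s0] inv[OF MW g(1)] g(2) by simp
      qed
      have eq: "?r a * s = a * ?r s" "?i a * s = a * ?i s"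
        using invariant_fraction[OF w cross] by simp_all
      have frac: "h \<in> local_ring quot_ring q"
        if uv: "u \<in> inv_polys" "v \<in> inv_polys" "u * s = a * v" "to_fract v \<notin> q" for u v
      proof -
        have "v \<noteq> 0"
          using uv(4) ideal_in_0[OF prime_in_ideal[OF qp]] by auto
        moreover have "to_fract u * to_fract s = to_fract a * to_fract v"
          by (simp only: to_fract_mult[symmetric] uv(3))
        ultimately have "h = to_fract u / to_fract v"
          using s0 by (simp add: as(1) field_simps)
        then show ?thesis
          unfolding local_ring_def using uv to_fract_in_quot_ring by blast
      qed
      \<comment> \<open>\<open>h\<close> is the quotient of the real parts or of the imaginary
        parts. Not both of these denominators lie in \<open>q\<close>, since otherwise
        \<open>s\<close> would lie in \<open>p\<close>.\<close>
      show ?thesis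
        using frac[OF pullback(1) pullback(1) eq(1)] frac[OF pullback(2) pullback(2) eq(2)] p(4)[of s] as(2)
        by blast
    qed
    then show "h \<in> regular quot_ring V"
      using False by (simp add: regular_def)
  qed
qed

section \<open>Finite generation\<close>

lemma a_inv_ring_of_type_algebra: "\<ominus>\<^bsub>ring_of_type_algebra\<^esub> h = - (h :: 'k::field)"
proof -
  interpret cring "ring_of_type_algebra :: 'k ring"
    by (rule cring_from_type_algebra)
  show ?thesis
    by (rule minus_equality) (simp_all add: ring_of_type_algebra_def)
qed

lemma subring_set_generate_ring:
  "subring_set (generate_ring ring_of_type_algebra (H :: 'k::field set))"
proof -
  let ?S = "generate_ring ring_of_type_algebra H"
  have add: "a + b \<in> ?S" and mult: "a * b \<in> ?S" if "a \<in> ?S" "b \<in> ?S" for a b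
    using generate_ring.eng_add[OF that] generate_ring.eng_mult[OF that]
    by (simp_all add: ring_of_type_algebra_def)
  moreover have "- b \<in> ?S" if "b \<in> ?S" for b
    using generate_ring.a_inv[OF that] by (simp add: a_inv_ring_of_type_algebra)
  moreover have "1 \<in> ?S"
    using generate_ring.one[of ring_of_type_algebra H] by (simp add: ring_of_type_algebra_def)
  ultimately show ?thesis
    unfolding subring_set_def using add[of _ "- _"] by (metis diff_conv_add_uminus)
qed

lemma generate_ring_subset:
  assumes "subring_set S" "H \<subseteq> S"
  shows "generate_ring ring_of_type_algebra H \<subseteq> (S :: 'k::field set)"
proof
  fix h assume "h \<in> generate_ring ring_of_type_algebra H"
  then show "h \<in> S"
  proof (induction rule: generate_ring.induct)
    case (a_inv h)
    then show ?case
      using subring_set_uminus[OF assms(1)] by (simp add: a_inv_ring_of_type_algebra)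
  next
    case (eng_add a b)
    then show ?case
      using subring_set_add[OF assms(1)] by (simp add: ring_of_type_algebra_def)
  next
    case (eng_mult a b)
    then show ?case
      using subring_set_mult[OF assms(1)] by (simp add: ring_of_type_algebra_def)
  qed (use assms in \<open>auto simp: ring_of_type_algebra_def subring_set_1\<close>)
qed

lemma affine_varietyI:
  fixes S :: "'k::{field,real_algebra} set"
  assumes "subring_set S" "finite F" "range real_const \<union> F \<subseteq> S"
    and "\<And>T. subring_set T \<Longrightarrow> range real_const \<union> F \<subseteq> T \<Longrightarrow> S \<subseteq> T"
  shows "affine_variety S"
proof -
  have "S = generate_ring ring_of_type_algebra (range real_const \<union> F)"
  proof
    show "S \<subseteq> generate_ring ring_of_type_algebra (range real_const \<union> F)"
      by (rule assms(4)[OF subring_set_generate_ring]) (auto intro: generate_ring.incl)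
    show "generate_ring ring_of_type_algebra (range real_const \<union> F) \<subseteq> S"
      by (rule generate_ring_subset[OF assms(1,3)])
  qed
  then show ?thesis
    unfolding affine_variety_def using assms(2) by blast
qed

lemma affine_variety_coord_ring: "affine_variety coord_ring"
proof (rule affine_varietyI[OF subring_set_coord_ring])
  show "finite (to_fract ` range (var_poly :: entry \<Rightarrow> mpoly9))"
    by simp
  show "range real_const \<union> to_fract ` range var_poly \<subseteq> coord_ring"
    by (auto simp: real_const_eq)
next
  fix T :: "mpoly9 fract set"
  assume T: "subring_set T" and gen: "range real_const \<union> to_fract ` range var_poly \<subseteq> T"
  have "to_fract s \<in> T" for s
  proof (induction s rule: mpoly_induct)
    case (const c)
    then show ?case
      using gen by (auto simp: real_const_eq)
  next
    case (var v)
    then show ?case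
      using gen by auto
  qed (simp_all add: subring_set_add[OF T] subring_set_mult[OF T])
  then show "coord_ring \<subseteq> T"
    by (auto simp: coord_ring_def)
qed

lemma affine_variety_quot_ring: "affine_variety quot_ring"
proof (rule affine_varietyI[OF subring_set_quot_ring])
  let ?F = "{to_fract (inv1 generic_matrix), to_fract (inv2 generic_matrix),
    to_fract (Determinants.det generic_matrix), 1 / Delta}"
  show "finite ?F"
    by simp
  have "1 / Delta \<in> quot_ring"
    using inverse_power_in_adjoin_inverse[OF subring_set_inv_ring, of Delta 1] by (simp add: quot_ring_def)
  then show "range real_const \<union> ?F \<subseteq> quot_ring"
    by (auto simp: real_const_eq intro: to_fract_in_quot_ring inv_polys.intros)
  fix T :: "mpoly9 fract set"
  assume T: "subring_set T" and gen: "range real_const \<union> ?F \<subseteq> T"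
  have inv: "to_fract s \<in> T" if "s \<in> inv_polys" for s
    using that
  proof (induction s)
    case (const c)
    then show ?case
      using gen by (auto simp: real_const_eq)
  qed (use gen in \<open>simp_all add: subring_set_add[OF T] subring_set_mult[OF T]\<close>)
  have "to_fract r / to_fract (disc_poly ^ n) = to_fract r * (1 / Delta) ^ n" for r n
    by (simp add: Delta_eq to_fract_power power_one_over)
  moreover have "(1 / Delta) ^ n \<in> T" for n
    using gen by (intro subring_set_power[OF T]) simp
  ultimately show "quot_ring \<subseteq> T"
    using inv subring_set_mult[OF T] by (auto simp: quot_ring_iff)
qed

section \<open>Complex points of the quotient\<close>

lemma cpoint_map_matrix_to_point:
  assumes "eval_at M disc_poly \<noteq> 0" "r \<in> inv_polys"
  shows "cpoint_map coord_ring quot_ring (matrix_to_point M) (to_fract r / to_fract (disc_poly ^ n)) =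
    eval_at M r / eval_at M disc_poly ^ n"
proof -
  have "to_fract r / to_fract (disc_poly ^ n) \<in> quot_ring"
    using assms(2) by (auto simp: quot_ring_iff)
  then show ?thesis
    using val_matrix_to_point[of M "disc_poly ^ n" r] assms(1) by (simp add: cpoint_map_def)
qed

lemma cpoint_map_to_fract:
  assumes "eval_at M disc_poly \<noteq> 0" "r \<in> inv_polys"
  shows "cpoint_map coord_ring quot_ring (matrix_to_point M) (to_fract r) = eval_at M r"
  using cpoint_map_matrix_to_point[OF assms, of 0] by simp

lemma extensional_eqI_quot_ring:
  assumes "x \<in> extensional quot_ring" "y \<in> extensional quot_ring"
    and "\<And>r n. r \<in> inv_polys \<Longrightarrow>
      x (to_fract r / to_fract (disc_poly ^ n)) = y (to_fract r / to_fract (disc_poly ^ n))"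
  shows "x = y"
  using assms by (intro extensionalityI[of _ quot_ring]) (auto simp: quot_ring_iff)

lemma cpoint_map_in_cpoints:
  assumes M: "eval_at M disc_poly \<noteq> 0"
  shows "cpoint_map coord_ring quot_ring (matrix_to_point M) \<in> cpoints quot_ring (Spec quot_ring)"
proof -
  let ?y = "cpoint_map coord_ring quot_ring (matrix_to_point M)"
  have "?y (b + c) = ?y b + ?y c \<and> ?y (b * c) = ?y b * ?y c" if bc: "b \<in> quot_ring" "c \<in> quot_ring" for b c
  proof -
    obtain r m s n where *: "b = to_fract r / to_fract (disc_poly ^ m)" "c = to_fract s / to_fract (disc_poly ^ n)"
      "r \<in> inv_polys" "s \<in> inv_polys"
      using bc by (auto simp: quot_ring_iff)
    have d: "disc_poly ^ k \<in> inv_polys" for k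
      using subring_set_power[OF subring_set_inv_polys disc_poly_in_inv_polys] .
    have sum: "b + c = to_fract (r * disc_poly ^ n + s * disc_poly ^ m) / to_fract (disc_poly ^ (m + n))"
      and prod: "b * c = to_fract (r * s) / to_fract (disc_poly ^ (m + n))"
      using disc_poly_nonzero by (simp_all add: *(1,2) to_fract_power power_add field_simps)
    have mem: "r * disc_poly ^ n + s * disc_poly ^ m \<in> inv_polys" "r * s \<in> inv_polys"
      using * d by (intro inv_polys.add inv_polys.mult; simp)+
    let ?d = "eval_at M disc_poly"
    have "?y (b + c) = (eval_at M r * ?d ^ n + eval_at M s * ?d ^ m) / ?d ^ (m + n)"
      "?y (b * c) = eval_at M r * eval_at M s / ?d ^ (m + n)"
      unfolding sum prod cpoint_map_matrix_to_point[OF M mem(1)] cpoint_map_matrix_to_point[OF M mem(2)]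
      by simp_all
    moreover have "?y b = eval_at M r / ?d ^ m" "?y c = eval_at M s / ?d ^ n"
      unfolding *(1,2) cpoint_map_matrix_to_point[OF M *(3)] cpoint_map_matrix_to_point[OF M *(4)]
      by simp_all
    ultimately show ?thesis
      using M by (simp add: power_add add_divide_distrib)
  qed
  moreover have "?y 1 = 1"
    using cpoint_map_to_fract[OF M subring_set_1[OF subring_set_inv_polys]] by simp
  ultimately have hom: "?y \<in> ring_hom (subring_of quot_ring) ring_of_type_algebra"
    by (simp add: ring_hom_subring_of_iff)
  then show ?thesis
    using kernel_in_Spec[OF subring_set_quot_ring hom] cpoint_map_to_fract[OF M inv_polys.const]
    by (auto simp: cpoints_def real_const_eq cpoint_map_def)
qed

text \<open>A complex point assigns values to the three basic invariants, and \<open>sect\<close>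
  realises any three values by a matrix.\<close>

lemma cpoint_map_surj:
  assumes y: "y \<in> cpoints quot_ring (Spec quot_ring)"
  shows "\<exists>M. eval_at M disc_poly \<noteq> 0 \<and> y = cpoint_map coord_ring quot_ring (matrix_to_point M)"
proof -
  have hom: "y 1 = 1" "\<And>a b. a \<in> quot_ring \<Longrightarrow> b \<in> quot_ring \<Longrightarrow> y (a + b) = y a + y b"
    "\<And>a b. a \<in> quot_ring \<Longrightarrow> b \<in> quot_ring \<Longrightarrow> y (a * b) = y a * y b"
    and real: "\<And>r. y (real_const r) = of_real r" and ext: "y \<in> extensional quot_ring"
    using y by (auto simp: cpoints_def ring_hom_subring_of_iff)
  define M where "M = sect (y (to_fract (inv1 generic_matrix))) (y (to_fract (inv2 generic_matrix)))
    (y (to_fract (Determinants.det generic_matrix)))"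
  have eval: "y (to_fract s) = eval_at M s" if "s \<in> inv_polys" for s
    using that
  proof (induction s)
    case (const c)
    then show ?case
      using real[of c] by (simp add: real_const_eq)
  next
    case (add p q)
    then show ?case
      by (simp add: hom to_fract_in_quot_ring)
  next
    case (mult p q)
    then show ?case
      by (simp add: hom to_fract_in_quot_ring)
  qed (simp_all add: M_def inv_sect)
  have frac: "y (to_fract r / to_fract (disc_poly ^ n)) * eval_at M disc_poly ^ n = eval_at M r"
    if r: "r \<in> inv_polys" for r n
  proof -
    have d: "disc_poly ^ n \<in> inv_polys"
      using subring_set_power[OF subring_set_inv_polys disc_poly_in_inv_polys] .
    have "to_fract r / to_fract (disc_poly ^ n) * to_fract (disc_poly ^ n) = to_fract r"
      using disc_poly_nonzero by (simp add: to_fract_power)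
    moreover have "to_fract r / to_fract (disc_poly ^ n) \<in> quot_ring"
      using r by (auto simp: quot_ring_iff)
    ultimately show ?thesis
      using hom(3)[OF _ to_fract_in_quot_ring[OF d], of "to_fract r / to_fract (disc_poly ^ n)"] eval[OF d] eval[OF r]
      by simp
  qed
  \<comment> \<open>The value of \<open>y\<close> at the inverse of the discriminant is an inverse
    of its value at \<open>M\<close>.\<close>
  have "eval_at M disc_poly \<noteq> 0"
    using frac[OF subring_set_1[OF subring_set_inv_polys], of 1] by auto
  moreover from this have "y = cpoint_map coord_ring quot_ring (matrix_to_point M)"
    by (intro extensional_eqI_quot_ring ext)
      (use frac in \<open>auto simp: cpoint_map_matrix_to_point eq_divide_eq, simp add: cpoint_map_def\<close>)
  ultimately show ?thesis
    by blast
qed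

text \<open>Equal images agree on the three basic invariants, which separate the orbits where the
  discriminant is nonzero.\<close>

lemma cpoint_map_eq_iff:
  assumes "eval_at M disc_poly \<noteq> 0" "eval_at N disc_poly \<noteq> 0"
  shows "cpoint_map coord_ring quot_ring (matrix_to_point M) = cpoint_map coord_ring quot_ring (matrix_to_point N)
    \<longleftrightarrow> (\<exists>g\<in>carrier matrix_group. act g M = N)"
proof
  assume eq: "cpoint_map coord_ring quot_ring (matrix_to_point M) =
    cpoint_map coord_ring quot_ring (matrix_to_point N)"
  have "eval_at M s = eval_at N s" if "s \<in> inv_polys" for s
    using cpoint_map_to_fract[OF assms(1) that] cpoint_map_to_fract[OF assms(2) that] eq by simp
  from this[OF inv_polys.inv1] this[OF inv_polys.inv2] this[OF inv_polys.det]
  show "\<exists>g\<in>carrier matrix_group. act g M = N"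
    using ex_act_eq[OF assms(1)] by simp
next
  assume "\<exists>g\<in>carrier matrix_group. act g M = N"
  then have "eval_at M s = eval_at N s" if "s \<in> inv_polys" for s
    using eval_at_act[OF that] by auto
  then show "cpoint_map coord_ring quot_ring (matrix_to_point M) =
    cpoint_map coord_ring quot_ring (matrix_to_point N)"
    using assms disc_poly_in_inv_polys
    by (intro extensional_eqI_quot_ring)
      (auto simp: cpoint_map_matrix_to_point, simp_all add: cpoint_map_def)
qed

lemma cpoints_X0: "cpoints coord_ring X0 = matrix_to_point ` {M. eval_at M disc_poly \<noteq> 0}"
  by (simp add: cpoints_coord_ring matrix_kernel_X0)

lemma orbit_X0:
  "eval_at M disc_poly \<noteq> 0 \<Longrightarrow>
    orbit matrix_group matrix_action_X0 (matrix_to_point M) = matrix_to_point ` {act g M | g. g \<in> carrier matrix_group}"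
  by (auto simp: orbit_def matrix_action_X0_matrix_to_point matrix_kernel_X0)

lemma bij_betw_orbits:
  "bij_betw (\<lambda>orb. the_elem (cpoint_map coord_ring quot_ring ` orb))
    (orbits matrix_group (cpoints coord_ring X0) matrix_action_X0) (cpoints quot_ring (Spec quot_ring))"
proof -
  let ?c = "\<lambda>M. cpoint_map coord_ring quot_ring (matrix_to_point M)"
  let ?o = "\<lambda>M. orbit matrix_group matrix_action_X0 (matrix_to_point M)"
  have orbits: "orbits matrix_group (cpoints coord_ring X0) matrix_action_X0 = ?o ` {M. eval_at M disc_poly \<noteq> 0}"
    by (auto simp: orbits_def cpoints_X0)
  \<comment> \<open>The image of an orbit is a singleton, so \<open>the_elem\<close> picks the
    common value.\<close>
  have elem: "the_elem (cpoint_map coord_ring quot_ring ` ?o M) = ?c M" if M: "eval_at M disc_poly \<noteq> 0" for M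
  proof -
    have c: "?c (act g M) = ?c M" if "g \<in> carrier matrix_group" for g
      using cpoint_map_eq_iff[of M "act g M"] M that eval_at_act[OF disc_poly_in_inv_polys that, of M] by auto
    have "act unit_element M \<in> {act g M | g. g \<in> carrier matrix_group}"
      using unit_element_in_group by blast
    then have "?c ` {act g M | g. g \<in> carrier matrix_group} = {?c M}"
      using c by (auto simp del: split_paired_Ex split_paired_All)
    then have "cpoint_map coord_ring quot_ring ` ?o M = {?c M}"
      by (simp only: orbit_X0[OF M] image_image)
    then show ?thesis
      by simp
  qed
  have orbit_eq: "?o M = ?o N" if M: "eval_at M disc_poly \<noteq> 0" and N: "eval_at N disc_poly \<noteq> 0" and "?c M = ?c N" for M N
  proof -
    interpret G: group matrix_group
      by (rule group_matrix_group)
    obtain g where g: "g \<in> carrier matrix_group" "act g M = N"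
      using cpoint_map_eq_iff[OF M N] \<open>?c M = ?c N\<close> by blast
    have "act h M \<in> {act g N | g. g \<in> carrier matrix_group}" if h: "h \<in> carrier matrix_group" for h
    proof -
      have "act (h \<otimes>\<^bsub>matrix_group\<^esub> inv\<^bsub>matrix_group\<^esub> g) N = act h M"
        using g h by (simp add: g(2)[symmetric] act_mult[symmetric] G.m_assoc)
      then show ?thesis
        using g(1) h by (metis (mono_tags, lifting) G.inv_closed G.m_closed mem_Collect_eq)
    qed
    moreover have "act h N \<in> {act g M | g. g \<in> carrier matrix_group}" if h: "h \<in> carrier matrix_group" for h
      using act_mult[of h g M] g h by (metis (mono_tags, lifting) G.m_closed mem_Collect_eq)
    ultimately have "{act g M | g. g \<in> carrier matrix_group} = {act g N | g. g \<in> carrier matrix_group}"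
      by blast
    then show ?thesis
      by (simp add: orbit_X0 M N)
  qed
  show ?thesis
    unfolding bij_betw_def orbits
  proof
    show "inj_on (\<lambda>orb. the_elem (cpoint_map coord_ring quot_ring ` orb)) (?o ` {M. eval_at M disc_poly \<noteq> 0})"
    proof (rule inj_onI)
      fix o1 o2 assume "o1 \<in> ?o ` {M. eval_at M disc_poly \<noteq> 0}" "o2 \<in> ?o ` {M. eval_at M disc_poly \<noteq> 0}"
        and eq: "the_elem (cpoint_map coord_ring quot_ring ` o1) = the_elem (cpoint_map coord_ring quot_ring ` o2)"
      then obtain M N where MN: "o1 = ?o M" "eval_at M disc_poly \<noteq> 0" "o2 = ?o N" "eval_at N disc_poly \<noteq> 0"
        by blast
      have "?c M = ?c N"
        using eq unfolding MN(1,3) elem[OF MN(2)] elem[OF MN(4)] .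
      then show "o1 = o2"
        unfolding MN(1,3) by (rule orbit_eq[OF MN(2,4)])
    qed
    show "(\<lambda>orb. the_elem (cpoint_map coord_ring quot_ring ` orb)) ` ?o ` {M. eval_at M disc_poly \<noteq> 0} =
        cpoints quot_ring (Spec quot_ring)"
      using cpoint_map_surj cpoint_map_in_cpoints by (force simp: elem image_image)
  qed
qed

lemma geometric_quotient_X0: "geometric_quotient coord_ring X0 matrix_group matrix_action_X0 quot_ring"
proof -
  have "openin (zariski coord_ring) X0"
    unfolding X0_def using inv_ring_subset Delta_in_inv_ring by (intro openin_zariski_basic_open) auto
  moreover have "quot_ring \<subseteq> regular coord_ring X0"
    unfolding inv_regular_X0[symmetric] by (auto simp: inv_regular_def)
  moreover have "cpoint_map coord_ring quot_ring (matrix_action_X0 g x) = cpoint_map coord_ring quot_ring x"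
    if g: "g \<in> carrier matrix_group" and x: "x \<in> cpoints coord_ring X0" for g x
  proof -
    obtain M where M: "x = matrix_to_point M" "eval_at M disc_poly \<noteq> 0"
      using x by (auto simp: cpoints_X0)
    then show ?thesis
      using cpoint_map_eq_iff[of M "act g M"] g eval_at_act[OF disc_poly_in_inv_polys g, of M]
      by (auto simp: matrix_action_X0_matrix_to_point matrix_kernel_X0)
  qed
  ultimately show ?thesis
    unfolding geometric_quotient_def
    using affine_variety_coord_ring group_action_X0 affine_variety_quot_ring bij_betw_orbits
      open_quot_map[unfolded quot_map_def] regular_quot_ring[unfolded quot_map_def]
    by blast
qed

theorem theorem4p2:
  "Delta \<in> inv_regular coord_ring (Spec coord_ring) matrix_group matrix_action \<and>
   cpoints coord_ring X0 =
     {x \<in> cpoints coord_ring (Spec coord_ring).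
        distinct_eigenvalues
          (point_to_matrix x ** Finite_Cartesian_Product.transpose (point_to_matrix x))} \<and>
   inv_regular coord_ring X0 matrix_group matrix_action_X0 =
     adjoin_inverse (inv_regular coord_ring (Spec coord_ring) matrix_group matrix_action) Delta \<and>
   geometric_quotient coord_ring X0 matrix_group matrix_action_X0
     (inv_regular coord_ring X0 matrix_group matrix_action_X0) \<and>
   invariant_open coord_ring X0 matrix_group matrix_action \<and>
   zariski coord_ring closure_of X0 = Spec coord_ring \<and>
   geometric_rational_quotient coord_ring matrix_group matrix_action
     (inv_regular coord_ring X0 matrix_group matrix_action_X0)"
proof -
  have points: "cpoints coord_ring X0 =
     {x \<in> cpoints coord_ring (Spec coord_ring).
        distinct_eigenvalues
          (point_to_matrix x ** Finite_Cartesian_Product.transpose (point_to_matrix x))}"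
    unfolding cpoints_X0 unfolding cpoints_coord_ring
    by (auto simp: matrix_kernel_in_Spec eval_at_disc_poly_nonzero)
  have inv_open: "invariant_open coord_ring X0 matrix_group matrix_action"
    using geometric_quotient_X0
    by (auto simp: invariant_open_def geometric_quotient_def cpoints_coord_ring matrix_action_matrix_to_point
        matrix_kernel_act_X0)
  have dense: "zariski coord_ring closure_of X0 = Spec coord_ring"
    unfolding X0_def by (rule basic_open_dense[OF subring_set_coord_ring Delta_nonzero])
  \<comment> \<open>After the two invariant rings are identified, the localisation statement is the
    definition of \<open>quot_ring\<close>, and the open set of the rational quotient is
    \<open>X0\<close>.\<close>
  show ?thesis
    unfolding inv_regular_X0 inv_regular_Spec geometric_rational_quotient_def
    using Delta_in_inv_ring points geometric_quotient_X0 inv_open dense group_action_Spec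
    by (auto simp: quot_ring_def matrix_action_X0_def)
qed

end
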